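(* Let $r(a,x)$ be a symmetric noncommutative rational function in $a=(a_1,\dots,a_h)$ and $x=(x_1,\dots,x_g)$, regular at the origin, given by a symmetric minimal realization, and let $\operatorname{dom} r$ and $\operatorname{dom}^+ r$ be as defined in the context. Then the set $\operatorname{dom}^+ r$ is a domain of partial convexity for $r$. Conversely, if $\mathcal D\subseteq \operatorname{dom} r$ is a full domain of partial convexity for $r$, then $\mathcal D\subseteq \operatorname{dom}^+ r$, and $\operatorname{dom}^+ r$ is also a full domain of partial convexity for $r$.
   Context: Let $h,g$ be positive integers. $\mathbb S_n^k$ is the set of $k$-tuples of $n\times n$ complex hermitian matrices. A subset $\mathcal D$ of $\mathbb S^h\times\mathbb S^g=(\mathbb S^h_n\times\mathbb S^g_n)_{n\ge 1}$ is a sequence $(\mathcal D_n)_n$ with $\mathcal D_n\subseteq \mathbb S^h_n\times\mathbb S^g_n$; elements are written $(A,X)$. It is open if each $\mathcal D_n$ is open. It is free if it is closed under (componentwise) direct sums and under simultaneous unitary conjugation $(A,X)\mapsto U^*(A,X)U$. A noncommutative (nc) rational function in the freely noncommuting variables $a,x$ is given by a syntactically valid expression in $a,x,+,\cdot,(\,)^{-1}$ and complex scalars, evaluated on tuples of matrices of any size in the natural way; $r$ is symmetric if $r(A,X)=r(A,X)^*$ for hermitian tuples in its domain, and regular at the origin if $0$ is in its domain. Such an $r$ (symmetric and regular at the origin) has a symmetric minimal realization (SMR) $$r(a,x)=c^*\Big(J-\sum_{i=1}^g T_ix_i-\sum_{j=1}^h S_ja_j\Big)^{-1}c,$$ where for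 some positive integer $e$, $J$ is an $e\times e$ matrix with $J^2=I$, $J^*=J$, the $S_j,T_i$ are hermitian $e\times e$ matrices, $c\in\mathbb C^e$, and $e$ is the smallest possible. Define $$\operatorname{dom} r=\Big\{(A,X)\in\mathbb S^h\times\mathbb S^g:\det\Big(J\otimes I-\sum_i T_i\otimes X_i-\sum_j S_j\otimes A_j\Big)\neq 0\Big\}.$$ Let $V_T$ be the inclusion into $\mathbb C^e$ of the span of the ranges of the $T_i$, let $R_T(a,x)=V_T^*\big(J-\sum_i T_ix_i-\sum_j S_ja_j\big)^{-1}V_T$ (so $R_T(A,X)=(V_T\otimes I)^*(J\otimes I-\sum_i T_i\otimes X_i-\sum_j S_j\otimes A_j)^{-1}(V_T\otimes I)$), and $$\operatorname{dom}^+ r=\{(A,X)\in\operatorname{dom} r: R_T(A,X)\succeq 0\}.$$ These definitions do not depend on the choice of SMR. For $\mathcal D\subseteq\mathbb S^h\times\mathbb S^g$ and $A\in\mathbb S^h_k$ let $\mathcal D[A]=\{X\in\mathbb S^g_k:(A,X)\in\mathcal D\}$. A free set $\mathcal D$ is convex (resp. open) in $x$ if $\mathcal D[A]$ is convex (resp. open) for each $A\in\mathbb S^h$. For $\mathcal D\subseteq\operatorname{dom} r$, $r$ is convex in $x$ on $\mathcal D$ if $r(A,\frac{X+Y}2)\preceq\frac12(r(A,X)+r(A,Y))$ whenever $(A,X),(A,Y),(A,\frac{X+Y}2)\in\mathcal D$. A free set $\mathcal D$ is a domain of partial convexity for $r$ if it is open in $x$, convex in $x$ and $r$ is convex in $x$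 on $\mathcal D$. It is a full domain of partial convexity if in addition $\mathcal D$ contains a free open set $\mathcal U$ with $\mathcal U_1\neq\emptyset$.
   Formalization: The size e of a symmetric minimal realization may be 0, not only positive; this affects only r = 0, where size-1 realizations with c = 0 make dom r and dom⁺ r depend on the choice and the converse false (J = T = 1, S = 0, D = {X > I}). *)

theory Defs
  imports
    "Jordan_Normal_Form.Schur_Decomposition"
    "Jordan_Normal_Form.Gauss_Jordan_Elimination"
    "Jordan_Normal_Form.VS_Connect"
begin

section \<open>Matrices\<close>

definition hermitian_mat :: "nat \<Rightarrow> complex mat \<Rightarrow> bool" where
  "hermitian_mat n A \<longleftrightarrow> A \<in> carrier_mat n n \<and> mat_adjoint A = A"

definition psd_mat :: "nat \<Rightarrow> complex mat \<Rightarrow> bool" where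
  "psd_mat n A \<longleftrightarrow> hermitian_mat n A \<and> (\<forall>v \<in> carrier_vec n. 0 \<le> Re ((A *\<^sub>v v) \<bullet>c v))"

definition kron :: "complex mat \<Rightarrow> complex mat \<Rightarrow> complex mat" where
  "kron A B = mat (dim_row A * dim_row B) (dim_col A * dim_col B)
     (\<lambda>(i, j). A $$ (i div dim_row B, j div dim_col B) * B $$ (i mod dim_row B, j mod dim_col B))"

text \<open>The type of matrices is not additive (its dimensions are not fixed), hence an explicit sum of a
  finite family of \<open>nr \<times> nc\<close> matrices.\<close>

definition mat_sum :: "nat \<Rightarrow> nat \<Rightarrow> ('i::finite \<Rightarrow> complex mat) \<Rightarrow> complex mat" where
  "mat_sum nr nc F = mat nr nc (\<lambda>(p, q). \<Sum>i\<in>UNIV. F i $$ (p, q))"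

definition mat_range :: "complex mat \<Rightarrow> complex vec set" where
  "mat_range A = {A *\<^sub>v v |v. v \<in> carrier_vec (dim_col A)}"


section \<open>Tuples of hermitian matrices and free sets\<close>

text \<open>Tuples are indexed by the finite types \<open>'h\<close> and \<open>'g\<close>, whose (positive) cardinalities are the
  numbers of variables \<open>a\<close> and \<open>x\<close>.  A sequence \<open>(D\<^sub>n)\<^sub>n\<close> of sets of pairs of tuples is encoded by its
  union over \<open>n \<ge> 1\<close>; \<open>D\<^sub>n\<close> is recovered as \<open>D \<inter> herm_pairs n\<close>.\<close>

type_synonym 'i tuple = "'i \<Rightarrow> complex mat"
type_synonym ('h, 'g) pair = "'h tuple \<times> 'g tuple"

definition herm_tuples :: "nat \<Rightarrow> 'i tuple set" where
  "herm_tuples n = {A. \<forall>j. hermitian_mat n (A j)}"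

definition herm_pairs :: "nat \<Rightarrow> ('h, 'g) pair set" where
  "herm_pairs n = herm_tuples n \<times> herm_tuples n"

definition all_herm_pairs :: "('h, 'g) pair set" where
  "all_herm_pairs = (\<Union>n\<in>{1..}. herm_pairs n)"

definition tuple_dsum :: "'i tuple \<Rightarrow> 'i tuple \<Rightarrow> 'i tuple" where
  "tuple_dsum A B = (\<lambda>j. diag_block_mat [A j, B j])"

definition tuple_conj :: "complex mat \<Rightarrow> 'i tuple \<Rightarrow> 'i tuple" where
  "tuple_conj U A = (\<lambda>j. mat_adjoint U * A j * U)"

definition unitary_mat :: "nat \<Rightarrow> complex mat \<Rightarrow> bool" where
  "unitary_mat n U \<longleftrightarrow> U \<in> carrier_mat n n \<and> mat_adjoint U * U = 1\<^sub>m n \<and> U * mat_adjoint U = 1\<^sub>m n"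

definition free_set :: "('h, 'g) pair set \<Rightarrow> bool" where
  "free_set D \<longleftrightarrow> D \<subseteq> all_herm_pairs \<and>
     (\<forall>A X B Y. (A, X) \<in> D \<longrightarrow> (B, Y) \<in> D \<longrightarrow> (tuple_dsum A B, tuple_dsum X Y) \<in> D) \<and>
     (\<forall>n\<ge>1. \<forall>A X U. (A, X) \<in> D \<inter> herm_pairs n \<longrightarrow> unitary_mat n U \<longrightarrow>
        (tuple_conj U A, tuple_conj U X) \<in> D)"

text \<open>The topology of the finite-dimensional spaces of tuples is that of the entrywise maximum norm.\<close>

definition tuple_close :: "real \<Rightarrow> nat \<Rightarrow> 'i tuple \<Rightarrow> 'i tuple \<Rightarrow> bool" where
  "tuple_close \<epsilon> n A B \<longleftrightarrow> (\<forall>j. \<forall>p<n. \<forall>q<n. cmod (A j $$ (p, q) - B j $$ (p, q)) < \<epsilon>)"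

definition open_tuples :: "nat \<Rightarrow> 'i tuple set \<Rightarrow> bool" where
  "open_tuples n S \<longleftrightarrow> S \<subseteq> herm_tuples n \<and>
     (\<forall>X\<in>S. \<exists>\<epsilon>>0. \<forall>Y\<in>herm_tuples n. tuple_close \<epsilon> n X Y \<longrightarrow> Y \<in> S)"

definition open_pairs :: "nat \<Rightarrow> ('h, 'g) pair set \<Rightarrow> bool" where
  "open_pairs n S \<longleftrightarrow> S \<subseteq> herm_pairs n \<and>
     (\<forall>(A, X)\<in>S. \<exists>\<epsilon>>0. \<forall>(B, Y)\<in>herm_pairs n.
        tuple_close \<epsilon> n A B \<longrightarrow> tuple_close \<epsilon> n X Y \<longrightarrow> (B, Y) \<in> S)"

definition open_graded :: "('h, 'g) pair set \<Rightarrow> bool" where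
  "open_graded D \<longleftrightarrow> D \<subseteq> all_herm_pairs \<and> (\<forall>n\<ge>1. open_pairs n (D \<inter> herm_pairs n))"

definition tuple_comb :: "real \<Rightarrow> 'i tuple \<Rightarrow> real \<Rightarrow> 'i tuple \<Rightarrow> 'i tuple" where
  "tuple_comb s X t Y = (\<lambda>i. complex_of_real s \<cdot>\<^sub>m X i + complex_of_real t \<cdot>\<^sub>m Y i)"

definition convex_tuples :: "'i tuple set \<Rightarrow> bool" where
  "convex_tuples S \<longleftrightarrow>
     (\<forall>X\<in>S. \<forall>Y\<in>S. \<forall>s\<ge>0. \<forall>t\<ge>0. s + t = 1 \<longrightarrow> tuple_comb s X t Y \<in> S)"

text \<open>\<open>D[A]\<close> for \<open>A\<close> a tuple of \<open>k \<times> k\<close> matrices.\<close>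

definition fiber :: "('h, 'g) pair set \<Rightarrow> nat \<Rightarrow> 'h tuple \<Rightarrow> 'g tuple set" where
  "fiber D k A = {X \<in> herm_tuples k. (A, X) \<in> D}"

definition open_in_x :: "('h, 'g) pair set \<Rightarrow> bool" where
  "open_in_x D \<longleftrightarrow> (\<forall>k\<ge>1. \<forall>A\<in>herm_tuples k. open_tuples k (fiber D k A))"

definition convex_in_x :: "('h, 'g) pair set \<Rightarrow> bool" where
  "convex_in_x D \<longleftrightarrow> (\<forall>k\<ge>1. \<forall>A\<in>herm_tuples k. convex_tuples (fiber D k A))"


section \<open>Noncommutative rational functions\<close>

datatype ('h, 'g) nc_expr =
    AVar 'h
  | XVar 'g
  | Scalar complex
  | Plus "('h, 'g) nc_expr" "('h, 'g) nc_expr"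
  | Times "('h, 'g) nc_expr" "('h, 'g) nc_expr"
  | Inverse "('h, 'g) nc_expr"

text \<open>Evaluation on tuples of \<open>n \<times> n\<close> matrices, not necessarily hermitian; the value is \<open>None\<close> exactly
  when some inverse occurring in the expression does not exist.\<close>

fun nc_eval :: "nat \<Rightarrow> ('h, 'g) pair \<Rightarrow> ('h, 'g) nc_expr \<Rightarrow> complex mat option" where
  "nc_eval n p (AVar j) = Some (fst p j)"
| "nc_eval n p (XVar i) = Some (snd p i)"
| "nc_eval n p (Scalar z) = Some (z \<cdot>\<^sub>m 1\<^sub>m n)"
| "nc_eval n p (Plus r s) =
     (case (nc_eval n p r, nc_eval n p s) of (Some M, Some N) \<Rightarrow> Some (M + N) | _ \<Rightarrow> None)"
| "nc_eval n p (Times r s) =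
     (case (nc_eval n p r, nc_eval n p s) of (Some M, Some N) \<Rightarrow> Some (M * N) | _ \<Rightarrow> None)"
| "nc_eval n p (Inverse r) =
     (case nc_eval n p r of Some M \<Rightarrow> mat_inverse M | None \<Rightarrow> None)"

definition nc_symmetric :: "('h, 'g) nc_expr \<Rightarrow> bool" where
  "nc_symmetric r \<longleftrightarrow>
     (\<forall>n\<ge>1. \<forall>p\<in>herm_pairs n. \<forall>M. nc_eval n p r = Some M \<longrightarrow> mat_adjoint M = M)"

definition regular_at_origin :: "('h, 'g) nc_expr \<Rightarrow> bool" where
  "regular_at_origin r \<longleftrightarrow> (\<forall>n\<ge>1. nc_eval n (\<lambda>j. 0\<^sub>m n n, \<lambda>i. 0\<^sub>m n n) r \<noteq> None)"


section \<open>Symmetric minimal realizations\<close>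

record ('h, 'g) realization =
  rl_dim :: nat
  rl_J :: "complex mat"
  rl_T :: "'g \<Rightarrow> complex mat"
  rl_S :: "'h \<Rightarrow> complex mat"
  rl_c :: "complex vec"

definition sym_realization :: "('h, 'g) realization \<Rightarrow> bool" where
  "sym_realization \<rho> \<longleftrightarrow>
     hermitian_mat (rl_dim \<rho>) (rl_J \<rho>) \<and> rl_J \<rho> * rl_J \<rho> = 1\<^sub>m (rl_dim \<rho>) \<and>
     (\<forall>i. hermitian_mat (rl_dim \<rho>) (rl_T \<rho> i)) \<and>
     (\<forall>j. hermitian_mat (rl_dim \<rho>) (rl_S \<rho> j)) \<and>
     rl_c \<rho> \<in> carrier_vec (rl_dim \<rho>)"

text \<open>The linear pencil \<open>J \<otimes> I - (\<Sum>i. T\<^sub>i \<otimes> X\<^sub>i) - (\<Sum>j. S\<^sub>j \<otimes> A\<^sub>j)\<close>.\<close>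

definition pencil :: "('h::finite, 'g::finite) realization \<Rightarrow> nat \<Rightarrow> ('h, 'g) pair \<Rightarrow> complex mat" where
  "pencil \<rho> n p =
     (let e = rl_dim \<rho> in
      kron (rl_J \<rho>) (1\<^sub>m n)
        - mat_sum (e * n) (e * n) (\<lambda>i. kron (rl_T \<rho> i) (snd p i))
        - mat_sum (e * n) (e * n) (\<lambda>j. kron (rl_S \<rho> j) (fst p j)))"

definition resolvent :: "('h::finite, 'g::finite) realization \<Rightarrow> nat \<Rightarrow> ('h, 'g) pair \<Rightarrow> complex mat" where
  "resolvent \<rho> n p = the (mat_inverse (pencil \<rho> n p))"

text \<open>The compression \<open>(W \<otimes> I)\<^sup>* (pencil)\<^sup>-\<^sup>1 (W \<otimes> I)\<close>.\<close>

definition compressed_resolvent ::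
    "('h::finite, 'g::finite) realization \<Rightarrow> complex mat \<Rightarrow> nat \<Rightarrow> ('h, 'g) pair \<Rightarrow> complex mat" where
  "compressed_resolvent \<rho> W n p =
     mat_adjoint (kron W (1\<^sub>m n)) * resolvent \<rho> n p * kron W (1\<^sub>m n)"

definition rl_eval :: "('h::finite, 'g::finite) realization \<Rightarrow> nat \<Rightarrow> ('h, 'g) pair \<Rightarrow> complex mat" where
  "rl_eval \<rho> n p = compressed_resolvent \<rho> (mat_of_cols (rl_dim \<rho>) [rl_c \<rho>]) n p"

text \<open>Equality as nc rational functions: the two sides agree wherever both are defined.\<close>

definition realizes :: "('h::finite, 'g::finite) realization \<Rightarrow> ('h, 'g) nc_expr \<Rightarrow> bool" where
  "realizes \<rho> r \<longleftrightarrow>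
     (\<forall>n\<ge>1. \<forall>A X M. (\<forall>j. A j \<in> carrier_mat n n) \<longrightarrow> (\<forall>i. X i \<in> carrier_mat n n) \<longrightarrow>
        nc_eval n (A, X) r = Some M \<longrightarrow> det (pencil \<rho> n (A, X)) \<noteq> 0 \<longrightarrow>
        rl_eval \<rho> n (A, X) = M)"

text \<open>The size \<open>e = 0\<close> is allowed.  A realization of size \<open>0\<close> has value \<open>0\<close>, so this only matters for the zero
  function, whose minimal realization is the empty one.  If one insisted on \<open>e \<ge> 1\<close>, then \<open>c = 0\<close> with
  arbitrary \<open>1 \<times> 1\<close> data \<open>J, T, S\<close> would be minimal for the zero function, and the
  sets \<open>rl_dom\<close> and \<open>rl_dom_plus\<close> below would depend on that choice.\<close>

definition is_SMR :: "('h::finite, 'g::finite) nc_expr \<Rightarrow> ('h, 'g) realization \<Rightarrow> bool" where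
  "is_SMR r \<rho> \<longleftrightarrow> sym_realization \<rho> \<and> realizes \<rho> r \<and>
     (\<forall>\<rho>' :: ('h, 'g) realization. sym_realization \<rho>' \<longrightarrow> realizes \<rho>' r \<longrightarrow> rl_dim \<rho> \<le> rl_dim \<rho>')"

definition rl_dom :: "('h::finite, 'g::finite) realization \<Rightarrow> ('h, 'g) pair set" where
  "rl_dom \<rho> = (\<Union>n\<in>{1..}. {p \<in> herm_pairs n. det (pencil \<rho> n p) \<noteq> 0})"

text \<open>The inclusion \<open>V\<^sub>T\<close> of the span of the ranges of the \<open>T\<^sub>i\<close> into \<open>\<complex>\<^sup>e\<close>, as a matrix with respect to an
  orthonormal basis of that span.  Another choice of basis changes \<open>R\<^sub>T\<close> by a unitary conjugation only.\<close>

definition V_T :: "('h, 'g) realization \<Rightarrow> complex mat" where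
  "V_T \<rho> = (SOME V. V \<in> carrier_mat (rl_dim \<rho>) (dim_col V) \<and>
     mat_adjoint V * V = 1\<^sub>m (dim_col V) \<and>
     mat_range V = LinearCombinations.module.span class_ring (module_vec TYPE(complex) (rl_dim \<rho>))
                     (\<Union>i. mat_range (rl_T \<rho> i)))"

definition R_T :: "('h::finite, 'g::finite) realization \<Rightarrow> nat \<Rightarrow> ('h, 'g) pair \<Rightarrow> complex mat" where
  "R_T \<rho> n p = compressed_resolvent \<rho> (V_T \<rho>) n p"

definition rl_dom_plus :: "('h::finite, 'g::finite) realization \<Rightarrow> ('h, 'g) pair set" where
  "rl_dom_plus \<rho> =
     (\<Union>n\<in>{1..}. {p \<in> rl_dom \<rho> \<inter> herm_pairs n. psd_mat (dim_col (V_T \<rho>) * n) (R_T \<rho> n p)})"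


section \<open>Partial convexity\<close>

text \<open>On \<open>dom r\<close> the function \<open>r\<close> is evaluated through its realization, which is defined on all of
  \<open>dom r\<close>, while a particular expression for \<open>r\<close> need not be.\<close>

definition r_convex_in_x :: "('h::finite, 'g::finite) realization \<Rightarrow> ('h, 'g) pair set \<Rightarrow> bool" where
  "r_convex_in_x \<rho> D \<longleftrightarrow> D \<subseteq> rl_dom \<rho> \<and>
     (\<forall>k\<ge>1. \<forall>A\<in>herm_tuples k. \<forall>X\<in>fiber D k A. \<forall>Y\<in>fiber D k A.
        tuple_comb (1/2) X (1/2) Y \<in> fiber D k A \<longrightarrow>
        psd_mat k ((1/2) \<cdot>\<^sub>m (rl_eval \<rho> k (A, X) + rl_eval \<rho> k (A, Y))
                     - rl_eval \<rho> k (A, tuple_comb (1/2) X (1/2) Y)))"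

definition domain_of_partial_convexity ::
    "('h::finite, 'g::finite) realization \<Rightarrow> ('h, 'g) pair set \<Rightarrow> bool" where
  "domain_of_partial_convexity \<rho> D \<longleftrightarrow>
     free_set D \<and> open_in_x D \<and> convex_in_x D \<and> r_convex_in_x \<rho> D"

definition full_domain_of_partial_convexity ::
    "('h::finite, 'g::finite) realization \<Rightarrow> ('h, 'g) pair set \<Rightarrow> bool" where
  "full_domain_of_partial_convexity \<rho> D \<longleftrightarrow> domain_of_partial_convexity \<rho> D \<and>
     (\<exists>U. U \<subseteq> D \<and> free_set U \<and> open_graded U \<and> U \<inter> herm_pairs 1 \<noteq> {})"

end

theory Submission
  imports Defs
begin

text \<open>
  Write \<open>L(A,X)\<close> for the pencil and \<open>V = V\<^sub>T \<otimes> I\<close>. A change of \<open>x\<close> alone perturbs \<open>L\<close> by a matrix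
  \<open>V H V\<^sup>*\<close>. With \<open>R = R\<^sub>T(A,X)\<close> and \<open>R'\<close> its value at the perturbed point, the resolvent identity gives
  \<open>(I - H R)\<^sup>* R' (I - H R) = R - R H R\<close>, so once \<open>I - H R\<close> is invertible,
  \<open>R' \<succeq> 0\<close> is the affine condition \<open>R - R H R \<succeq> 0\<close> on \<open>H\<close>; invertibility is automatic for small \<open>H\<close> and,
  by positivity of \<open>R\<close>, at proper convex combinations of two points of the positive part. This yields openness and convexity of the fibres, and the second difference of
  \<open>r\<close> in \<open>x\<close> is a congruence of \<open>R(X) + R(Y)\<close>, hence positive.

  Conversely, let \<open>P\<close> run through the free open set. Expanding \<open>r\<close> to second order at \<open>(A,X) \<oplus> P\<close> in an
  off-diagonal direction shows that \<open>L(A,X)\<inverse>\<close> is nonnegative on the vectors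
  \<open>(\<Sum>\<^sub>i T\<^sub>i \<otimes> h\<^sub>i) L(P)\<inverse> (c \<otimes> \<eta>)\<close>. By direct sums of the \<open>P\<close> these vectors form a subspace, which is the
  range of \<open>V\<close> unless some \<open>u \<noteq> 0\<close> satisfies \<open>(u \<otimes> I)\<^sup>* L(P)\<inverse> (c \<otimes> I) = 0\<close> for all \<open>P\<close>. A first-order
  expansion at \<open>p\<^sub>0 \<oplus> P\<close>, with \<open>p\<^sub>0\<close> a scalar point, shows that the space of such \<open>u\<close> is invariant under
  all \<open>T\<^sub>i J\<close> and \<open>S\<^sub>j J\<close> and orthogonal to \<open>J c\<close>. Compressing the realization to the orthogonal complement,
  modulo the radical of the form of \<open>J\<close>, would then give a smaller symmetric realization of \<open>r\<close>.
\<close>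

text \<open>Minimality is measured against symmetric realizations only, so a compressed system
  counts only if it again carries a signature matrix. The form of \<open>J\<close> restricted to an
  invariant subspace can be degenerate, so neither this restriction nor its inverse can serve as the
  new signature matrix; a generalized inverse of signature shape replaces it, padded to the
  dimension of the subspace. A second obstacle is that positivity of \<open>R\<^sub>T\<close> is not
  strict: openness cannot rest on a margin of positivity, only on the perturbation
  \<open>R H R\<close> being dominated by \<open>R\<close> itself. Convexity gives information in
  hermitian directions only, while the span argument and the annihilator need arbitrary rectangular
  ones; direct sums supply these as off-diagonal corners of hermitian directions. The scalar point
  matters because its pencil is an \<open>e \<times> e\<close> matrix and can act on the vectors
  \<open>u\<close> themselves. The conditions obtained there involve
  \<open>L(p\<^sub>0)\<inverse>\<close>; passing to \<open>J\<close> removes the dependence on the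
  point.\<close>

abbreviation adj :: "complex mat \<Rightarrow> complex mat" where "adj \<equiv> mat_adjoint"

section \<open>Matrix algebra with explicit dimension conditions\<close>

lemma carrier_mat_iff: "A \<in> carrier_mat n m \<longleftrightarrow> dim_row A = n \<and> dim_col A = m"
  by auto

lemma dim_adj [simp]: "dim_row (adj A) = dim_col A" "dim_col (adj A) = dim_row A"
  by (simp_all add: mat_adjoint_def)

lemma index_adj [simp]:
  "i < dim_col A \<Longrightarrow> j < dim_row A \<Longrightarrow> adj A $$ (i, j) = cnj (A $$ (j, i))"
  by (simp add: mat_adjoint_def mat_of_rows_index)

lemma adj_carrier [simp, intro]: "A \<in> carrier_mat n m \<Longrightarrow> adj A \<in> carrier_mat m n"
  by auto

text \<open>The ring laws are restated with premises on \<open>dim_row\<close> and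
  \<open>dim_col\<close> instead of \<open>carrier_mat\<close>: the simplifier can then discharge
  the side conditions without guessing dimensions.\<close>

lemma mmult_assoc:
  "dim_col A = dim_row B \<Longrightarrow> dim_col B = dim_row C \<Longrightarrow> (A * B) * C = A * (B * (C :: complex mat))"
  by (rule assoc_mult_mat[of _ "dim_row A" "dim_row B" _ "dim_row C" _ "dim_col C"]) auto

lemma mmult_add_left:
  "dim_row A = dim_row B \<Longrightarrow> dim_col A = dim_col B \<Longrightarrow> dim_col B = dim_row C \<Longrightarrow>
    (A + B) * C = A * C + B * (C :: complex mat)"
  by (rule add_mult_distrib_mat[of _ "dim_row A" "dim_col A" _ _ "dim_col C"]) auto

lemma mmult_add_right:
  "dim_row A = dim_row B \<Longrightarrow> dim_col A = dim_col B \<Longrightarrow> dim_col C = dim_row A \<Longrightarrow>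
    C * (A + B) = C * A + C * (B :: complex mat)"
  by (rule mult_add_distrib_mat[of _ "dim_row C" "dim_row A" _ "dim_col A"]) auto

lemma mmult_minus_left:
  "dim_row A = dim_row B \<Longrightarrow> dim_col A = dim_col B \<Longrightarrow> dim_col B = dim_row C \<Longrightarrow>
    (A - B) * C = A * C - B * (C :: complex mat)"
  by (rule minus_mult_distrib_mat[of _ "dim_row A" "dim_col A" _ _ "dim_col C"]) auto

lemma mmult_minus_right:
  "dim_row A = dim_row B \<Longrightarrow> dim_col A = dim_col B \<Longrightarrow> dim_col C = dim_row A \<Longrightarrow>
    C * (A - B) = C * A - C * (B :: complex mat)"
  by (rule mult_minus_distrib_mat[of _ "dim_row C" "dim_row A" _ "dim_col A"]) auto

lemma mmult_smult_left: "dim_col A = dim_row B \<Longrightarrow> (k \<cdot>\<^sub>m A) * B = k \<cdot>\<^sub>m (A * (B :: complex mat))"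
  by (rule mult_smult_assoc_mat[of _ "dim_row A" "dim_col A" _ "dim_col B"]) auto

lemma mmult_smult_right: "dim_col A = dim_row B \<Longrightarrow> A * (k \<cdot>\<^sub>m B) = k \<cdot>\<^sub>m (A * (B :: complex mat))"
  by (rule mult_smult_distrib[of _ "dim_row A" "dim_col A" _ "dim_col B"]) auto

lemma mmult_one: "dim_row A = n \<Longrightarrow> 1\<^sub>m n * A = (A :: complex mat)"
  "dim_col A = n \<Longrightarrow> A * 1\<^sub>m n = (A :: complex mat)"
  by (metis carrier_matI left_mult_one_mat, metis carrier_matI right_mult_one_mat)

lemma mmult_zero: "dim_row A = n \<Longrightarrow> 0\<^sub>m m n * A = 0\<^sub>m m (dim_col (A :: complex mat))"
  "dim_col A = n \<Longrightarrow> A * 0\<^sub>m n m = 0\<^sub>m (dim_row (A :: complex mat)) m"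
  by (metis carrier_matI left_mult_zero_mat, metis carrier_matI right_mult_zero_mat)

text \<open>Products are normalized to right-nested form, where an equation for \<open>A * B\<close>
  no longer matches; this version rewrites the prefix of \<open>A * (B * X)\<close>. Facts are
  passed through it by \<open>THEN\<close> or \<open>OF\<close> throughout.\<close>

lemma mult_eq_assoc:
  "A * B = C \<Longrightarrow> dim_col A = dim_row B \<Longrightarrow> dim_col B = dim_row X \<Longrightarrow> A * (B * X) = C * (X :: complex mat)"
  by (metis mmult_assoc)

lemma adj_adj [simp]: "adj (adj A) = A"
  by (rule eq_matI) auto

lemma adj_mult: "dim_col A = dim_row B \<Longrightarrow> adj (A * B) = adj B * adj A"
  by (rule eq_matI) (auto simp: scalar_prod_def intro!: sum.cong)

lemma adj_add: "dim_row A = dim_row B \<Longrightarrow> dim_col A = dim_col B \<Longrightarrow> adj (A + B) = adj A + adj B"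
  by (rule eq_matI) auto

lemma adj_minus: "dim_row A = dim_row B \<Longrightarrow> dim_col A = dim_col B \<Longrightarrow> adj (A - B) = adj A - adj B"
  by (rule eq_matI) auto

lemma adj_smult: "adj (k \<cdot>\<^sub>m A) = cnj k \<cdot>\<^sub>m adj A"
  by (rule eq_matI) auto

lemma adj_one [simp]: "adj (1\<^sub>m n) = 1\<^sub>m n"
  by (rule eq_matI) auto

lemma adj_zero [simp]: "adj (0\<^sub>m n m) = 0\<^sub>m m n"
  by (rule eq_matI) auto

lemmas mmult_distribs = mmult_add_left mmult_add_right mmult_minus_left mmult_minus_right
  mmult_smult_left mmult_smult_right mmult_one mmult_zero
lemmas adj_simps = adj_mult adj_add adj_minus adj_smult
lemmas mat_algebra = mmult_assoc mmult_distribs adj_simps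

lemma add_zero_mat:
  "dim_row A = n \<Longrightarrow> dim_col A = m \<Longrightarrow> A + 0\<^sub>m n m = (A :: complex mat)"
  "dim_row A = n \<Longrightarrow> dim_col A = m \<Longrightarrow> 0\<^sub>m n m + A = (A :: complex mat)"
  "dim_row A = n \<Longrightarrow> dim_col A = m \<Longrightarrow> A - 0\<^sub>m n m = (A :: complex mat)"
  "dim_row A = n \<Longrightarrow> dim_col A = m \<Longrightarrow> A - A = (0\<^sub>m n m :: complex mat)"
  by (auto intro!: eq_matI)

lemma dim_diff [simp]: "dim_row (A - B :: complex mat) = dim_row B" "dim_col (A - B :: complex mat) = dim_col B"
  by (simp_all add: minus_mat_def)

section \<open>Inverses\<close>

lemma mat_of_cols_single: "mat_of_cols n [v] \<in> carrier_mat n 1"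
  by (simp add: mat_of_cols_def)

declare mat_of_cols_single [simplified, simp]

text \<open>Vectors are taken as \<open>n \<times> 1\<close> matrices here and later, so that one
  product and one associativity law serve operators and vectors alike.\<close>

lemma det_nonzeroI:
  fixes A :: "complex mat"
  assumes A: "A \<in> carrier_mat n n"
    and inj: "\<And>v. v \<in> carrier_mat n 1 \<Longrightarrow> A * v = 0\<^sub>m n 1 \<Longrightarrow> v = 0\<^sub>m n 1"
  shows "det A \<noteq> 0"
proof
  assume "det A = 0"
  then obtain v where v: "v \<in> carrier_vec n" "v \<noteq> 0\<^sub>v n" "A *\<^sub>v v = 0\<^sub>v n"
    using det_0_iff_vec_prod_zero_field[OF A] by auto
  let ?v = "mat_of_cols n [v]"
  have "A * ?v = 0\<^sub>m n 1"
  proof (rule eq_matI)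
    fix i j assume ij: "i < dim_row (0\<^sub>m n 1 :: complex mat)" "j < dim_col (0\<^sub>m n 1 :: complex mat)"
    have "(A * ?v) $$ (i, j) = (A *\<^sub>v v) $ i"
      using ij A v(1) unfolding v(3)[symmetric] by (auto simp: scalar_prod_def mat_of_cols_index intro!: sum.cong)
    then show "(A * ?v) $$ (i, j) = (0\<^sub>m n 1 :: complex mat) $$ (i, j)" using ij v by simp
  qed (use A in \<open>auto simp: mat_of_cols_def\<close>)
  from inj[OF mat_of_cols_single this] have "?v = 0\<^sub>m n 1" .
  then have "?v $$ (i, 0) = 0" if "i < n" for i using that by simp
  then have "v = 0\<^sub>v n" using v by (auto simp: mat_of_cols_index)
  with v show False by simp
qed

lemma right_inverse_imp_left:
  fixes A :: "complex mat"
  assumes "A \<in> carrier_mat n n" "B \<in> carrier_mat n n" "A * B = 1\<^sub>m n"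
  shows "B * A = 1\<^sub>m n"
  by (rule mat_mult_left_right_inverse) (use assms in auto)

lemma mat_inverse_det:
  fixes A :: "complex mat"
  assumes A: "A \<in> carrier_mat n n" and d: "det A \<noteq> 0"
  obtains B where "mat_inverse A = Some B" "B \<in> carrier_mat n n" "A * B = 1\<^sub>m n" "B * A = 1\<^sub>m n"
proof (cases "mat_inverse A")
  case None
  then show ?thesis using mat_inverse(1)[OF A None, of "()"] det_non_zero_imp_unit[OF A d, of "()"] by blast
next
  case (Some B)
  then show ?thesis using mat_inverse(2)[OF A Some] that by auto
qed

lemma inverse_det_nonzero:
  fixes A :: "complex mat"
  assumes "A \<in> carrier_mat n n" "B \<in> carrier_mat n n" "A * B = 1\<^sub>m n"
  shows "det A \<noteq> 0"
proof
  assume "det A = 0"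
  then have "det (A * B) = 0" using det_mult[OF assms(1,2)] by simp
  then show False using assms by simp
qed

lemma inverse_unique:
  fixes A :: "complex mat"
  assumes [simp]: "A \<in> carrier_mat n n" "B \<in> carrier_mat n n" "C \<in> carrier_mat n n"
    and AB: "B * A = 1\<^sub>m n" and AC: "A * C = 1\<^sub>m n"
  shows "B = C"
proof -
  note [simp] = assms(1-3)[unfolded carrier_mat_iff]
  have "B = B * (A * C)" by (simp add: AC mat_algebra)
  also have "\<dots> = C" by (simp add: mult_eq_assoc[OF AB] mat_algebra)
  finally show ?thesis .
qed

lemma mat_inverse_eqI:
  fixes A :: "complex mat"
  assumes "A \<in> carrier_mat n n" "B \<in> carrier_mat n n" "A * B = 1\<^sub>m n"
  shows "mat_inverse A = Some B"
proof -
  obtain C where C: "mat_inverse A = Some C" "C \<in> carrier_mat n n" "C * A = 1\<^sub>m n"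
    using mat_inverse_det[OF assms(1) inverse_det_nonzero[OF assms]] by metis
  with inverse_unique[of A n C B] assms show ?thesis by simp
qed

text \<open>Taking adjoints of \<open>A * B = 1\<close> makes \<open>adj B\<close> a left inverse of
  \<open>A\<close>, and a left inverse agrees with a right inverse.\<close>

lemma hermitian_inverse:
  fixes A :: "complex mat"
  assumes A: "A \<in> carrier_mat n n" and B: "B \<in> carrier_mat n n" and AB: "A * B = 1\<^sub>m n"
    and h: "adj A = A"
  shows "adj B = B"
proof -
  have "adj (A * B) = adj B * A" using A B h by (subst adj_mult) auto
  then have "adj B * A = 1\<^sub>m n" by (simp add: AB)
  then show ?thesis using inverse_unique[of A n "adj B" B] A B AB by simp
qed

section \<open>Kronecker products\<close>

lemma div_mod_less: "i < a * b \<Longrightarrow> i div b < a \<and> i mod b < (b::nat)"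
  by (metis less_mult_imp_div_less mod_less_divisor mult_0_right not_less_zero gr0I)

text \<open>Mixed-radix bijection between the numbers below \<open>a * b\<close> and pairs of
  digits; it splits the inner sum in a product of Kronecker products into two independent
  sums.\<close>

lemma sum_div_mod:
  fixes f :: "nat \<Rightarrow> nat \<Rightarrow> complex"
  shows "(\<Sum>k<a*b. f (k div b) (k mod b)) = (\<Sum>i<a. \<Sum>j<b. f i j)"
proof -
  have "(\<Sum>i<a. \<Sum>j<b. f i j) = (\<Sum>(i, j)\<in>{..<a} \<times> {..<b}. f i j)"
    by (simp add: sum.cartesian_product)
  also have "\<dots> = (\<Sum>k<a*b. f (k div b) (k mod b))"
  proof (rule sum.reindex_bij_witness[of _ "\<lambda>k. (k div b, k mod b)" "\<lambda>(i, j). i * b + j"])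
    fix p assume "p \<in> {..<a} \<times> {..<b}"
    then obtain i j where p: "p = (i, j)" "i < a" "j < b" by auto
    have "i * b + j < i * b + b" using p by simp
    also have "\<dots> = Suc i * b" by simp
    also have "\<dots> \<le> a * b" using p by (intro mult_right_mono) auto
    finally show "(case p of (i, j) \<Rightarrow> i * b + j) \<in> {..<a * b}" using p by simp
  qed (use div_mod_less in auto)
  finally show ?thesis by simp
qed

lemma dim_kron [simp]: "dim_row (kron A B) = dim_row A * dim_row B"
  "dim_col (kron A B) = dim_col A * dim_col B"
  by (simp_all add: kron_def)

lemma kron_carrier [simp, intro]:
  "A \<in> carrier_mat a b \<Longrightarrow> B \<in> carrier_mat c d \<Longrightarrow> kron A B \<in> carrier_mat (a * c) (b * d)"
  by auto

lemma index_kron: "i < dim_row A * dim_row B \<Longrightarrow> j < dim_col A * dim_col B \<Longrightarrow>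
   kron A B $$ (i, j) = A $$ (i div dim_row B, j div dim_col B) * B $$ (i mod dim_row B, j mod dim_col B)"
  by (simp add: kron_def)

lemma kron_mult:
  assumes "dim_col A = dim_row C" "dim_col B = dim_row D"
  shows "kron A B * kron C D = kron (A * C) (B * D)"
proof (rule eq_matI)
  fix i j assume "i < dim_row (kron (A * C) (B * D))" "j < dim_col (kron (A * C) (B * D))"
  then have ij: "i < dim_row A * dim_row B" "j < dim_col C * dim_col D" by simp_all
  note ij' = div_mod_less[OF ij(1)] div_mod_less[OF ij(2)]
  have "(kron A B * kron C D) $$ (i, j) = (\<Sum>k<dim_row C * dim_row D.
      (\<lambda>p q. A $$ (i div dim_row B, p) * B $$ (i mod dim_row B, q) *
        (C $$ (p, j div dim_col D) * D $$ (q, j mod dim_col D))) (k div dim_row D) (k mod dim_row D))"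
    using ij assms by (auto simp: scalar_prod_def index_kron atLeast0LessThan intro!: sum.cong)
  also have "\<dots> = (\<Sum>p<dim_row C. \<Sum>q<dim_row D. A $$ (i div dim_row B, p) * B $$ (i mod dim_row B, q) *
        (C $$ (p, j div dim_col D) * D $$ (q, j mod dim_col D)))"
    by (rule sum_div_mod)
  also have "\<dots> = (\<Sum>p<dim_row C. A $$ (i div dim_row B, p) * C $$ (p, j div dim_col D)) *
      (\<Sum>q<dim_row D. B $$ (i mod dim_row B, q) * D $$ (q, j mod dim_col D))"
    by (simp add: sum_product mult_ac)
  also have "\<dots> = kron (A * C) (B * D) $$ (i, j)"
    using ij ij' assms by (simp add: index_kron scalar_prod_def atLeast0LessThan)
  finally show "(kron A B * kron C D) $$ (i, j) = kron (A * C) (B * D) $$ (i, j)" .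
qed (use assms in auto)

lemma adj_kron: "adj (kron A B) = kron (adj A) (adj B)"
proof (rule eq_matI)
  fix i j assume "i < dim_row (kron (adj A) (adj B))" "j < dim_col (kron (adj A) (adj B))"
  then have ij: "i < dim_col A * dim_col B" "j < dim_row A * dim_row B" by simp_all
  note ij' = div_mod_less[OF ij(1)] div_mod_less[OF ij(2)]
  show "adj (kron A B) $$ (i, j) = kron (adj A) (adj B) $$ (i, j)"
    using ij ij' by (simp add: index_kron)
qed auto

lemma kron_one: "kron (1\<^sub>m a) (1\<^sub>m b) = 1\<^sub>m (a * b)"
proof (rule eq_matI)
  fix i j assume "i < dim_row (1\<^sub>m (a * b) :: complex mat)" "j < dim_col (1\<^sub>m (a * b) :: complex mat)"
  then have ij: "i < a * b" "j < a * b" by simp_all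
  have "i div b = j div b \<and> i mod b = j mod b \<longleftrightarrow> i = j"
    by (metis div_mult_mod_eq)
  then show "kron (1\<^sub>m a) (1\<^sub>m b) $$ (i, j) = (1\<^sub>m (a * b) :: complex mat) $$ (i, j)"
    using ij div_mod_less[OF ij(1)] div_mod_less[OF ij(2)] by (auto simp: index_kron)
qed auto

lemma kron_one_one [simp]: "kron A (1\<^sub>m 1) = A"
  by (rule eq_matI) (auto simp: index_kron)

lemma kron_add_left: "dim_row A = dim_row B \<Longrightarrow> dim_col A = dim_col B \<Longrightarrow> 
   kron (A + B) C = kron A C + kron B C"
  by (rule eq_matI) (auto simp: index_kron distrib_right dest!: div_mod_less)

lemma kron_add_right: "dim_row A = dim_row B \<Longrightarrow> dim_col A = dim_col B \<Longrightarrow> 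
   kron C (A + B) = kron C A + kron C B"
  by (rule eq_matI) (auto simp: index_kron distrib_left dest!: div_mod_less)

lemma kron_smult_left: "kron (k \<cdot>\<^sub>m A) C = k \<cdot>\<^sub>m kron A C"
  by (rule eq_matI) (auto simp: index_kron dest!: div_mod_less)

lemma kron_smult_right: "kron C (k \<cdot>\<^sub>m A) = k \<cdot>\<^sub>m kron C A"
  by (rule eq_matI) (auto simp: index_kron dest!: div_mod_less)

lemma kron_zero: "kron (0\<^sub>m a b) C = 0\<^sub>m (a * dim_row C) (b * dim_col C)"
   "kron C (0\<^sub>m a b) = 0\<^sub>m (dim_row C * a) (dim_col C * b)"
  by (auto intro!: eq_matI simp: index_kron dest!: div_mod_less)

lemma dim_mat_sum [simp]: "dim_row (mat_sum nr nc F) = nr" "dim_col (mat_sum nr nc F) = nc"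
  by (simp_all add: mat_sum_def)

lemma mat_sum_carrier [simp, intro]: "mat_sum nr nc F \<in> carrier_mat nr nc"
  by (simp add: mat_sum_def)

lemma index_mat_sum: "i < nr \<Longrightarrow> j < nc \<Longrightarrow> mat_sum nr nc F $$ (i, j) = (\<Sum>k\<in>UNIV. F k $$ (i, j))"
  by (simp add: mat_sum_def)

lemma mat_sum_mult_right:
  assumes "\<And>i. F i \<in> carrier_mat nr nc" "B \<in> carrier_mat nc nk"
  shows "mat_sum nr nc F * B = mat_sum nr nk (\<lambda>i. F i * B)"
proof (rule eq_matI)
  fix i j assume "i < dim_row (mat_sum nr nk (\<lambda>i. F i * B))" "j < dim_col (mat_sum nr nk (\<lambda>i. F i * B))"
  then have ij: "i < nr" "j < nk" by auto
  have d: "dim_row (F k) = nr" "dim_col (F k) = nc" for k using assms(1)[of k] by auto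
  have "(\<Sum>l<nc. (\<Sum>k\<in>UNIV. F k $$ (i, l)) * B $$ (l, j)) = (\<Sum>k\<in>UNIV. \<Sum>l<nc. F k $$ (i, l) * B $$ (l, j))"
    by (simp add: sum_distrib_right) (rule sum.swap)
  then show "(mat_sum nr nc F * B) $$ (i, j) = mat_sum nr nk (\<lambda>i. F i * B) $$ (i, j)"
    using ij assms(2) by (simp add: index_mat_sum scalar_prod_def d atLeast0LessThan)
qed (use assms in auto)

lemma mat_sum_mult_left:
  assumes "\<And>i. F i \<in> carrier_mat nr nc" "B \<in> carrier_mat nk nr"
  shows "B * mat_sum nr nc F = mat_sum nk nc (\<lambda>i. B * F i)"
proof (rule eq_matI)
  fix i j assume "i < dim_row (mat_sum nk nc (\<lambda>i. B * F i))" "j < dim_col (mat_sum nk nc (\<lambda>i. B * F i))"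
  then have ij: "i < nk" "j < nc" by auto
  have d: "dim_row (F k) = nr" "dim_col (F k) = nc" for k using assms(1)[of k] by auto
  have "(\<Sum>l<nr. B $$ (i, l) * (\<Sum>k\<in>UNIV. F k $$ (l, j))) = (\<Sum>k\<in>UNIV. \<Sum>l<nr. B $$ (i, l) * F k $$ (l, j))"
    by (simp add: sum_distrib_left) (rule sum.swap)
  then show "(B * mat_sum nr nc F) $$ (i, j) = mat_sum nk nc (\<lambda>i. B * F i) $$ (i, j)"
    using ij assms(2) by (simp add: index_mat_sum scalar_prod_def d atLeast0LessThan)
qed (use assms in auto)

section \<open>Linear pencils\<close>

text \<open>Row and column numbers are separate parameters because rectangular directions (corners
  of direct sums) and coefficients multiplied by a rectangular isometry both occur.\<close>

definition lin :: "nat \<Rightarrow> nat \<Rightarrow> ('i::finite \<Rightarrow> complex mat) \<Rightarrow> ('i \<Rightarrow> complex mat) \<Rightarrow> complex mat" where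
  "lin nr nc Z z = mat_sum nr nc (\<lambda>i. kron (Z i) (z i))"

lemma dim_lin [simp]: "dim_row (lin nr nc Z z) = nr" "dim_col (lin nr nc Z z) = nc"
  by (simp_all add: lin_def)

lemma lin_carrier [simp, intro]: "lin nr nc Z z \<in> carrier_mat nr nc"
  by (simp add: lin_def)

lemma kron_mult_lin:
  assumes "\<And>i. Z i \<in> carrier_mat e f" "\<And>i. z i \<in> carrier_mat n m" "B \<in> carrier_mat e' e" "F \<in> carrier_mat n' n"
  shows "kron B F * lin (e * n) (f * m) Z z = lin (e' * n') (f * m) (\<lambda>i. B * Z i) (\<lambda>i. F * z i)"
proof -
  have d: "dim_row (Z i) = e" "dim_row (z i) = n" for i using assms by auto
  show ?thesis unfolding lin_def using assms
    by (subst mat_sum_mult_left) (auto simp: kron_mult d)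
qed

lemma lin_mult_kron:
  assumes "\<And>i. Z i \<in> carrier_mat e f" "\<And>i. z i \<in> carrier_mat n m" "B \<in> carrier_mat f f'" "F \<in> carrier_mat m m'"
  shows "lin (e * n) (f * m) Z z * kron B F = lin (e * n) (f' * m') (\<lambda>i. Z i * B) (\<lambda>i. z i * F)"
proof -
  have d: "dim_col (Z i) = f" "dim_col (z i) = m" for i using assms by auto
  show ?thesis unfolding lin_def using assms
    by (subst mat_sum_mult_right) (auto simp: kron_mult d)
qed

lemma lin_add_right:
  assumes "\<And>i. Z i \<in> carrier_mat e f" "\<And>i. z i \<in> carrier_mat n m" "\<And>i. w i \<in> carrier_mat n m"
  shows "lin (e * n) (f * m) Z (\<lambda>i. z i + w i) = lin (e * n) (f * m) Z z + lin (e * n) (f * m) Z w"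
proof -
  have d: "dim_row (Z i) = e" "dim_row (z i) = n" "dim_row (w i) = n"
     "dim_col (Z i) = f" "dim_col (z i) = m" "dim_col (w i) = m" for i using assms by (auto dest: carrier_matD)
  show ?thesis unfolding lin_def
    by (rule eq_matI) (auto simp: index_mat_sum kron_add_right d sum.distrib)
qed

lemma lin_smult_right:
  assumes "\<And>i. Z i \<in> carrier_mat e f" "\<And>i. z i \<in> carrier_mat n m"
  shows "lin (e * n) (f * m) Z (\<lambda>i. k \<cdot>\<^sub>m z i) = k \<cdot>\<^sub>m lin (e * n) (f * m) Z z"
proof -
  have d: "dim_row (Z i) = e" "dim_row (z i) = n" 
     "dim_col (Z i) = f" "dim_col (z i) = m" for i using assms by (auto dest: carrier_matD)
  show ?thesis unfolding lin_def
    by (rule eq_matI) (auto simp: index_mat_sum kron_smult_right d sum_distrib_left)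
qed

lemma adj_lin:
  assumes "\<And>i. Z i \<in> carrier_mat e f" "\<And>i. z i \<in> carrier_mat n m"
  shows "adj (lin (e * n) (f * m) Z z) = lin (f * m) (e * n) (\<lambda>i. adj (Z i)) (\<lambda>i. adj (z i))"
proof -
  have d: "dim_row (Z i) = e" "dim_row (z i) = n" 
     "dim_col (Z i) = f" "dim_col (z i) = m" for i using assms by (auto dest: carrier_matD)
  show ?thesis unfolding lin_def
    by (rule eq_matI) (auto simp: index_mat_sum d adj_kron[symmetric])
qed

text \<open>The variables x and a are merged into one index type \<open>'g + 'h\<close>, so that the
  pencil has a single linear part and each expansion is done once for both kinds of
  variables.\<close>

definition coeffs :: "('h, 'g) realization \<Rightarrow> 'g + 'h \<Rightarrow> complex mat" where
  "coeffs \<rho> = case_sum (rl_T \<rho>) (rl_S \<rho>)"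

abbreviation rl_C :: "('h, 'g) realization \<Rightarrow> complex mat" where
  "rl_C \<rho> \<equiv> mat_of_cols (rl_dim \<rho>) [rl_c \<rho>]"

abbreviation rl_lin ::
    "('h::finite, 'g::finite) realization \<Rightarrow> nat \<Rightarrow> nat \<Rightarrow> ('g + 'h \<Rightarrow> complex mat) \<Rightarrow> complex mat" where
  "rl_lin \<rho> n m z \<equiv> lin (rl_dim \<rho> * n) (rl_dim \<rho> * m) (coeffs \<rho>) z"

definition join :: "('h, 'g) pair \<Rightarrow> 'g + 'h \<Rightarrow> complex mat" where
  "join p = case_sum (snd p) (fst p)"

lemma pencil_lin:
  fixes \<rho> :: "('h::finite, 'g::finite) realization"
  assumes "sym_realization \<rho>" "\<And>i. join p i \<in> carrier_mat n n"
  shows "pencil \<rho> n p = kron (rl_J \<rho>) (1\<^sub>m n) - rl_lin \<rho> n n (join p)"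
proof (rule eq_matI)
  let ?N = "rl_dim \<rho> * n"
  fix i j assume ij: "i < dim_row (kron (rl_J \<rho>) (1\<^sub>m n) - lin ?N ?N (coeffs \<rho>) (join p))"
     "j < dim_col (kron (rl_J \<rho>) (1\<^sub>m n) - lin ?N ?N (coeffs \<rho>) (join p))"
  have J: "dim_row (rl_J \<rho>) = rl_dim \<rho>" "dim_col (rl_J \<rho>) = rl_dim \<rho>"
    using assms(1) by (auto simp: sym_realization_def hermitian_mat_def)
  have "(\<Sum>k\<in>UNIV. kron (coeffs \<rho> k) (join p k) $$ (i, j)) = 
     (\<Sum>k\<in>UNIV. kron (coeffs \<rho> (Inl k)) (join p (Inl k)) $$ (i, j)) + 
     (\<Sum>k\<in>UNIV. kron (coeffs \<rho> (Inr k)) (join p (Inr k)) $$ (i, j))"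
    by (subst UNIV_Plus_UNIV[symmetric], subst sum.Plus) auto
  then show "pencil \<rho> n p $$ (i, j) = (kron (rl_J \<rho>) (1\<^sub>m n) - lin ?N ?N (coeffs \<rho>) (join p)) $$ (i, j)"
    using ij by (simp add: pencil_def Let_def lin_def index_mat_sum J) (simp add: coeffs_def join_def)
qed (auto simp: pencil_def Let_def)

section \<open>Coordinate isometries\<close>

text \<open>The block columns \<open>[I; 0]\<close> and, below, \<open>[0; I]\<close>. Block
  matrices are written with them, which replaces index computations by the four relations
  \<open>inlr\<close> and the resolution of the identity \<open>inl_inr_sum\<close>.\<close>

definition inl_mat :: "nat \<Rightarrow> nat \<Rightarrow> complex mat" where
  "inl_mat n m = mat (n + m) n (\<lambda>(i, j). if i = j then 1 else 0)"

definition inr_mat :: "nat \<Rightarrow> nat \<Rightarrow> complex mat" where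
  "inr_mat n m = mat (n + m) m (\<lambda>(i, j). if i = n + j then 1 else 0)"

lemma inlr_carrier [simp, intro]:
  "inl_mat n m \<in> carrier_mat (n + m) n" "inr_mat n m \<in> carrier_mat (n + m) m"
  by (simp_all add: inl_mat_def inr_mat_def)

lemma dim_inlr [simp]: "dim_row (inl_mat n m) = n + m" "dim_col (inl_mat n m) = n"
  "dim_row (inr_mat n m) = n + m" "dim_col (inr_mat n m) = m"
  by (simp_all add: inl_mat_def inr_mat_def)

lemma index_inl_mult: "i < n + m \<Longrightarrow> j < dim_col A \<Longrightarrow> dim_row A = n \<Longrightarrow>
   (inl_mat n m * A) $$ (i, j) = (if i < n then A $$ (i, j) else 0)"
  by (auto simp: inl_mat_def scalar_prod_def if_distrib[of "\<lambda>x. x * _"] cong: if_cong)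

lemma index_inr_mult: "i < n + m \<Longrightarrow> j < dim_col A \<Longrightarrow> dim_row A = m \<Longrightarrow>
   (inr_mat n m * A) $$ (i, j) = (if i < n then 0 else A $$ (i - n, j))"
proof -
  assume a: "i < n + m" "j < dim_col A" "dim_row A = m"
  have "(inr_mat n m * A) $$ (i, j) = (\<Sum>k = 0..<m. if i = n + k then A $$ (k, j) else 0)"
    using a by (auto simp: inr_mat_def scalar_prod_def intro!: sum.cong)
  also have "\<dots> = (\<Sum>k = 0..<m. if k = i - n then (if i < n then 0 else A $$ (k, j)) else 0)"
    by (rule sum.cong) auto
  also have "\<dots> = (if i < n then 0 else A $$ (i - n, j))" using a by auto
  finally show ?thesis .
qed

lemma inl_isometry: "adj (inl_mat n m) * inl_mat n m = 1\<^sub>m n"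
proof -
  have "adj (inl_mat n m) * inl_mat n m = 1\<^sub>m n"
    by (rule eq_matI) (auto simp: inl_mat_def scalar_prod_def if_distrib[of "\<lambda>x. x * _"] if_distrib[of cnj] cong: if_cong)
  then show ?thesis .
qed

lemma inr_isometry: "adj (inr_mat n m) * inr_mat n m = 1\<^sub>m m"
proof (rule eq_matI)
  fix i j assume "i < dim_row (1\<^sub>m m :: complex mat)" "j < dim_col (1\<^sub>m m :: complex mat)"
  then have ij: "i < m" "j < m" by auto
  have "(adj (inr_mat n m) * inr_mat n m) $$ (i, j) = 
     (\<Sum>k = 0..<n+m. cnj (if k = n + i then 1 else 0) * (if k = n + j then 1 else 0))"
    using ij by (simp add: inr_mat_def scalar_prod_def)
  also have "\<dots> = (\<Sum>k = 0..<n+m. if k = n + i then (if n + i = n + j then 1 else 0) else 0)"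
    by (rule sum.cong) auto
  also have "\<dots> = 1\<^sub>m m $$ (i, j)" using ij by auto
  finally show "(adj (inr_mat n m) * inr_mat n m) $$ (i, j) = 1\<^sub>m m $$ (i, j)" .
qed auto

lemma inl_inr: "adj (inl_mat n m) * inr_mat n m = 0\<^sub>m n m"
  by (rule eq_matI) (auto simp: inl_mat_def inr_mat_def scalar_prod_def intro!: sum.neutral)

lemma inr_inl: "adj (inr_mat n m) * inl_mat n m = 0\<^sub>m m n"
  by (rule eq_matI) (auto simp: inl_mat_def inr_mat_def scalar_prod_def intro!: sum.neutral)

lemma inl_inr_sum: "inl_mat n m * adj (inl_mat n m) + inr_mat n m * adj (inr_mat n m) = 1\<^sub>m (n + m)"
  by (rule eq_matI)
    (auto simp: index_inl_mult index_inr_mult simp del: index_mult_mat(1), auto simp: inl_mat_def inr_mat_def)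

text \<open>Bridge from \<open>diag_block_mat\<close> to the coordinate isometries. Right
  multiplication by the adjoint of an isometry is read off from left multiplication by taking
  adjoints.\<close>

lemma diag_block_inlr:
  assumes "A \<in> carrier_mat n n" "B \<in> carrier_mat m m"
  shows "diag_block_mat [A, B] =
    inl_mat n m * (A * adj (inl_mat n m)) + inr_mat n m * (B * adj (inr_mat n m))"
proof -
  note [simp] = assms[unfolded carrier_mat_iff]
  have 1: "(A * adj (inl_mat n m)) $$ (i, j) = (if j < n then A $$ (i, j) else 0)" if "i < n" "j < n + m" for i j
  proof -
    have "A * adj (inl_mat n m) = adj (inl_mat n m * adj A)" by (simp add: adj_mult)
    then show ?thesis using that by (auto simp: index_inl_mult simp del: index_mult_mat(1))
  qed
  have 2: "(B * adj (inr_mat n m)) $$ (i, j) = (if j < n then 0 else B $$ (i, j - n))" if "i < m" "j < n + m" for i j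
  proof -
    have "B * adj (inr_mat n m) = adj (inr_mat n m * adj B)" by (simp add: adj_mult)
    then show ?thesis using that by (auto simp: index_inr_mult simp del: index_mult_mat(1))
  qed
  show ?thesis
    by (rule eq_matI) (auto simp: index_inl_mult index_inr_mult 1 2 Let_def simp del: index_mult_mat(1))
qed

lemmas inlr = inl_isometry inr_isometry inl_inr inr_inl
lemmas inlr_left = inlr[THEN mult_eq_assoc]

section \<open>Quadratic forms\<close>

text \<open>For hermitian \<open>A\<close> the form is real anyway (\<open>hermitian_qform\<close>);
  the real part gives a real number, additive in \<open>A\<close>, without a hermitian
  premise.\<close>

definition qform :: "complex mat \<Rightarrow> complex mat \<Rightarrow> real" where
  "qform A v = Re ((adj v * (A * v)) $$ (0, 0))"

definition nrm2 :: "complex mat \<Rightarrow> real" where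
  "nrm2 v = (\<Sum>i<dim_row v. (cmod (v $$ (i, 0)))\<^sup>2)"

lemma adj_self: "v \<in> carrier_mat n 1 \<Longrightarrow> adj v * v = complex_of_real (nrm2 v) \<cdot>\<^sub>m 1\<^sub>m 1"
proof (rule eq_matI)
  fix i j assume v: "v \<in> carrier_mat n 1" and "i < dim_row (complex_of_real (nrm2 v) \<cdot>\<^sub>m 1\<^sub>m 1)" "j < dim_col (complex_of_real (nrm2 v) \<cdot>\<^sub>m 1\<^sub>m 1)"
  then have "i = 0" "j = 0" by auto
  then show "(adj v * v) $$ (i, j) = (complex_of_real (nrm2 v) \<cdot>\<^sub>m 1\<^sub>m 1) $$ (i, j)"
    using v by (auto simp: scalar_prod_def nrm2_def atLeast0LessThan complex_norm_square mult.commute simp del: of_real_power intro!: sum.cong)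
qed auto

lemma nrm2_nonneg: "0 \<le> nrm2 v"
  by (simp add: nrm2_def sum_nonneg)

lemma nrm2_eq_0: "v \<in> carrier_mat n 1 \<Longrightarrow> nrm2 v = 0 \<Longrightarrow> v = 0\<^sub>m n 1"
  by (rule eq_matI) (auto simp: nrm2_def sum_nonneg_eq_0_iff)

lemma adj_self_eq_0: "v \<in> carrier_mat n 1 \<Longrightarrow> adj v * v = 0\<^sub>m 1 1 \<Longrightarrow> v = 0\<^sub>m n 1"
proof -
  assume v: "v \<in> carrier_mat n 1" "adj v * v = 0\<^sub>m 1 1"
  have "(complex_of_real (nrm2 v) \<cdot>\<^sub>m 1\<^sub>m 1) $$ (0,0) = (0\<^sub>m 1 1 :: complex mat) $$ (0,0)"
    using adj_self[OF v(1)] v(2) by simp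
  then show ?thesis using nrm2_eq_0[OF v(1)] by simp
qed

lemma qform_add: "A \<in> carrier_mat n n \<Longrightarrow> B \<in> carrier_mat n n \<Longrightarrow> v \<in> carrier_mat n 1 \<Longrightarrow>
   qform (A + B) v = qform A v + qform B v"
  by (simp add: qform_def mat_algebra del: index_mult_mat(1))

lemma qform_minus: "A \<in> carrier_mat n n \<Longrightarrow> B \<in> carrier_mat n n \<Longrightarrow> v \<in> carrier_mat n 1 \<Longrightarrow>
   qform (A - B) v = qform A v - qform B v"
  by (simp add: qform_def mat_algebra del: index_mult_mat(1))

lemma qform_smult: "A \<in> carrier_mat n n \<Longrightarrow> v \<in> carrier_mat n 1 \<Longrightarrow>
   qform (complex_of_real k \<cdot>\<^sub>m A) v = k * qform A v"
  by (simp add: qform_def mat_algebra del: index_mult_mat(1))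

lemma qform_congruence: "A \<in> carrier_mat n n \<Longrightarrow> G \<in> carrier_mat n m \<Longrightarrow> v \<in> carrier_mat m 1 \<Longrightarrow>
   qform (adj G * (A * G)) v = qform A (G * v)"
  by (simp add: qform_def mat_algebra del: index_mult_mat(1))

lemma psd_mat_iff:
  "psd_mat n A \<longleftrightarrow> A \<in> carrier_mat n n \<and> adj A = A \<and> (\<forall>v\<in>carrier_mat n 1. 0 \<le> qform A v)"
proof -
  have *: "qform A (mat_of_cols n [v]) = Re ((A *\<^sub>v v) \<bullet>c v)" 
    if "A \<in> carrier_mat n n" "v \<in> carrier_vec n" for v
  proof -
    have "(adj (mat_of_cols n [v]) * (A * mat_of_cols n [v])) $$ (0, 0) = 
      (\<Sum>i = 0..<n. (A *\<^sub>v v) $ i * cnj (v $ i))"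
      using that by (auto simp: scalar_prod_def mat_of_cols_index mult.commute intro!: sum.cong)
    then show ?thesis using that by (simp add: qform_def scalar_prod_def)
  qed
  have **: "v = mat_of_cols n [col v 0]" "col v 0 \<in> carrier_vec n" if "v \<in> carrier_mat n 1" for v :: "complex mat"
    using that by (auto intro!: eq_matI simp: mat_of_cols_index)
  have "(\<forall>v\<in>carrier_mat n 1. 0 \<le> qform A v) \<longleftrightarrow> (\<forall>v\<in>carrier_vec n. 0 \<le> Re ((A *\<^sub>v v) \<bullet>c v))"
    if "A \<in> carrier_mat n n"
  proof
    assume "\<forall>v\<in>carrier_mat n 1. 0 \<le> qform A v"
    then show "\<forall>v\<in>carrier_vec n. 0 \<le> Re ((A *\<^sub>v v) \<bullet>c v)"
      using *[OF that, symmetric] mat_of_cols_single by auto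
  next
    assume h: "\<forall>v\<in>carrier_vec n. 0 \<le> Re ((A *\<^sub>v v) \<bullet>c v)"
    show "\<forall>v\<in>carrier_mat n 1. 0 \<le> qform A v"
    proof
      fix v :: "complex mat" assume v: "v \<in> carrier_mat n 1"
      show "0 \<le> qform A v" using h *[OF that **(2)[OF v]] **[OF v] by metis
    qed
  qed
  then show ?thesis unfolding psd_mat_def hermitian_mat_def by blast
qed

lemma psd_qform: "psd_mat n R \<Longrightarrow> v \<in> carrier_mat n 1 \<Longrightarrow> 0 \<le> qform R v"
  by (simp add: psd_mat_iff)

lemma psd_congruence: "psd_mat n R \<Longrightarrow> G \<in> carrier_mat n m \<Longrightarrow> psd_mat m (adj G * (R * G))"
  unfolding psd_mat_iff by (auto simp: qform_congruence mat_algebra)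

lemma psd_add: "psd_mat n A \<Longrightarrow> psd_mat n B \<Longrightarrow> psd_mat n (A + B)"
  unfolding psd_mat_iff by (auto simp: qform_add adj_add)

lemma psd_smult: "psd_mat n A \<Longrightarrow> 0 \<le> k \<Longrightarrow> psd_mat n (complex_of_real k \<cdot>\<^sub>m A)"
  unfolding psd_mat_iff by (auto simp: qform_smult adj_smult)

section \<open>Cauchy-Schwarz and perturbation of semidefinite matrices\<close>

lemma quadratic_discriminant:
  fixes a b c :: real
  assumes q: "\<And>t. 0 \<le> a + 2 * b * t + c * t\<^sup>2" and c: "0 \<le> c"
  shows "b\<^sup>2 \<le> a * c"
proof (cases "c = 0")
  case True
  have "b = 0"
  proof (rule ccontr)
    assume "b \<noteq> 0"
    \<comment> \<open>At this \<open>t\<close> the affine function \<open>a + 2 * b * t\<close>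
      takes the value -1.\<close>
    then show False using q[of "- (a + 1) / (2 * b)"] True by (simp add: field_simps)
  qed
  then show ?thesis using True by simp
next
  case False
  then show ?thesis using q[of "- b / c"] c by (simp add: field_simps power2_eq_square)
qed

text \<open>Cauchy-Schwarz for the semi-inner product of \<open>R\<close>, applied to
  \<open>v\<close> and \<open>R * v\<close>, whose mixed term is \<open>nrm2 (R * v)\<close>. In
  particular a vanishing form forces \<open>R * v = 0\<close>.\<close>

lemma psd_cauchy_schwarz:
  assumes R: "psd_mat n R" and v: "v \<in> carrier_mat n 1"
  shows "(nrm2 (R * v))\<^sup>2 \<le> qform R v * qform R (R * v)"
proof (rule quadratic_discriminant)
  show "0 \<le> qform R (R * v)"
    using psd_qform[OF R mult_carrier_mat[OF _ v]] R by (simp add: psd_mat_iff)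
  fix t :: real
  from R have [simp]: "R \<in> carrier_mat n n" and a: "adj R = R" by (auto simp: psd_mat_iff)
  note [simp] = carrier_matD[OF \<open>R \<in> _\<close>] carrier_matD[OF v]
  let ?w = "v + complex_of_real t \<cdot>\<^sub>m (R * v)"
  have s: "adj v * (R * (R * v)) = complex_of_real (nrm2 (R * v)) \<cdot>\<^sub>m 1\<^sub>m 1"
    using adj_self[OF mult_carrier_mat[OF \<open>R \<in> _\<close> v]] by (simp add: mat_algebra a)
  have "adj ?w * (R * ?w) = adj v * (R * v) + complex_of_real t \<cdot>\<^sub>m (adj v * (R * (R * v)))
     + complex_of_real t \<cdot>\<^sub>m (adj v * (R * (R * v)))
     + complex_of_real (t^2) \<cdot>\<^sub>m (adj (R * v) * (R * (R * v)))"
    by (rule eq_matI) (auto simp: mat_algebra a power2_eq_square distrib_left simp del: index_mult_mat(1))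
  then have "qform R ?w = qform R v + 2 * nrm2 (R * v) * t + qform R (R * v) * t\<^sup>2"
    by (simp add: qform_def s del: index_mult_mat(1) of_real_power)
  moreover have "?w \<in> carrier_mat n 1" by (simp add: carrier_mat_iff)
  then have "0 \<le> qform R ?w" by (rule psd_qform[OF R])
  ultimately show "0 \<le> qform R v + 2 * nrm2 (R * v) * t + qform R (R * v) * t\<^sup>2" by simp
qed

text \<open>The product of the moduli of two coordinates is at most half the sum of their squares,
  and the double sum of these halves is \<open>n * nrm2 w\<close>.\<close>

lemma qform_bound:
  assumes H: "H \<in> carrier_mat n n" and w: "w \<in> carrier_mat n 1"
    and \<epsilon>: "\<And>i j. i < n \<Longrightarrow> j < n \<Longrightarrow> cmod (H $$ (i, j)) \<le> \<epsilon>"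
  shows "\<bar>qform H w\<bar> \<le> \<epsilon> * n * nrm2 w"
proof -
  have "\<bar>qform H w\<bar> \<le> cmod ((adj w * (H * w)) $$ (0, 0))" by (simp add: qform_def abs_Re_le_cmod)
  also have "(adj w * (H * w)) $$ (0, 0) = (\<Sum>i<n. \<Sum>j<n. cnj (w $$ (i, 0)) * H $$ (i, j) * w $$ (j, 0))"
    using H w by (simp add: scalar_prod_def atLeast0LessThan sum_distrib_left mult.assoc)
  also have "cmod \<dots> \<le> (\<Sum>i<n. \<Sum>j<n. \<epsilon> * (((cmod (w $$ (i, 0)))\<^sup>2 + (cmod (w $$ (j, 0)))\<^sup>2) / 2))"
  proof (intro order_trans[OF norm_sum] sum_mono)
    fix i j assume ij: "i \<in> {..<n}" "j \<in> {..<n}"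
    have e: "0 \<le> \<epsilon>" using order_trans[OF norm_ge_zero \<epsilon>] ij by blast
    have "cmod (cnj (w $$ (i, 0)) * H $$ (i, j) * w $$ (j, 0)) = cmod (H $$ (i, j)) * (cmod (w $$ (i, 0)) * cmod (w $$ (j, 0)))"
      by (simp add: norm_mult)
    also have "\<dots> \<le> \<epsilon> * (((cmod (w $$ (i, 0)))\<^sup>2 + (cmod (w $$ (j, 0)))\<^sup>2) / 2)"
      using ij e sum_squares_bound[of "cmod (w $$ (i, 0))" "cmod (w $$ (j, 0))"] by (intro mult_mono \<epsilon>) auto
    finally show "cmod (cnj (w $$ (i, 0)) * H $$ (i, j) * w $$ (j, 0)) \<le> \<epsilon> * (((cmod (w $$ (i, 0)))\<^sup>2 + (cmod (w $$ (j, 0)))\<^sup>2) / 2)" .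
  qed
  also have "\<dots> = \<epsilon> * n * nrm2 w"
    using w by (simp add: nrm2_def sum_distrib_left[symmetric] sum.distrib sum_divide_distrib[symmetric]
       add_divide_distrib distrib_left)
  finally show ?thesis .
qed

text \<open>Cauchy-Schwarz divided by \<open>nrm2 (R * v)\<close>, once the form at
  \<open>R * v\<close> is bounded by a multiple of \<open>nrm2 (R * v)\<close>. The estimate
  survives for singular \<open>R\<close>, where the form has no lower bound by a positive multiple
  of \<open>nrm2 v\<close>.\<close>

lemma psd_norm_bound:
  assumes R: "psd_mat n R"
  obtains C where "0 < C" "\<And>v. v \<in> carrier_mat n 1 \<Longrightarrow> nrm2 (R * v) \<le> C * qform R v"
proof -
  from R have Rc: "R \<in> carrier_mat n n" by (simp add: psd_mat_iff)
  define M where "M = (\<Sum>i<n. \<Sum>j<n. cmod (R $$ (i, j)))"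
  have M: "cmod (R $$ (i, j)) \<le> M" if "i < n" "j < n" for i j
  proof -
    have "cmod (R $$ (i, j)) \<le> (\<Sum>j<n. cmod (R $$ (i, j)))"
      using that by (intro member_le_sum) auto
    also have "\<dots> \<le> M" unfolding M_def using that by (intro member_le_sum) (auto simp: sum_nonneg)
    finally show ?thesis .
  qed
  have M0: "M \<ge> 0" by (simp add: M_def sum_nonneg)
  show ?thesis
  \<comment> \<open>\<open>M\<close> dominates every entry of \<open>R\<close>; the summand 1 keeps
    the constant positive when \<open>M * n = 0\<close>.\<close>
  proof (rule that[of "M * n + 1"])
    show "0 < M * real n + 1" using M0 by (simp add: add_nonneg_pos)
    fix v :: "complex mat" assume v: "v \<in> carrier_mat n 1"
    have Rv: "R * v \<in> carrier_mat n 1" using Rc v by simp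
    have q: "0 \<le> qform R v" using R v by (simp add: psd_mat_iff)
    have "qform R (R * v) \<le> M * n * nrm2 (R * v)" using qform_bound[OF Rc Rv M] by linarith
    also have "\<dots> \<le> (M * n + 1) * nrm2 (R * v)" using nrm2_nonneg by (simp add: mult_right_mono)
    finally have "qform R v * qform R (R * v) \<le> qform R v * ((M * n + 1) * nrm2 (R * v))"
      using q by (rule mult_left_mono)
    with psd_cauchy_schwarz[OF R v] have "nrm2 (R * v) * nrm2 (R * v) \<le> ((M * n + 1) * qform R v) * nrm2 (R * v)"
      by (simp add: power2_eq_square mult_ac)
    then show "nrm2 (R * v) \<le> (M * n + 1) * qform R v"
      using nrm2_nonneg[of "R * v"] M0 q by (cases "nrm2 (R * v) = 0") (auto simp: mult_le_cancel_right)
  qed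
qed

text \<open>As \<open>R\<close> may be singular, smallness of \<open>R H R\<close> alone proves
  nothing. The form of \<open>R H R\<close> at \<open>v\<close> is the form of \<open>H\<close> at
  \<open>R * v\<close>, hence at most a small multiple of \<open>nrm2 (R * v)\<close>, and this
  quantity is dominated by the form of \<open>R\<close> at \<open>v\<close>.\<close>

lemma psd_perturb:
  assumes R: "psd_mat n R"
  obtains \<delta> where "0 < \<delta>" "\<And>H. hermitian_mat n H \<Longrightarrow> (\<And>i j. i < n \<Longrightarrow> j < n \<Longrightarrow> cmod (H $$ (i, j)) \<le> \<delta>) \<Longrightarrow>
     psd_mat n (R - R * (H * R)) \<and> (\<forall>z\<in>carrier_mat n 1. z = H * (R * z) \<longrightarrow> z = 0\<^sub>m n 1)"
proof -
  obtain C where C: "0 < C" "\<And>v. v \<in> carrier_mat n 1 \<Longrightarrow> nrm2 (R * v) \<le> C * qform R v"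
    using psd_norm_bound[OF R] by blast
  \<comment> \<open>Chosen for \<open>\<delta> * n * C \<le> 1/2\<close>; with \<open>n + 1\<close>
    in place of \<open>n\<close> the choice makes sense also for \<open>n = 0\<close>.\<close>
  define \<delta> where "\<delta> = 1 / (2 * C * (n + 1))"
  have \<delta>: "0 < \<delta>" using C by (simp add: \<delta>_def)
  have "\<delta> * n * C = n / (2 * (n + 1))" using C by (simp add: \<delta>_def divide_simps)
  also have "\<dots> \<le> 1/2" by (simp add: field_simps)
  finally have \<delta>C: "\<delta> * n * C \<le> 1/2" .
  from R have Rc[simp]: "R \<in> carrier_mat n n" and a: "adj R = R" by (auto simp: psd_mat_iff)
  note [simp] = carrier_matD[OF Rc]
  show ?thesis
  proof (rule that[OF \<delta>])
    fix H assume "hermitian_mat n H" and small: "\<And>i j. i < n \<Longrightarrow> j < n \<Longrightarrow> cmod (H $$ (i, j)) \<le> \<delta>"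
    then have Hc[simp]: "H \<in> carrier_mat n n" and h: "adj H = H" by (auto simp: hermitian_mat_def)
    note [simp] = carrier_matD[OF Hc]
    have b: "qform H (R * v) \<le> qform R v / 2" if v: "v \<in> carrier_mat n 1" for v
    proof -
      have "qform H (R * v) \<le> \<delta> * n * nrm2 (R * v)"
        using qform_bound[OF Hc mult_carrier_mat[OF Rc v] small] by linarith
      also have "\<dots> \<le> \<delta> * n * (C * qform R v)" using C(2)[OF v] \<delta> by (intro mult_left_mono) auto
      also have "\<dots> = (\<delta> * n * C) * qform R v" by simp
      also have "\<dots> \<le> 1/2 * qform R v" using \<delta>C R v by (intro mult_right_mono) (auto simp: psd_mat_iff)
      finally show ?thesis by simp
    qed
    have q: "qform (R * (H * R)) v = qform H (R * v)" if "v \<in> carrier_mat n 1" for v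
      using qform_congruence[of H n R n v] that a by simp
    have "psd_mat n (R - R * (H * R))"
      unfolding psd_mat_iff
    proof (intro conjI ballI)
      fix v :: "complex mat" assume v: "v \<in> carrier_mat n 1"
      have "0 \<le> qform R v" using R v by (simp add: psd_mat_iff)
      then show "0 \<le> qform (R - R * (H * R)) v"
        using b[OF v] q[OF v] v by (subst qform_minus[of _ n]) auto
    qed (auto simp: mat_algebra a h)
    \<comment> \<open>For a fixed vector the form of \<open>H\<close> at \<open>R * z\<close> equals
      the form of \<open>R\<close> at \<open>z\<close>. Being at most half of itself, it vanishes,
      so \<open>R * z = 0\<close> and then \<open>z = 0\<close>.\<close>
    moreover have "z = 0\<^sub>m n 1" if z: "z \<in> carrier_mat n 1" "z = H * (R * z)" for z
    proof -
      have "adj (R * z) * (H * (R * z)) = adj z * (R * z)" using z(1) z(2)[symmetric] by (simp add: mat_algebra a)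
      then have "qform H (R * z) = qform R z" by (simp add: qform_def)
      with b[OF z(1)] have "qform R z \<le> 0" by simp
      then have "C * qform R z \<le> 0" using C(1) by (simp add: mult_le_0_iff)
      then have "nrm2 (R * z) = 0" using C(2)[OF z(1)] nrm2_nonneg[of "R * z"] by simp
      then have "R * z = 0\<^sub>m n 1" using nrm2_eq_0[OF mult_carrier_mat[OF Rc z(1)]] by blast
      then have "H * (R * z) = 0\<^sub>m n 1" by (simp add: mat_algebra)
      then show ?thesis using z(2) by metis
    qed
    ultimately show "psd_mat n (R - R * (H * R)) \<and> (\<forall>z\<in>carrier_mat n 1. z = H * (R * z) \<longrightarrow> z = 0\<^sub>m n 1)"
      by blast
  qed
qed

text \<open>\<open>R - s R H R\<close> is the convex combination of \<open>R\<close> and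
  \<open>R - R H R\<close>. For \<open>s < 1\<close> a vector with \<open>z = s H R z\<close> gives
  the combination the value 0; both terms being nonnegative, the form of \<open>R\<close> vanishes
  at \<open>z\<close>, whence \<open>R * z = 0\<close> and \<open>z = 0\<close>. For
  \<open>s = 1\<close> the claim is the premise \<open>inj\<close>.\<close>

lemma psd_interpolate:
  assumes R: "psd_mat n R" and H: "hermitian_mat n H" and RH: "psd_mat n (R - R * (H * R))"
    and inj: "\<And>z. z \<in> carrier_mat n 1 \<Longrightarrow> z = H * (R * z) \<Longrightarrow> z = 0\<^sub>m n 1"
    and s: "0 \<le> s" "s \<le> 1"
  defines "Hs \<equiv> complex_of_real s \<cdot>\<^sub>m H"
  shows "psd_mat n (R - R * (Hs * R))" 
    and "z \<in> carrier_mat n 1 \<Longrightarrow> z = Hs * (R * z) \<Longrightarrow> z = 0\<^sub>m n 1"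
proof -
  from R have Rc[simp]: "R \<in> carrier_mat n n" and a: "adj R = R" by (auto simp: psd_mat_iff)
  from H have Hc[simp]: "H \<in> carrier_mat n n" and h: "adj H = H" by (auto simp: hermitian_mat_def)
  note [simp] = carrier_matD[OF Rc] carrier_matD[OF Hc]
  have eq: "R - R * (Hs * R) = complex_of_real (1 - s) \<cdot>\<^sub>m R + complex_of_real s \<cdot>\<^sub>m (R - R * (H * R))"
    by (rule eq_matI) (auto simp: Hs_def mat_algebra algebra_simps simp del: index_mult_mat(1))
  show "psd_mat n (R - R * (Hs * R))"
    unfolding eq using s by (intro psd_add psd_smult R RH) auto
  assume z: "z \<in> carrier_mat n 1" "z = Hs * (R * z)"
  show "z = 0\<^sub>m n 1"
  proof (cases "s = 1")
    case True
    have "Hs = H" using True by (auto simp: Hs_def)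
    then show ?thesis using inj[OF z(1)] z(2) by metis
  next
    case False
    have "R * (Hs * R) * z = R * (Hs * (R * z))" using z(1) by (simp add: mat_algebra Hs_def)
    also have "\<dots> = R * z" using z(2) by metis
    finally have "R * (Hs * R) * z = R * z" .
    then have "(R - R * (Hs * R)) * z = 0\<^sub>m n 1" using z(1)
      by (simp add: mmult_minus_left Hs_def add_zero_mat)
    then have "qform (R - R * (Hs * R)) z = 0" using z(1) by (simp add: qform_def mat_algebra)
    moreover have "qform (R - R * (Hs * R)) z = (1 - s) * qform R z + s * qform (R - R * (H * R)) z"
    proof -
      have c: "R - R * (H * R) \<in> carrier_mat n n" by (simp add: carrier_mat_iff)
      show ?thesis unfolding eq
        by (subst qform_add[OF _ _ z(1)]) (simp_all add: c qform_smult[OF _ z(1)] del: of_real_diff)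
    qed
    moreover have "0 \<le> (1 - s) * qform R z" "0 \<le> s * qform (R - R * (H * R)) z"
      using R RH z(1) s by (auto simp: psd_mat_iff)
    ultimately have "(1 - s) * qform R z = 0" by linarith
    then have "qform R z = 0" using False by simp
    then have "nrm2 (R * z) = 0" using psd_cauchy_schwarz[OF R z(1)] by simp
    then have "R * z = 0\<^sub>m n 1" using nrm2_eq_0[OF mult_carrier_mat[OF Rc z(1)]] by blast
    then have "Hs * (R * z) = 0\<^sub>m n 1" by (simp add: mat_algebra Hs_def)
    then show ?thesis using z(2) by metis
  qed
qed

section \<open>Perturbation of inverses\<close>

lemma resolvent_identity:
  fixes L :: "complex mat"
  assumes c: "L \<in> carrier_mat n n" "L' \<in> carrier_mat n n" "M \<in> carrier_mat n n" "Li \<in> carrier_mat n n" "Li' \<in> carrier_mat n n"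
    and i: "Li * L = 1\<^sub>m n" "L' * Li' = 1\<^sub>m n" and L: "L = L' + M"
  shows "Li' = Li + Li * (M * Li')"
proof -
  note [simp] = c[unfolded carrier_mat_iff]
  have "Li' = Li * (L * Li')" by (simp add: mult_eq_assoc[OF i(1)] mat_algebra)
  also have "\<dots> = Li + Li * (M * Li')" unfolding L by (simp add: mat_algebra i)
  finally show ?thesis .
qed

lemma resolvent_identity':
  fixes L :: "complex mat"
  assumes c: "L \<in> carrier_mat n n" "L' \<in> carrier_mat n n" "M \<in> carrier_mat n n" "Li \<in> carrier_mat n n" "Li' \<in> carrier_mat n n"
    and i: "L * Li = 1\<^sub>m n" "Li' * L' = 1\<^sub>m n" and L: "L = L' + M"
  shows "Li' = Li + Li' * (M * Li)"
proof -
  note [simp] = c[unfolded carrier_mat_iff]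
  have "Li' = Li' * (L * Li)" by (simp add: i mat_algebra)
  also have "\<dots> = Li + Li' * (M * Li)" unfolding L by (simp add: mat_algebra mult_eq_assoc[OF i(2)])
  finally show ?thesis .
qed

text \<open>At the equally spaced points \<open>L - M\<close>, \<open>L\<close>,
  \<open>L + M\<close> the first-order terms of the two resolvent expansions cancel, and the
  remainder \<open>Z M (X + Y) M Z\<close> is exact. Thus one identity serves finite steps and,
  after division by the square of the step, second derivatives.\<close>

lemma second_difference:
  fixes L :: "complex mat"
  assumes c: "L \<in> carrier_mat n n" "M \<in> carrier_mat n n" "Lx \<in> carrier_mat n n" "Ly \<in> carrier_mat n n" 
     "Z \<in> carrier_mat n n" "X \<in> carrier_mat n n" "Y \<in> carrier_mat n n"
    and i: "L * Z = 1\<^sub>m n" "Z * L = 1\<^sub>m n" "Lx * X = 1\<^sub>m n" "X * Lx = 1\<^sub>m n" "Ly * Y = 1\<^sub>m n" "Y * Ly = 1\<^sub>m n"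
    and L: "Lx = L + M" "L = Ly + M"
  shows "X + Y = (Z + Z) + Z * (M * ((X + Y) * (M * Z)))"
proof -
  note [simp] = c[unfolded carrier_mat_iff]
  have y1: "Y = Z + Z * (M * Y)" by (rule resolvent_identity[of L _ Ly]) (use c i L in auto)
  have y2: "Y = Z + Y * (M * Z)" by (rule resolvent_identity'[of L _ Ly]) (use c i L in auto)
  have x1: "Z = X + Z * (M * X)" by (rule resolvent_identity'[of Lx _ L]) (use c i L in auto)
  have x2: "Z = X + X * (M * Z)" by (rule resolvent_identity[of Lx _ L]) (use c i L in auto)
  have "Z * (M * Y) = Z * (M * (Z + Y * (M * Z)))" using y2 by metis
  then have e1: "Z * (M * Y) = Z * (M * Z) + Z * (M * (Y * (M * Z)))" by (simp add: mat_algebra)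
  have "Z * (M * Z) = Z * (M * (X + X * (M * Z)))" using x2 by metis
  then have e2: "Z * (M * Z) = Z * (M * X) + Z * (M * (X * (M * Z)))" by (simp add: mat_algebra)
  show ?thesis
  proof (rule eq_matI)
    fix i j assume "i < dim_row ((Z + Z) + Z * (M * ((X + Y) * (M * Z))))" "j < dim_col ((Z + Z) + Z * (M * ((X + Y) * (M * Z))))"
    then have ij: "i < n" "j < n" by auto
    have "Y $$ (i, j) = (Z + Z * (M * Y)) $$ (i, j)" using y1 by metis
    moreover have "Z $$ (i, j) = (X + Z * (M * X)) $$ (i, j)" using x1 by metis
    ultimately show "(X + Y) $$ (i, j) = ((Z + Z) + Z * (M * ((X + Y) * (M * Z)))) $$ (i, j)"
      using arg_cong[OF e1, of "\<lambda>A. A $$ (i, j)"] arg_cong[OF e2, of "\<lambda>A. A $$ (i, j)"] ij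
      by (simp add: mat_algebra del: index_mult_mat(1))
  qed auto
qed

text \<open>For a kernel vector \<open>v\<close> of \<open>L'\<close>, the vector
  \<open>L * v\<close> has the form \<open>W * z\<close> with \<open>z = H * (adj W * v)\<close>.
  Hence \<open>v = Li * (W * z)\<close> and \<open>z = H * (R * z)\<close>: singularity is decided
  by the small matrix \<open>1 - H R\<close>.\<close>

lemma compression_det:
  assumes c: "L \<in> carrier_mat n n" "L' \<in> carrier_mat n n" "Li \<in> carrier_mat n n" "W \<in> carrier_mat n m" "H \<in> carrier_mat m m"
    and i: "Li * L = 1\<^sub>m n" and L: "L = L' + W * (H * adj W)"
    and R: "R = adj W * (Li * W)"
    and inj: "\<And>z. z \<in> carrier_mat m 1 \<Longrightarrow> z = H * (R * z) \<Longrightarrow> z = 0\<^sub>m m 1"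
  shows "det L' \<noteq> 0"
proof (rule det_nonzeroI[OF c(2)])
  note [simp] = c[unfolded carrier_mat_iff]
  fix v :: "complex mat" assume v: "v \<in> carrier_mat n 1" "L' * v = 0\<^sub>m n 1"
  note [simp] = carrier_matD[OF v(1)]
  define z where "z = H * (adj W * v)"
  have z: "z \<in> carrier_mat m 1" by (simp add: z_def carrier_mat_iff)
  note [simp] = carrier_matD[OF z]
  have "L * v = W * z" unfolding L z_def by (simp add: mat_algebra v add_zero_mat)
  then have "Li * (L * v) = Li * (W * z)" by simp
  then have v': "v = Li * (W * z)" by (simp add: mult_eq_assoc[OF i] mat_algebra)
  have "R * z = adj W * v" unfolding R by (subst v') (simp add: mat_algebra)
  then have "z = H * (R * z)" by (simp add: z_def)
  from inj[OF z this] v' show "v = 0\<^sub>m n 1" by (simp add: mat_algebra)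
qed

text \<open>The two resolvent identities compress to \<open>R' = R + R H R'\<close> and
  \<open>R' = R + R' H R\<close>. The second says \<open>R' (1 - H R) = R\<close>; the first makes
  \<open>1 + H R'\<close> an inverse of \<open>1 - H R\<close>, so the congruence can be used in
  both directions.\<close>

lemma
  assumes c: "L \<in> carrier_mat n n" "L' \<in> carrier_mat n n" "Li \<in> carrier_mat n n" "Li' \<in> carrier_mat n n"
      "W \<in> carrier_mat n m" "H \<in> carrier_mat m m"
    and i: "L * Li = 1\<^sub>m n" "Li * L = 1\<^sub>m n" "L' * Li' = 1\<^sub>m n" "Li' * L' = 1\<^sub>m n" 
    and L: "L = L' + W * (H * adj W)"
    and h: "adj L = L" "adj H = H" "adj L' = L'"
    and R: "R = adj W * (Li * W)" and R': "R' = adj W * (Li' * W)"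
  shows compression_psd_iff: "psd_mat m R' \<longleftrightarrow> psd_mat m (R - R * (H * R))"
    and compression_inj: "z \<in> carrier_mat m 1 \<Longrightarrow> z = H * (R * z) \<Longrightarrow> z = 0\<^sub>m m 1"
proof -
  note [simp] = c[unfolded carrier_mat_iff]
  have a: "adj Li = Li" "adj Li' = Li'" using hermitian_inverse c i h by blast+
  have [simp]: "dim_row R = m" "dim_col R = m" "dim_row R' = m" "dim_col R' = m" by (simp_all add: R R')
  have aR: "adj R = R" "adj R' = R'" by (simp_all add: R R' a mat_algebra)
  have M: "W * (H * adj W) \<in> carrier_mat n n" by (simp add: carrier_mat_iff)
  have "Li' = Li + Li * (W * (H * adj W) * Li')" 
    by (rule resolvent_identity[of L _ L']) (use c i L M in auto)
  then have "R' = adj W * ((Li + Li * (W * (H * adj W) * Li')) * W)" unfolding R' by simp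
  also have "\<dots> = R + R * (H * R')" by (simp add: R R' mat_algebra)
  finally have 1: "R' = R + R * (H * R')" .
  have "Li' = Li + Li' * (W * (H * adj W) * Li)" 
    by (rule resolvent_identity'[of L _ L']) (use c i L M in auto)
  then have "R' = adj W * ((Li + Li' * (W * (H * adj W) * Li)) * W)" unfolding R' by simp
  also have "\<dots> = R + R' * (H * R)" by (simp add: R R' mat_algebra)
  finally have 2: "R' = R + R' * (H * R)" .
  define G where "G = 1\<^sub>m m - H * R"
  define K where "K = 1\<^sub>m m + H * R'"
  have [simp]: "dim_row G = m" "dim_col G = m" "dim_row K = m" "dim_col K = m" by (simp_all add: G_def K_def)
  have "R' - R' * (H * R) = (R + R' * (H * R)) - R' * (H * R)" using 2 by metis
  also have "\<dots> = R" by (rule eq_matI) (auto simp del: index_mult_mat(1))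
  finally have RG: "R' * G = R" by (simp add: G_def mat_algebra)
  then have A: "R - R * (H * R) = adj G * (R' * G)" by (simp add: G_def mat_algebra aR h)
  have HR: "H * R' = H * R + H * (R * (H * R'))" using arg_cong[OF 1, of "\<lambda>x. H * x"] by (simp add: mat_algebra)
  have GK: "G * K = 1\<^sub>m m"
  proof (rule eq_matI)
    fix i j assume "i < dim_row (1\<^sub>m m :: complex mat)" "j < dim_col (1\<^sub>m m :: complex mat)"
    then show "(G * K) $$ (i, j) = 1\<^sub>m m $$ (i, j)"
      using arg_cong[OF HR, of "\<lambda>A. A $$ (i, j)"]
      by (simp add: G_def K_def mat_algebra del: index_mult_mat(1))
  qed auto
  have KG: "K * G = 1\<^sub>m m" by (rule right_inverse_imp_left[OF _ _ GK]) (auto simp: carrier_mat_iff)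
  have B: "R' = adj K * ((R - R * (H * R)) * K)"
  proof -
    have "R - R * (H * R) = R * G" by (simp add: G_def mat_algebra)
    then have "(R - R * (H * R)) * K = R" by (simp add: mmult_assoc GK mat_algebra)
    then have "adj K * ((R - R * (H * R)) * K) = R + R' * (H * R)" by (simp add: K_def mat_algebra aR h)
    then show ?thesis using 2 by metis
  qed
  show "psd_mat m R' \<longleftrightarrow> psd_mat m (R - R * (H * R))"
  proof
    show "psd_mat m (R - R * (H * R))" if "psd_mat m R'"
      unfolding A by (rule psd_congruence[OF that]) (simp add: carrier_mat_iff)
    show "psd_mat m R'" if "psd_mat m (R - R * (H * R))"
      by (subst B, rule psd_congruence[OF that]) (simp add: carrier_mat_iff)
  qed
  assume z: "z \<in> carrier_mat m 1" "z = H * (R * z)"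
  note [simp] = carrier_matD[OF z(1)]
  have "G * z = z - H * (R * z)" by (simp add: G_def mat_algebra)
  also have "\<dots> = 0\<^sub>m m 1" using z(2)[symmetric] by (simp add: add_zero_mat)
  finally have "K * (G * z) = 0\<^sub>m m 1" by (simp add: mat_algebra)
  then show "z = 0\<^sub>m m 1" by (simp add: mult_eq_assoc[OF KG] mat_algebra)
qed

section \<open>Subspaces\<close>

definition col_subspace :: "nat \<Rightarrow> complex mat set \<Rightarrow> bool" where
  "col_subspace n S \<longleftrightarrow> S \<subseteq> carrier_mat n 1 \<and> 0\<^sub>m n 1 \<in> S \<and>
     (\<forall>v\<in>S. \<forall>w\<in>S. v + w \<in> S) \<and> (\<forall>v\<in>S. \<forall>k. k \<cdot>\<^sub>m v \<in> S)"

text \<open>Were the isometry wider than high, padding by zero rows would make it a square isometry,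
  hence unitary, although its last rows vanish.\<close>

lemma isometry_dim:
  assumes V: "V \<in> carrier_mat n d" and i: "adj V * V = 1\<^sub>m d"
  shows "d \<le> n"
proof (rule ccontr)
  assume "\<not> d \<le> n"
  then obtain k where d: "d = n + k" and k: "0 < k" by (metis less_imp_add_positive not_le)
  note [simp] = carrier_matD[OF V]
  define U where "U = inl_mat n k * V"
  have U: "U \<in> carrier_mat d d" by (simp add: U_def carrier_mat_iff d)
  note [simp] = carrier_matD[OF U]
  have "adj U * U = 1\<^sub>m d" by (simp add: U_def mat_algebra inlr_left i)
  then have UU: "U * adj U = 1\<^sub>m d" using right_inverse_imp_left[of "adj U" d U] U by auto
  have "adj (inr_mat n k) * U = 0\<^sub>m k d" by (simp add: U_def inlr_left mat_algebra d)
  then have "adj (inr_mat n k) * (U * adj U) = 0\<^sub>m k d" by (simp add: mmult_assoc[symmetric] mat_algebra d[symmetric])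
  then have "adj (inr_mat n k) * inr_mat n k = 0\<^sub>m k k" unfolding UU by (simp add: mat_algebra d)
  then have "1\<^sub>m k $$ (0, 0) = (0\<^sub>m k k :: complex mat) $$ (0, 0)" by (simp only: inlr)
  then show False using k by simp
qed

text \<open>A Gram-Schmidt step. The normalizing factor \<open>k = 1 / sqrt (nrm2 w)\<close> is left
  existential, since only the directions of the new columns matter later.\<close>

lemma isometry_extend:
  assumes V: "V \<in> carrier_mat n d" and i: "adj V * V = 1\<^sub>m d"
    and w: "w \<in> carrier_mat n 1" and wV: "adj V * w = 0\<^sub>m d 1" and w0: "w \<noteq> 0\<^sub>m n 1"
  obtains k U where "U \<in> carrier_mat n (d + 1)" "adj U * U = 1\<^sub>m (d + 1)"
    "U = V * adj (inl_mat d 1) + (k \<cdot>\<^sub>m w) * adj (inr_mat d 1)"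
proof -
  note [simp] = carrier_matD[OF V] carrier_matD[OF w]
  have p: "nrm2 w > 0" using nrm2_nonneg[of w] nrm2_eq_0[OF w] w0 by fastforce
  define k where "k = complex_of_real (1 / sqrt (nrm2 w))"
  define u where "u = k \<cdot>\<^sub>m w"
  have [simp]: "dim_row u = n" "dim_col u = 1" by (simp_all add: u_def)
  have kk: "cnj k * (k * complex_of_real (nrm2 w)) = 1"
  proof -
    have "cnj k * (k * complex_of_real (nrm2 w)) = complex_of_real ((1 / sqrt (nrm2 w)) * ((1 / sqrt (nrm2 w)) * nrm2 w))"
      unfolding k_def by (simp only: complex_cnj_complex_of_real of_real_mult)
    also have "(1 / sqrt (nrm2 w)) * ((1 / sqrt (nrm2 w)) * nrm2 w) = 1" using p by (simp add: real_div_sqrt)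
    finally show ?thesis by simp
  qed
  have uu: "adj u * u = 1\<^sub>m 1"
    using kk by (auto simp: u_def mat_algebra adj_self[OF w] mult_ac intro!: eq_matI)
  have Vu: "adj V * u = 0\<^sub>m d 1" by (auto simp: u_def mat_algebra wV)
  have uV: "adj u * V = 0\<^sub>m 1 d" using arg_cong[OF Vu, of adj] by (simp add: mat_algebra)
  define U where "U = V * adj (inl_mat d 1) + u * adj (inr_mat d 1)"
  note s = i Vu uV uu
  have "adj U * U = 1\<^sub>m (d + 1)"
    unfolding inl_inr_sum[symmetric] by (simp add: U_def mat_algebra s s[THEN mult_eq_assoc] add_zero_mat)
  then show ?thesis using that[of U k] by (auto simp: U_def u_def carrier_mat_iff)
qed

text \<open>An orthonormal basis obtained as an isometry of greatest width with range in
  \<open>S\<close>. If some \<open>w\<close> in \<open>S\<close> were not reproduced, its component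
  orthogonal to the range could be appended.\<close>

lemma subspace_basis:
  assumes S: "col_subspace n S"
  obtains V d where "V \<in> carrier_mat n d" "adj V * V = 1\<^sub>m d" "\<And>v. v \<in> carrier_mat d 1 \<Longrightarrow> V * v \<in> S"
    "\<And>w. w \<in> S \<Longrightarrow> V * (adj V * w) = w"
proof -
  define P where "P d \<longleftrightarrow> (\<exists>V\<in>carrier_mat n d. adj V * V = 1\<^sub>m d \<and> (\<forall>v\<in>carrier_mat d 1. V * v \<in> S))" for d
  have "P 0" unfolding P_def
  proof (intro bexI[of _ "0\<^sub>m n 0"] conjI ballI)
    show "adj (0\<^sub>m n 0) * 0\<^sub>m n 0 = 1\<^sub>m 0" by (rule eq_matI) auto
    show "0\<^sub>m n 0 * v \<in> S" if "v \<in> carrier_mat 0 1" for v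
    proof -
      have "0\<^sub>m n 0 * v = 0\<^sub>m n 1" using that by (simp add: mmult_zero)
      then show ?thesis using S by (simp add: col_subspace_def)
    qed
  qed simp
  moreover have "\<forall>d. P d \<longrightarrow> d \<le> n"
  proof (intro allI impI)
    fix d assume "P d"
    then obtain V where "V \<in> carrier_mat n d" "adj V * V = 1\<^sub>m d" unfolding P_def by metis
    then show "d \<le> n" by (rule isometry_dim)
  qed
  ultimately have d: "P (Greatest P)" and max: "\<forall>d'. P d' \<longrightarrow> d' \<le> Greatest P"
    by (auto intro: GreatestI_nat[of P 0 n] Greatest_le_nat[of P _ n])
  define d where "d = Greatest P"
  note d = d[folded d_def] and max = max[folded d_def]
  from d obtain V where V: "V \<in> carrier_mat n d" and i: "adj V * V = 1\<^sub>m d" 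
    and VS: "\<And>v. v \<in> carrier_mat d 1 \<Longrightarrow> V * v \<in> S" by (auto simp: P_def)
  note [simp] = carrier_matD[OF V]
  have "V * (adj V * w) = w" if w: "w \<in> S" for w
  proof (rule ccontr)
    assume ne: "V * (adj V * w) \<noteq> w"
    have wc: "w \<in> carrier_mat n 1" using w S by (auto simp: col_subspace_def)
    note [simp] = carrier_matD[OF wc]
    define w' where "w' = w + (- 1) \<cdot>\<^sub>m (V * (adj V * w))"
    have "V * (adj V * w) \<in> S" by (rule VS) (simp add: carrier_mat_iff)
    then have w'S: "w' \<in> S" using w S unfolding w'_def col_subspace_def by blast
    then have w'c: "w' \<in> carrier_mat n 1" using S by (auto simp: col_subspace_def)
    note [simp] = carrier_matD[OF w'c]
    have o: "adj V * w' = 0\<^sub>m d 1"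
      by (rule eq_matI) (auto simp: w'_def mat_algebra i i[THEN mult_eq_assoc] simp del: index_mult_mat(1))
    have "w' \<noteq> 0\<^sub>m n 1"
    proof
      assume e: "w' = 0\<^sub>m n 1"
      have "V * (adj V * w) = w"
      proof (rule eq_matI)
        fix a b assume "a < dim_row w" "b < dim_col w"
        moreover have "w' $$ (a, b) = (0\<^sub>m n 1 :: complex mat) $$ (a, b)" using e by simp
        ultimately show "(V * (adj V * w)) $$ (a, b) = w $$ (a, b)"
          by (simp add: w'_def del: index_mult_mat(1))
      qed auto
      with ne show False ..
    qed
    from isometry_extend[OF V i w'c o this] obtain k U where U: "U \<in> carrier_mat n (d + 1)" "adj U * U = 1\<^sub>m (d + 1)"
      "U = V * adj (inl_mat d 1) + (k \<cdot>\<^sub>m w') * adj (inr_mat d 1)" by metis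
    have "U * v \<in> S" if v: "v \<in> carrier_mat (d + 1) 1" for v
    proof -
      note [simp] = carrier_matD[OF v]
      have vv: "V * (adj (inl_mat d 1) * v) \<in> S" by (rule VS) (simp add: carrier_mat_iff)
      define x where "x = adj (inr_mat d 1) * v"
      have x: "x \<in> carrier_mat 1 1" by (simp add: x_def carrier_mat_iff)
      have "(k \<cdot>\<^sub>m w') * x = (k * x $$ (0, 0)) \<cdot>\<^sub>m w'"
        using x by (intro eq_matI) (auto simp: scalar_prod_def)
      then have ww: "(k \<cdot>\<^sub>m w') * x \<in> S" using w'S S by (auto simp: col_subspace_def)
      have "U * v = V * (adj (inl_mat d 1) * v) + (k \<cdot>\<^sub>m w') * x"
        by (simp add: U(3) mat_algebra x_def)
      then show ?thesis using vv ww S by (auto simp: col_subspace_def)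
    qed
    then have "P (d + 1)" using U by (auto simp: P_def)
    then show False using max by fastforce
  qed
  with that V i VS show ?thesis by blast
qed

text \<open>The residual of \<open>x\<close> after projection to \<open>S\<close> is orthogonal to
  \<open>S\<close>, hence to \<open>x\<close> by assumption, hence to itself.\<close>

lemma subspace_double_perp:
  assumes S: "col_subspace n S" and x: "x \<in> carrier_mat n 1"
    and perp: "\<And>y. y \<in> carrier_mat n 1 \<Longrightarrow> (\<And>s. s \<in> S \<Longrightarrow> adj y * s = 0\<^sub>m 1 1) \<Longrightarrow> adj y * x = 0\<^sub>m 1 1"
  shows "x \<in> S"
proof -
  obtain V d where V: "V \<in> carrier_mat n d" "adj V * V = 1\<^sub>m d" "\<And>v. v \<in> carrier_mat d 1 \<Longrightarrow> V * v \<in> S"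
    "\<And>w. w \<in> S \<Longrightarrow> V * (adj V * w) = w" using subspace_basis[OF S] by blast
  note [simp] = carrier_matD[OF V(1)] carrier_matD[OF x]
  define y where "y = x - V * (adj V * x)"
  have y: "y \<in> carrier_mat n 1" by (simp add: y_def carrier_mat_iff)
  note [simp] = carrier_matD[OF y]
  have yV: "adj y * V = 0\<^sub>m 1 d" by (simp add: y_def mat_algebra V(2) add_zero_mat)
  have "adj y * s = 0\<^sub>m 1 1" if s: "s \<in> S" for s
  proof -
    have [simp]: "dim_row s = n" "dim_col s = 1" using s S by (auto simp: col_subspace_def)
    have "adj y * s = adj y * (V * (adj V * s))" using V(4)[OF s] by simp
    also have "\<dots> = 0\<^sub>m 1 1" by (simp add: mult_eq_assoc[OF yV] mat_algebra)
    finally show ?thesis .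
  qed
  from perp[OF y this] have yx: "adj y * x = 0\<^sub>m 1 1" .
  have "adj y * y = adj y * x - adj y * (V * (adj V * x))" unfolding y_def[symmetric]
    by (subst (2) y_def) (simp add: mat_algebra)
  also have "\<dots> = 0\<^sub>m 1 1" by (simp add: mult_eq_assoc[OF yV] yx mat_algebra add_zero_mat)
  finally have y0: "y = 0\<^sub>m n 1" by (rule adj_self_eq_0[OF y])
  have "V * (adj V * x) = x"
  proof (rule eq_matI)
    fix a b assume "a < dim_row x" "b < dim_col x"
    moreover have "y $$ (a, b) = (0\<^sub>m n 1 :: complex mat) $$ (a, b)" using y0 by simp
    ultimately show "(V * (adj V * x)) $$ (a, b) = x $$ (a, b)"
      by (simp add: y_def del: index_mult_mat(1))
  qed auto
  moreover have "V * (adj V * x) \<in> S" by (rule V(3)) (simp add: carrier_mat_iff)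
  ultimately show ?thesis by simp
qed

text \<open>In finite dimension an injective map of the range of \<open>V\<close> into itself is
  onto, so the inverse preserves the range as well. \<open>G\<close> is the matrix of the restricted
  map.\<close>

lemma inverse_invariant:
  assumes c: "V \<in> carrier_mat n d" "B \<in> carrier_mat n n" "Bi \<in> carrier_mat n n"
    and i: "adj V * V = 1\<^sub>m d" "Bi * B = 1\<^sub>m n"
    and inv: "B * V = V * (adj V * (B * V))"
  shows "Bi * V = V * (adj V * (Bi * V))"
proof -
  note [simp] = c[unfolded carrier_mat_iff]
  define G where "G = adj V * (B * V)"
  have G: "G \<in> carrier_mat d d" by (simp add: G_def carrier_mat_iff)
  note [simp] = carrier_matD[OF G]
  have BV: "B * V = V * G" using inv by (simp add: G_def)
  have "det G \<noteq> 0"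
  proof (rule det_nonzeroI[OF G])
    fix x :: "complex mat" assume x: "x \<in> carrier_mat d 1" "G * x = 0\<^sub>m d 1"
    note [simp] = carrier_matD[OF x(1)]
    have "B * (V * x) = 0\<^sub>m n 1" by (simp add: mult_eq_assoc[OF BV] mmult_assoc x mat_algebra)
    then have "Bi * (B * (V * x)) = 0\<^sub>m n 1" by (simp add: mat_algebra)
    then have "V * x = 0\<^sub>m n 1" by (simp add: mult_eq_assoc[OF i(2)] mat_algebra)
    then have "adj V * (V * x) = 0\<^sub>m d 1" by (simp add: mat_algebra)
    then show "x = 0\<^sub>m d 1" by (simp add: mult_eq_assoc[OF i(1)] mat_algebra)
  qed
  then obtain Gi where Gi: "Gi \<in> carrier_mat d d" "G * Gi = 1\<^sub>m d" using mat_inverse_det[OF G] by metis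
  note [simp] = carrier_matD[OF Gi(1)]
  have "Bi * (B * (V * Gi)) = Bi * V" by (simp add: mult_eq_assoc[OF BV] mmult_assoc Gi mat_algebra)
  then have "V * Gi = Bi * V" by (simp add: mult_eq_assoc[OF i(2)] mat_algebra)
  then show ?thesis by (simp add: mult_eq_assoc[OF i(1)] mat_algebra flip: \<open>V * Gi = Bi * V\<close>)
qed

section \<open>Compression of a realization to an invariant subspace\<close>

text \<open>Zero rows make \<open>B\<close> square; the result has vanishing last rows and is
  therefore singular.\<close>

lemma kernel_vector:
  fixes B :: "complex mat"
  assumes B: "B \<in> carrier_mat k d" and kd: "k < d"
  obtains w where "w \<in> carrier_mat d 1" "w \<noteq> 0\<^sub>m d 1" "B * w = 0\<^sub>m k 1"
proof -
  obtain m where d: "d = k + m" and m: "0 < m" using kd by (metis less_imp_add_positive)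
  note [simp] = carrier_matD[OF B]
  define X where "X = inl_mat k m * B"
  have X: "X \<in> carrier_mat d d" by (simp add: X_def carrier_mat_iff d)
  note [simp] = carrier_matD[OF X]
  have "\<not> (\<forall>v\<in>carrier_mat d 1. X * v = 0\<^sub>m d 1 \<longrightarrow> v = 0\<^sub>m d 1)"
  proof
    assume "\<forall>v\<in>carrier_mat d 1. X * v = 0\<^sub>m d 1 \<longrightarrow> v = 0\<^sub>m d 1"
    then have "det X \<noteq> 0" by (intro det_nonzeroI[OF X]) blast
    then obtain Y where Y: "Y \<in> carrier_mat d d" "X * Y = 1\<^sub>m d" using mat_inverse_det[OF X] by metis
    note [simp] = carrier_matD[OF Y(1)]
    have rX: "adj (inr_mat k m) * X = 0\<^sub>m m d" by (simp add: X_def inlr_left mat_algebra d)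
    have "adj (inr_mat k m) * (X * Y) = 0\<^sub>m m d"
      by (simp add: mult_eq_assoc[OF rX] d[symmetric] mat_algebra)
    then have "adj (inr_mat k m) * inr_mat k m = 0\<^sub>m m m" unfolding Y(2) by (simp add: d mat_algebra)
    then have "1\<^sub>m m $$ (0, 0) = (0\<^sub>m m m :: complex mat) $$ (0, 0)" by (simp only: inlr)
    then show False using m by simp
  qed
  then obtain w where w: "w \<in> carrier_mat d 1" "X * w = 0\<^sub>m d 1" "w \<noteq> 0\<^sub>m d 1" by blast
  note [simp] = carrier_matD[OF w(1)]
  have "B * w = adj (inl_mat k m) * (X * w)" by (simp add: X_def inlr_left mat_algebra)
  also have "\<dots> = 0\<^sub>m k 1" by (simp add: w(2) mat_algebra d)
  finally show ?thesis using that w by blast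
qed

lemma mat_eq_zeroI:
  fixes F :: "complex mat"
  assumes F: "F \<in> carrier_mat n m" and z: "\<And>v. v \<in> carrier_mat m 1 \<Longrightarrow> F * v = 0\<^sub>m n 1"
  shows "F = 0\<^sub>m n m"
proof (rule eq_matI)
  note [simp] = carrier_matD[OF F]
  fix i j assume ij: "i < dim_row (0\<^sub>m n m :: complex mat)" "j < dim_col (0\<^sub>m n m :: complex mat)"
  define v where "v = mat m 1 (\<lambda>(k, l). if k = j then 1 else 0 :: complex)"
  have "F $$ (i, j) = (F * v) $$ (i, 0)"
    using ij by (simp add: v_def scalar_prod_def if_distrib[of "\<lambda>x. _ * x"] cong: if_cong)
  also have "F * v = 0\<^sub>m n 1" by (rule z) (simp add: v_def)
  finally show "F $$ (i, j) = 0\<^sub>m n m $$ (i, j)" using ij by simp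
qed (use F in auto)

text \<open>If the form vanished identically, \<open>F\<close> would be positive semidefinite with
  zero form, and Cauchy-Schwarz would give \<open>F = 0\<close>.\<close>

lemma hermitian_nonzero_qform:
  assumes F: "F \<in> carrier_mat n n" "adj F = F" and ne: "F \<noteq> 0\<^sub>m n n"
  obtains v where "v \<in> carrier_mat n 1" "qform F v \<noteq> 0"
proof (rule ccontr)
  note obtained = that
  assume "\<not> thesis"
  then have q: "qform F v = 0" if "v \<in> carrier_mat n 1" for v using obtained that by blast
  have P: "psd_mat n F" unfolding psd_mat_iff using F q by simp
  have "F * v = 0\<^sub>m n 1" if v: "v \<in> carrier_mat n 1" for v
  proof (rule nrm2_eq_0)
    show "F * v \<in> carrier_mat n 1" by (rule mult_carrier_mat[OF F(1) v])
    show "nrm2 (F * v) = 0" using psd_cauchy_schwarz[OF P v] q[OF v] by simp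
  qed
  from mat_eq_zeroI[OF F(1) this] ne show False by blast
qed

lemma hermitian_qform:
  assumes F: "F \<in> carrier_mat n n" "adj F = F" and v: "v \<in> carrier_mat n 1"
  shows "adj v * (F * v) = complex_of_real (qform F v) \<cdot>\<^sub>m 1\<^sub>m 1"
proof (rule eq_matI)
  note [simp] = carrier_matD[OF F(1)] carrier_matD[OF v]
  fix i j assume "i < dim_row (complex_of_real (qform F v) \<cdot>\<^sub>m 1\<^sub>m 1)" "j < dim_col (complex_of_real (qform F v) \<cdot>\<^sub>m 1\<^sub>m 1)"
  then have ij: "i = 0" "j = 0" by auto
  have "adj (adj v * (F * v)) = adj v * (F * v)" by (simp add: mat_algebra F)
  then have "adj (adj v * (F * v)) $$ (0, 0) = (adj v * (F * v)) $$ (0, 0)" by simp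
  then have "cnj ((adj v * (F * v)) $$ (0, 0)) = (adj v * (F * v)) $$ (0, 0)"
    by (subst (asm) index_adj) (simp_all del: index_mult_mat(1))
  then have "(adj v * (F * v)) $$ (0, 0) = complex_of_real (qform F v)"
    unfolding qform_def by (metis Reals_cnj_iff of_real_Re)
  then show "(adj v * (F * v)) $$ (i, j) = (complex_of_real (qform F v) \<cdot>\<^sub>m 1\<^sub>m 1) $$ (i, j)"
    using ij by (simp del: index_mult_mat(1))
qed (use F v in auto)

text \<open>The value of the form is normalized to a sign and kept as a \<open>1 \<times> 1\<close>
  matrix \<open>E\<close>, ready to become a diagonal block of a signature matrix.\<close>

lemma hermitian_normalized_vector:
  assumes F: "F \<in> carrier_mat n n" "adj F = F" and ne: "F \<noteq> 0\<^sub>m n n"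
  obtains u E where "u \<in> carrier_mat n 1" "E \<in> carrier_mat 1 1" "adj E = E" "E * E = 1\<^sub>m 1" "adj u * (F * u) = E"
proof -
  obtain v where v: "v \<in> carrier_mat n 1" "qform F v \<noteq> 0" using hermitian_nonzero_qform[OF assms] by blast
  note [simp] = carrier_matD[OF F(1)] carrier_matD[OF v(1)]
  define q where "q = qform F v"
  define k where "k = 1 / sqrt \<bar>q\<bar>"
  define u where "u = complex_of_real k \<cdot>\<^sub>m v"
  have "k * (k * q) = sgn q"
  proof -
    have "k * k = 1 / \<bar>q\<bar>" by (simp add: k_def)
    then have "k * (k * q) = q / \<bar>q\<bar>" by (simp add: mult.assoc[symmetric])
    then show ?thesis by (simp add: sgn_if v(2) q_def)
  qed
  then have kk: "complex_of_real k * (complex_of_real k * complex_of_real q) = complex_of_real (sgn q)"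
    by (metis of_real_mult)
  show ?thesis
  proof (rule that[of u "complex_of_real (sgn q) \<cdot>\<^sub>m 1\<^sub>m 1"])
    show "u \<in> carrier_mat n 1" by (simp add: u_def carrier_mat_iff)
    show "adj u * (F * u) = complex_of_real (sgn q) \<cdot>\<^sub>m 1\<^sub>m 1"
      using kk by (auto simp: u_def mat_algebra hermitian_qform[OF F v(1)] q_def intro!: eq_matI)
    have "complex_of_real (sgn q) * complex_of_real (sgn q) = 1"
      using v(2) by (auto simp: q_def sgn_if)
    then show "complex_of_real (sgn q) \<cdot>\<^sub>m 1\<^sub>m 1 * (complex_of_real (sgn q) \<cdot>\<^sub>m 1\<^sub>m 1) = 1\<^sub>m 1"
      by (auto simp: mat_algebra intro!: eq_matI)
  qed (auto simp: adj_simps)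
qed

text \<open>
  \<open>Z J Z\<^sup>*\<close> is a generalized inverse of \<open>G\<close>. The induction enlarges the kernel of
  \<open>G - G Z J Z\<^sup>* G\<close> by one dimension in each step.
\<close>
lemma hermitian_signature:
  assumes G: "G \<in> carrier_mat d d" "adj G = G"
  obtains Z J where "Z \<in> carrier_mat d d" "J \<in> carrier_mat d d" "adj J = J" "J * J = 1\<^sub>m d"
    "G * (Z * (J * (adj Z * G))) = G"
proof -
  note [simp] = carrier_matD[OF G(1)]
  have "\<exists>Z J V. Z \<in> carrier_mat d k \<and> J \<in> carrier_mat k k \<and> V \<in> carrier_mat d k \<and> adj J = J \<and> J * J = 1\<^sub>m k \<and>
     adj V * V = 1\<^sub>m k \<and> (G - G * (Z * (J * (adj Z * G)))) * V = 0\<^sub>m d k" if "k \<le> d" for k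
    using that
  proof (induction k)
    case 0
    show ?case
      by (rule exI[of _ "0\<^sub>m d 0"], rule exI[of _ "1\<^sub>m 0"], rule exI[of _ "0\<^sub>m d 0"])
        (auto simp: mmult_zero intro!: eq_matI)
  next
    case (Suc k)
    then obtain Z J V where c: "Z \<in> carrier_mat d k" "J \<in> carrier_mat k k" "V \<in> carrier_mat d k" 
      and J: "adj J = J" "J * J = 1\<^sub>m k" and V: "adj V * V = 1\<^sub>m k" 
      and FV: "(G - G * (Z * (J * (adj Z * G)))) * V = 0\<^sub>m d k" by auto
    note [simp] = c[unfolded carrier_mat_iff]
    define F where "F = G - G * (Z * (J * (adj Z * G)))"
    have F: "F \<in> carrier_mat d d" "adj F = F" by (simp_all add: F_def carrier_mat_iff mat_algebra G J)
    note [simp] = carrier_matD[OF F(1)]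
    note FV = FV[folded F_def]
    have VF: "adj V * F = 0\<^sub>m k d" using arg_cong[OF FV, of adj] by (simp add: mat_algebra F)
    obtain z E w where z: "z \<in> carrier_mat d 1" and E: "E \<in> carrier_mat 1 1" "adj E = E" "E * E = 1\<^sub>m 1"
      and w: "w \<in> carrier_mat d 1" "w \<noteq> 0\<^sub>m d 1" "adj V * w = 0\<^sub>m k 1"
      and F'w: "(F - G * (z * (E * (adj z * G)))) * w = 0\<^sub>m d 1"
      and F'V: "(F - G * (z * (E * (adj z * G)))) * V = 0\<^sub>m d k"
    \<comment> \<open>With zero remainder the equation is already solved; the column
      \<open>z = 0\<close> with sign 1 only pads \<open>Z\<close> and \<open>J\<close> to the next
      size.\<close>
    proof (cases "F = 0\<^sub>m d d")
      case True
      obtain w where w: "w \<in> carrier_mat d 1" "w \<noteq> 0\<^sub>m d 1" "adj V * w = 0\<^sub>m k 1"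
        using kernel_vector[of "adj V" k d] c(3) Suc.prems by auto
      have "F - G * (0\<^sub>m d 1 * (1\<^sub>m 1 * (adj (0\<^sub>m d 1) * G))) = 0\<^sub>m d d"
        unfolding True by (simp add: mat_algebra add_zero_mat)
      then show ?thesis using w c by (intro that[of "0\<^sub>m d 1" "1\<^sub>m 1" w]) (auto simp: mmult_zero)
    next
      case False
      obtain u E where u: "u \<in> carrier_mat d 1" and E: "E \<in> carrier_mat 1 1" "adj E = E" "E * E = 1\<^sub>m 1" "adj u * (F * u) = E"
        using hermitian_normalized_vector[OF F False] by blast
      note [simp] = carrier_matD[OF u] carrier_matD[OF E(1)]
      \<comment> \<open>Chosen so that \<open>G * z = F * u\<close>. The new term is then
        \<open>F u E u\<^sup>* F\<close>, and subtracting it from \<open>F\<close> annihilates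
        \<open>u\<close>, because \<open>u\<^sup>* F u = E\<close> and
        \<open>E * E = 1\<close>.\<close>
      define z where "z = u - Z * (J * (adj Z * (G * u)))"
      have z: "z \<in> carrier_mat d 1" by (simp add: z_def carrier_mat_iff)
      note [simp] = carrier_matD[OF z]
      have Gz: "G * z = F * u" by (simp add: z_def F_def mat_algebra)
      have zG: "adj z * G = adj u * F" using arg_cong[OF Gz, of adj] by (simp add: mat_algebra G F)
      \<comment> \<open>The part of \<open>u\<close> orthogonal to the kernel found so far. Since
        \<open>F * V = 0\<close>, it has the same image as \<open>u\<close> under \<open>F\<close>
        and is annihilated along with it.\<close>
      define w where "w = u - V * (adj V * u)"
      have w: "w \<in> carrier_mat d 1" by (simp add: w_def carrier_mat_iff)
      note [simp] = carrier_matD[OF w]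
      have Fw: "F * w = F * u" by (simp add: w_def mat_algebra mult_eq_assoc[OF FV] add_zero_mat)
      have F': "(F - G * (z * (E * (adj z * G)))) * x = F * x - F * (u * (E * (adj u * (F * x))))"
        if "dim_row x = d" for x
        using that by (simp add: mat_algebra mult_eq_assoc[OF Gz] mult_eq_assoc[OF zG])
      show ?thesis
      proof (rule that[OF z E(1-3) w])
        show "w \<noteq> 0\<^sub>m d 1"
        proof
          assume "w = 0\<^sub>m d 1"
          then have "F * u = 0\<^sub>m d 1" using Fw by (simp add: mat_algebra)
          then have "E = 0\<^sub>m 1 1" using E(4) by (simp add: mat_algebra)
          then have "1\<^sub>m 1 = (0\<^sub>m 1 1 :: complex mat)" using E(3) by (simp add: mat_algebra)
          then have "1\<^sub>m 1 $$ (0, 0) = (0\<^sub>m 1 1 :: complex mat) $$ (0, 0)" by simp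
          then show False by simp
        qed
        show "adj V * w = 0\<^sub>m k 1" by (simp add: w_def mat_algebra mult_eq_assoc[OF V] add_zero_mat)
        show "(F - G * (z * (E * (adj z * G)))) * w = 0\<^sub>m d 1"
          by (subst F') (simp_all add: Fw E mat_algebra add_zero_mat)
        show "(F - G * (z * (E * (adj z * G)))) * V = 0\<^sub>m d k"
          by (subst F') (simp_all add: FV mat_algebra add_zero_mat)
      qed
    qed
    note [simp] = carrier_matD[OF z] carrier_matD[OF E(1)] carrier_matD[OF w(1)]
    obtain a U where U: "U \<in> carrier_mat d (k + 1)" "adj U * U = 1\<^sub>m (k + 1)" 
      "U = V * adj (inl_mat k 1) + (a \<cdot>\<^sub>m w) * adj (inr_mat k 1)"
      using isometry_extend[OF c(3) V w(1) w(3) w(2)] by metis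
    define Z' where "Z' = Z * adj (inl_mat k 1) + z * adj (inr_mat k 1)"
    define J' where "J' = inl_mat k 1 * (J * adj (inl_mat k 1)) + inr_mat k 1 * (E * adj (inr_mat k 1))"
    note s = inlr J(2) E(3)
    have 1: "Z' \<in> carrier_mat d (k + 1)" "J' \<in> carrier_mat (k + 1) (k + 1)" by (simp_all add: Z'_def J'_def carrier_mat_iff)
    have 2: "adj J' = J'" by (simp add: J'_def mat_algebra J E)
    have 3: "J' * J' = 1\<^sub>m (k + 1)"
      unfolding inl_inr_sum[symmetric] 
      by (simp add: J'_def mat_algebra s s[THEN mult_eq_assoc] add_zero_mat)
    have "G * (Z' * (J' * (adj Z' * G))) = G * (Z * (J * (adj Z * G))) + G * (z * (E * (adj z * G)))"
      by (simp add: J'_def Z'_def mat_algebra s s[THEN mult_eq_assoc] add_zero_mat)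
    then have "G - G * (Z' * (J' * (adj Z' * G))) = F - G * (z * (E * (adj z * G)))"
      by (intro eq_matI) (auto simp: F_def simp del: index_mult_mat(1))
    moreover have "(F - G * (z * (E * (adj z * G)))) * U = 0\<^sub>m d (k + 1)"
    proof -
      define F' where "F' = F - G * (z * (E * (adj z * G)))"
      have [simp]: "dim_row F' = d" "dim_col F' = d" by (simp_all add: F'_def)
      note f = F'w[folded F'_def] F'V[folded F'_def]
      have "F' * U = 0\<^sub>m d (k + 1)"
        unfolding U(3) by (auto simp: mat_algebra f[THEN mult_eq_assoc] f add_zero_mat intro!: eq_matI)
      then show ?thesis by (simp add: F'_def)
    qed
    ultimately show ?case using 1 2 3 U(1,2) by (intro exI[of _ Z'] exI[of _ J'] exI[of _ U]) simp
  qed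
  from this[of d] obtain Z J V where c: "Z \<in> carrier_mat d d" "J \<in> carrier_mat d d" "V \<in> carrier_mat d d"
    and J: "adj J = J" "J * J = 1\<^sub>m d" and V: "adj V * V = 1\<^sub>m d" 
    and FV: "(G - G * (Z * (J * (adj Z * G)))) * V = 0\<^sub>m d d" by auto
  note [simp] = c[unfolded carrier_mat_iff]
  have VV: "V * adj V = 1\<^sub>m d" using right_inverse_imp_left[OF _ c(3) V] c by auto
  define F where "F = G - G * (Z * (J * (adj Z * G)))"
  have [simp]: "dim_row F = d" "dim_col F = d" by (simp_all add: F_def)
  have "F * (V * adj V) = 0\<^sub>m d d" using FV[folded F_def] by (simp add: mult_eq_assoc[of F V] mat_algebra)
  then have F0: "F = 0\<^sub>m d d" unfolding VV by (simp add: mat_algebra)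
  have "G * (Z * (J * (adj Z * G))) = G"
  proof (rule eq_matI)
    fix a b assume "a < dim_row G" "b < dim_col G"
    moreover have "F $$ (a, b) = (0\<^sub>m d d :: complex mat) $$ (a, b)" using F0 by simp
    ultimately show "(G * (Z * (J * (adj Z * G)))) $$ (a, b) = G $$ (a, b)"
      by (simp add: F_def del: index_mult_mat(1))
  qed auto
  with that c J show ?thesis by blast
qed

lemma kron_mult_left:
  "dim_col A = dim_row C \<Longrightarrow> dim_col B = dim_row D \<Longrightarrow> dim_row X = dim_col C * dim_col D \<Longrightarrow>
    kron A B * (kron C D * X) = kron (A * C) (B * D) * X"
  by (simp add: mult_eq_assoc[OF kron_mult])

lemma lin_kron:
  assumes "\<And>i. Z i \<in> carrier_mat e f" "\<And>i. z i \<in> carrier_mat n m" "dim_row B = f" "dim_row F = m"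
  shows "lin (e * n) (f * m) Z z * kron B F = lin (e * n) (dim_col B * dim_col F) (\<lambda>i. Z i * B) (\<lambda>i. z i * F)"
  by (rule lin_mult_kron) (use assms in auto)

lemma kron_lin:
  assumes "\<And>i. Z i \<in> carrier_mat e f" "\<And>i. z i \<in> carrier_mat n m" "dim_col B = e" "dim_col F = n"
  shows "kron B F * lin (e * n) (f * m) Z z = lin (dim_row B * dim_row F) (f * m) (\<lambda>i. B * Z i) (\<lambda>i. F * z i)"
  by (rule kron_mult_lin) (use assms in auto)

lemma lin_kron_left:
  assumes "\<And>i. Z i \<in> carrier_mat e f" "\<And>i. z i \<in> carrier_mat n m" "dim_row B = f" "dim_row F = m"
    "dim_row X = dim_col B * dim_col F"
  shows "lin (e * n) (f * m) Z z * (kron B F * X) =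
    lin (e * n) (dim_col B * dim_col F) (\<lambda>i. Z i * B) (\<lambda>i. z i * F) * X"
  by (rule mult_eq_assoc[OF lin_kron[OF assms(1-4)]]) (use assms in auto)

lemma kron_lin_left:
  assumes "\<And>i. Z i \<in> carrier_mat e f" "\<And>i. z i \<in> carrier_mat n m" "dim_col B = e" "dim_col F = n"
    "dim_row X = f * m"
  shows "kron B F * (lin (e * n) (f * m) Z z * X) =
    lin (dim_row B * dim_row F) (f * m) (\<lambda>i. B * Z i) (\<lambda>i. F * z i) * X"
  by (rule mult_eq_assoc[OF kron_lin[OF assms(1-4)]]) (use assms in auto)

lemmas kron_merge = kron_mult kron_mult_left lin_kron kron_lin lin_kron_left kron_lin_left

text \<open>\<open>Q J' Q\<^sup>* J\<close> acts as the projection onto the range of \<open>V\<close>, modulo the radical of the form of \<open>J\<close>.\<close>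
lemma reduced_resolvent:
  fixes K z :: "'i::finite \<Rightarrow> complex mat"
  assumes c: "V \<in> carrier_mat e d" "J \<in> carrier_mat e e" "C \<in> carrier_mat e 1" "Z \<in> carrier_mat d d" "J' \<in> carrier_mat d d"
      "Li \<in> carrier_mat (e * n) (e * n)" "Li' \<in> carrier_mat (d * n) (d * n)"
    and K: "\<And>i. K i \<in> carrier_mat e e" "\<And>i. adj (K i) = K i" and zc: "\<And>i. z i \<in> carrier_mat n n"
    and V: "adj V * V = 1\<^sub>m d" and J: "adj J = J" "J * J = 1\<^sub>m e" and J': "adj J' = J'" "J' * J' = 1\<^sub>m d"
    and inv: "\<And>i. J * (K i * V) = V * (adj V * (J * (K i * V)))" "J * C = V * (adj V * (J * C))"
    and sig: "adj V * (J * V) * (Z * (J' * (adj Z * (adj V * (J * V))))) = adj V * (J * V)"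
    and Q: "Q = V * Z"
    and L: "L = kron J (1\<^sub>m n) - lin (e * n) (e * n) K z"
    and L': "L' = kron J' (1\<^sub>m n) - lin (d * n) (d * n) (\<lambda>i. adj Q * (K i * Q)) z"
    and i: "L * Li = 1\<^sub>m (e * n)" "Li * L = 1\<^sub>m (e * n)" "Li' * L' = 1\<^sub>m (d * n)"
  shows "adj (kron C (1\<^sub>m n)) * (Li * kron C (1\<^sub>m n)) =
    adj (kron (adj Q * C) (1\<^sub>m n)) * (Li' * kron (adj Q * C) (1\<^sub>m n))"
proof -
  note [simp] = c[unfolded carrier_mat_iff] K(1)[unfolded carrier_mat_iff]
     zc[unfolded carrier_mat_iff]
  have [simp]: "dim_row Q = e" "dim_col Q = d" by (simp_all add: Q)
  have [simp]: "dim_row L = e * n" "dim_col L = e * n" "dim_row L' = d * n" "dim_col L' = d * n" by (simp_all add: L L')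
  note km = kron_merge
  define V1 where "V1 = kron V (1\<^sub>m n)"
  define C1 where "C1 = kron C (1\<^sub>m n)"
  define J1 where "J1 = kron J (1\<^sub>m n)"
  define Q1 where "Q1 = kron Q (1\<^sub>m n)"
  have [simp]: "dim_row V1 = e * n" "dim_col V1 = d * n" "dim_row C1 = e * n" "dim_col C1 = n"
    "dim_row J1 = e * n" "dim_col J1 = e * n" "dim_row Q1 = e * n" "dim_col Q1 = d * n"
    by (simp_all add: V1_def C1_def J1_def Q1_def)
  have V1: "adj V1 * V1 = 1\<^sub>m (d * n)" by (simp add: V1_def adj_kron kron_mult V mat_algebra kron_one)
  have J1: "J1 * J1 = 1\<^sub>m (e * n)" by (simp add: J1_def kron_mult J mat_algebra kron_one)
  define E where "E = Li * C1"
  have [simp]: "dim_row E = e * n" "dim_col E = n" by (simp_all add: E_def)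
  \<comment> \<open>The resolvent column stays in the range of \<open>V1\<close>: this range is
    invariant under \<open>J1 * L\<close>, hence under the inverse \<open>Li * J1\<close>, and
    \<open>E\<close> is the image of \<open>J1 * C1\<close>, which lies in the range.\<close>
  have EV: "V1 * (adj V1 * E) = E"
  proof -
    define N where "N = J1 * L"
    have NV: "N * V1 = V1 - lin (e * n) (d * n) (\<lambda>i. J * (K i * V)) z"
    proof -
      have "L * V1 = kron (J * V) (1\<^sub>m n) - lin (e * n) (d * n) (\<lambda>i. K i * V) z"
        by (simp add: L V1_def mat_algebra km carrier_mat_iff)
      then have "J1 * (L * V1) = kron (J * (J * V)) (1\<^sub>m n) - lin (e * n) (d * n) (\<lambda>i. J * (K i * V)) z"
        by (simp add: J1_def mat_algebra km carrier_mat_iff)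
      then show ?thesis by (simp add: N_def V1_def mat_algebra mult_eq_assoc[OF J(2)])
    qed
    have "lin (e * n) (d * n) (\<lambda>i. J * (K i * V)) z = lin (e * n) (d * n) (\<lambda>i. V * (adj V * (J * (K i * V)))) z"
      using inv(1) by metis
    also have "\<dots> = V1 * (adj V1 * lin (e * n) (d * n) (\<lambda>i. J * (K i * V)) z)"
      by (simp add: V1_def adj_kron km carrier_mat_iff mat_algebra)
    finally have l: "V1 * (adj V1 * lin (e * n) (d * n) (\<lambda>i. J * (K i * V)) z) = lin (e * n) (d * n) (\<lambda>i. J * (K i * V)) z" ..
    have "Li * J1 * V1 = V1 * (adj V1 * (Li * J1 * V1))"
    proof (rule inverse_invariant)
      show "V1 \<in> carrier_mat (e * n) (d * n)" "N \<in> carrier_mat (e * n) (e * n)" "Li * J1 \<in> carrier_mat (e * n) (e * n)"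
        by (simp_all add: carrier_mat_iff N_def)
      show "Li * J1 * N = 1\<^sub>m (e * n)" by (simp add: N_def mat_algebra mult_eq_assoc[OF J1] i)
      show "N * V1 = V1 * (adj V1 * (N * V1))" unfolding NV by (simp add: mat_algebra V1 l)
    qed (rule V1)
    then have q: "V1 * (adj V1 * (Li * (J1 * V1))) = Li * (J1 * V1)" by (simp add: mat_algebra)
    have "C1 = J1 * kron (J * C) (1\<^sub>m n)" by (simp add: C1_def J1_def kron_mult mult_eq_assoc[OF J(2)] mat_algebra)
    also have "kron (J * C) (1\<^sub>m n) = kron (V * (adj V * (J * C))) (1\<^sub>m n)" using inv(2) by simp
    also have "\<dots> = V1 * (adj V1 * kron (J * C) (1\<^sub>m n))" by (simp add: V1_def adj_kron kron_mult mat_algebra)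
    finally have C: "C1 = J1 * (V1 * (adj V1 * kron (J * C) (1\<^sub>m n)))" .
    define y where "y = adj V1 * kron (J * C) (1\<^sub>m n)"
    have [simp]: "dim_row y = d * n" "dim_col y = n" by (simp_all add: y_def)
    have E: "E = Li * (J1 * V1) * y" unfolding E_def C y_def[symmetric] by (simp add: mat_algebra)
    have "V1 * (adj V1 * E) = V1 * (adj V1 * (Li * (J1 * V1))) * y" unfolding E by (simp add: mat_algebra)
    then show ?thesis unfolding q E .
  qed
  define \<Phi> where "\<Phi> = Q * (J' * (adj Q * J))"
  have [simp]: "dim_row \<Phi> = e" "dim_col \<Phi> = e" by (simp_all add: \<Phi>_def)
  \<comment> \<open>Such a \<open>B\<close> has the form \<open>J V Y\<close>. Paired with it,
    \<open>\<Phi>\<close> enters only through the Gram matrix \<open>adj V * (J * V)\<close>, for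
    which \<open>sig\<close> lets the generalized inverse cancel.\<close>
  have \<Phi>: "adj B * (\<Phi> * V) = adj B * V"
    if B: "J * B = V * (adj V * (J * B))" and [simp]: "dim_row B = e" for B
  proof -
    define Y where "Y = adj V * (J * B)"
    have [simp]: "dim_row Y = d" "dim_col Y = dim_col B" by (simp_all add: Y_def)
    have "B = J * (J * B)" by (simp add: mult_eq_assoc[OF J(2)] mat_algebra)
    also have "\<dots> = J * (V * Y)" using B by (simp add: Y_def)
    finally have "adj B = adj (J * (V * Y))" by simp
    then have aB: "adj B = adj Y * (adj V * J)" by (simp add: mat_algebra J)
    have "adj B * (\<Phi> * V) = adj Y * (adj V * (J * V) * (Z * (J' * (adj Z * (adj V * (J * V))))))"
      unfolding aB by (simp add: \<Phi>_def Q mat_algebra)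
    also have "\<dots> = adj B * V" unfolding sig aB by (simp add: mat_algebra)
    finally show ?thesis .
  qed
  have KQ: "adj Q * (K i * (\<Phi> * V)) = adj Q * (K i * V)" for i
  proof -
    have "J * (K i * Q) = J * (K i * V) * Z" by (simp add: Q mat_algebra)
    also have "\<dots> = V * (adj V * (J * (K i * V))) * Z" using inv(1) by metis
    also have "\<dots> = V * (adj V * (J * (K i * Q)))" by (simp add: Q mat_algebra)
    finally have "adj (K i * Q) * (\<Phi> * V) = adj (K i * Q) * V" by (rule \<Phi>) simp
    then show ?thesis by (simp add: mat_algebra K)
  qed
  have CQ: "adj C * (\<Phi> * V) = adj C * V" by (rule \<Phi>[OF inv(2)]) simp
  \<comment> \<open>The candidate for the resolvent column of the small pencil. It is confirmed by
    applying \<open>L'\<close> to it, where \<open>\<Phi>\<close> may be dropped between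
    coefficients and the range of \<open>V\<close>.\<close>
  define E' where "E' = kron (J' * (adj Q * J)) (1\<^sub>m n) * E"
  have [simp]: "dim_row E' = d * n" "dim_col E' = n" by (simp_all add: E'_def)
  have QE: "kron (X * Q) (1\<^sub>m n) * E' = kron (X * (\<Phi> * V)) (1\<^sub>m n) * (adj V1 * E)" if [simp]: "dim_col X = e" for X
  proof -
    have "kron (X * Q) (1\<^sub>m n) * E' = kron (X * \<Phi>) (1\<^sub>m n) * E"
      by (simp add: E'_def km mat_algebra \<Phi>_def)
    also have "\<dots> = kron (X * \<Phi>) (1\<^sub>m n) * (V1 * (adj V1 * E))" by (simp add: EV)
    also have "\<dots> = kron (X * \<Phi>) (1\<^sub>m n) * V1 * (adj V1 * E)" by (simp add: mmult_assoc)
    also have "kron (X * \<Phi>) (1\<^sub>m n) * V1 = kron (X * (\<Phi> * V)) (1\<^sub>m n)" by (simp add: V1_def kron_mult mat_algebra)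
    finally show ?thesis .
  qed
  have "lin (d * n) (d * n) (\<lambda>i. adj Q * (K i * Q)) z * E' = lin (d * n) (e * n) (\<lambda>i. adj Q * K i) z * (Q1 * E')"
    by (simp add: Q1_def km carrier_mat_iff mat_algebra)
  also have "Q1 * E' = kron (\<Phi> * V) (1\<^sub>m n) * (adj V1 * E)"
    using QE[of "1\<^sub>m e"] by (simp add: Q1_def mat_algebra)
  also have "lin (d * n) (e * n) (\<lambda>i. adj Q * K i) z * (kron (\<Phi> * V) (1\<^sub>m n) * (adj V1 * E)) =
     lin (d * n) (d * n) (\<lambda>i. adj Q * (K i * (\<Phi> * V))) z * (adj V1 * E)"
    by (simp add: km carrier_mat_iff mat_algebra)
  also have "\<dots> = lin (d * n) (d * n) (\<lambda>i. adj Q * (K i * V)) z * (adj V1 * E)" by (simp only: KQ)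
  also have "\<dots> = lin (d * n) (e * n) (\<lambda>i. adj Q * K i) z * (V1 * (adj V1 * E))"
    by (simp add: V1_def km carrier_mat_iff mat_algebra)
  also have "\<dots> = lin (d * n) (e * n) (\<lambda>i. adj Q * K i) z * E" by (simp add: EV)
  also have "\<dots> = adj Q1 * (lin (e * n) (e * n) K z * E)"
    by (simp add: Q1_def adj_kron km carrier_mat_iff mat_algebra)
  finally have l: "lin (d * n) (d * n) (\<lambda>i. adj Q * (K i * Q)) z * E' = adj Q1 * (lin (e * n) (e * n) K z * E)" .
  have k: "kron J' (1\<^sub>m n) * E' = adj Q1 * (J1 * E)"
    by (simp add: E'_def Q1_def J1_def adj_kron km mat_algebra J' mult_eq_assoc[OF J'(2)])
  have "L' * E' = adj Q1 * (L * E)" by (simp add: L' L J1_def[symmetric] mat_algebra l k)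
  also have "L * E = C1" by (simp add: E_def mult_eq_assoc[OF i(1)] mat_algebra)
  also have "adj Q1 * C1 = kron (adj Q * C) (1\<^sub>m n)" by (simp add: Q1_def C1_def adj_kron kron_mult mat_algebra)
  finally have "Li' * (L' * E') = Li' * kron (adj Q * C) (1\<^sub>m n)" by simp
  then have E': "E' = Li' * kron (adj Q * C) (1\<^sub>m n)" by (simp add: mult_eq_assoc[OF i(3)] mat_algebra)
  have "adj (kron (adj Q * C) (1\<^sub>m n)) * E' = kron (adj C * Q) (1\<^sub>m n) * E'" by (simp add: adj_kron mat_algebra)
  also have "\<dots> = kron (adj C * (\<Phi> * V)) (1\<^sub>m n) * (adj V1 * E)" by (rule QE) simp
  also have "\<dots> = kron (adj C * V) (1\<^sub>m n) * (adj V1 * E)" by (simp only: CQ)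
  also have "\<dots> = adj C1 * (V1 * (adj V1 * E))" 
    by (simp add: V1_def C1_def adj_kron km mat_algebra)
  also have "\<dots> = adj C1 * E" by (simp add: EV)
  finally show ?thesis unfolding E' E_def C1_def ..
qed

section \<open>Resolvents of a realization and its compression\<close>

lemma rl_carriers:
  assumes "sym_realization \<rho>"
  shows "rl_J \<rho> \<in> carrier_mat (rl_dim \<rho>) (rl_dim \<rho>)" "adj (rl_J \<rho>) = rl_J \<rho>" "rl_J \<rho> * rl_J \<rho> = 1\<^sub>m (rl_dim \<rho>)"
    "coeffs \<rho> i \<in> carrier_mat (rl_dim \<rho>) (rl_dim \<rho>)" "adj (coeffs \<rho> i) = coeffs \<rho> i"
    "rl_c \<rho> \<in> carrier_vec (rl_dim \<rho>)" "rl_C \<rho> \<in> carrier_mat (rl_dim \<rho>) 1"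
  using assms by (auto simp: sym_realization_def hermitian_mat_def coeffs_def split: sum.splits)

lemma pencil_carrier:
  assumes "sym_realization \<rho>" "\<And>i. join p i \<in> carrier_mat n n"
  shows "pencil \<rho> n p \<in> carrier_mat (rl_dim \<rho> * n) (rl_dim \<rho> * n)"
  using pencil_lin[OF assms] by (simp add: carrier_mat_iff)

lemma resolvent_inverse:
  assumes "sym_realization \<rho>" "\<And>i. join p i \<in> carrier_mat n n" "det (pencil \<rho> n p) \<noteq> 0"
  shows "resolvent \<rho> n p \<in> carrier_mat (rl_dim \<rho> * n) (rl_dim \<rho> * n)"
    "pencil \<rho> n p * resolvent \<rho> n p = 1\<^sub>m (rl_dim \<rho> * n)" "resolvent \<rho> n p * pencil \<rho> n p = 1\<^sub>m (rl_dim \<rho> * n)"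
proof -
  obtain B where "mat_inverse (pencil \<rho> n p) = Some B" "B \<in> carrier_mat (rl_dim \<rho> * n) (rl_dim \<rho> * n)" 
     "pencil \<rho> n p * B = 1\<^sub>m (rl_dim \<rho> * n)" "B * pencil \<rho> n p = 1\<^sub>m (rl_dim \<rho> * n)"
    using mat_inverse_det[OF pencil_carrier[OF assms(1,2)] assms(3)] by metis
  then show "resolvent \<rho> n p \<in> carrier_mat (rl_dim \<rho> * n) (rl_dim \<rho> * n)"
    "pencil \<rho> n p * resolvent \<rho> n p = 1\<^sub>m (rl_dim \<rho> * n)" "resolvent \<rho> n p * pencil \<rho> n p = 1\<^sub>m (rl_dim \<rho> * n)"
    by (simp_all add: resolvent_def)
qed

text \<open>The signature matrix for the compressed form \<open>adj V * (J * V)\<close> has full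
  size \<open>d\<close> even when that form is degenerate; this suffices, since it is
  \<open>d\<close> that is compared with the minimal size. Nothing ensures that the new pencil is
  invertible where the old one is, hence the two determinant premises in the conclusion.\<close>

lemma realization_compress:
  fixes \<rho> :: "('h::finite, 'g::finite) realization"
  assumes \<rho>: "sym_realization \<rho>" and V: "V \<in> carrier_mat (rl_dim \<rho>) d" "adj V * V = 1\<^sub>m d"
    and inv: "\<And>i. rl_J \<rho> * (coeffs \<rho> i * V) = V * (adj V * (rl_J \<rho> * (coeffs \<rho> i * V)))"
      "rl_J \<rho> * rl_C \<rho> = V * (adj V * (rl_J \<rho> * rl_C \<rho>))"
  obtains \<rho>' :: "('h, 'g) realization" where "sym_realization \<rho>'" "rl_dim \<rho>' = d"
    "\<And>n p. (\<And>i. join p i \<in> carrier_mat n n) \<Longrightarrow> det (pencil \<rho> n p) \<noteq> 0 \<Longrightarrow> det (pencil \<rho>' n p) \<noteq> 0 \<Longrightarrow>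
      rl_eval \<rho>' n p = rl_eval \<rho> n p"
proof -
  let ?e = "rl_dim \<rho>" and ?J = "rl_J \<rho>" and ?C = "rl_C \<rho>"
  note r = rl_carriers[OF \<rho>]
  note [simp] = r(1,4,7)[unfolded carrier_mat_iff] carrier_matD[OF V(1)]
  have G: "adj V * (?J * V) \<in> carrier_mat d d" "adj (adj V * (?J * V)) = adj V * (?J * V)"
    by (simp_all add: carrier_mat_iff mat_algebra r)
  obtain Z J' where ZJ: "Z \<in> carrier_mat d d" "J' \<in> carrier_mat d d" "adj J' = J'" "J' * J' = 1\<^sub>m d"
    "adj V * (?J * V) * (Z * (J' * (adj Z * (adj V * (?J * V))))) = adj V * (?J * V)"
    using hermitian_signature[OF G] by blast
  note [simp] = ZJ(1,2)[unfolded carrier_mat_iff]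
  define Q where "Q = V * Z"
  have [simp]: "dim_row Q = ?e" "dim_col Q = d" by (simp_all add: Q_def)
  define \<rho>' :: "('h, 'g) realization" where "\<rho>' = \<lparr>rl_dim = d, rl_J = J', rl_T = \<lambda>i. adj Q * (rl_T \<rho> i * Q),
    rl_S = \<lambda>i. adj Q * (rl_S \<rho> i * Q), rl_c = col (adj Q * ?C) 0\<rparr>"
  have T: "dim_row (rl_T \<rho> i) = ?e" "dim_col (rl_T \<rho> i) = ?e" "adj (rl_T \<rho> i) = rl_T \<rho> i" for i
    using r(4)[of "Inl i"] r(5)[of "Inl i"] by (auto simp: coeffs_def)
  have S: "dim_row (rl_S \<rho> i) = ?e" "dim_col (rl_S \<rho> i) = ?e" "adj (rl_S \<rho> i) = rl_S \<rho> i" for i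
    using r(4)[of "Inr i"] r(5)[of "Inr i"] by (auto simp: coeffs_def)
  have \<rho>': "sym_realization \<rho>'"
    unfolding sym_realization_def hermitian_mat_def
  proof (intro conjI allI)
    show "rl_J \<rho>' \<in> carrier_mat (rl_dim \<rho>') (rl_dim \<rho>')" "adj (rl_J \<rho>') = rl_J \<rho>'" "rl_J \<rho>' * rl_J \<rho>' = 1\<^sub>m (rl_dim \<rho>')"
      using ZJ(2-4) by (simp_all add: \<rho>'_def)
    show "rl_T \<rho>' i \<in> carrier_mat (rl_dim \<rho>') (rl_dim \<rho>')" "adj (rl_T \<rho>' i) = rl_T \<rho>' i" for i
      by (simp_all add: \<rho>'_def mat_algebra T carrier_mat_iff)
    show "rl_S \<rho>' i \<in> carrier_mat (rl_dim \<rho>') (rl_dim \<rho>')" "adj (rl_S \<rho>' i) = rl_S \<rho>' i" for i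
      by (simp_all add: \<rho>'_def mat_algebra S carrier_mat_iff)
    show "rl_c \<rho>' \<in> carrier_vec (rl_dim \<rho>')"
      by (rule carrier_vecI) (simp add: \<rho>'_def)
  qed
  have K: "coeffs \<rho>' i = adj Q * (coeffs \<rho> i * Q)" for i
    by (cases i) (simp_all add: coeffs_def \<rho>'_def)
  have C: "mat_of_cols d [rl_c \<rho>'] = adj Q * ?C"
    by (rule eq_matI) (auto simp: \<rho>'_def mat_of_cols_index simp del: index_mult_mat(1))
  have dim: "rl_dim \<rho>' = d" by (simp add: \<rho>'_def)
  show ?thesis
  proof (rule that[OF \<rho>' dim])
    fix n :: nat and p :: "('h, 'g) pair"
    assume p: "\<And>i. join p i \<in> carrier_mat n n" and d: "det (pencil \<rho> n p) \<noteq> 0" "det (pencil \<rho>' n p) \<noteq> 0"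
    note i = resolvent_inverse[OF \<rho> p d(1)] and i' = resolvent_inverse[OF \<rho>' p d(2)]
    note [simp] = i(1)[unfolded carrier_mat_iff] i'(1)[unfolded carrier_mat_iff]
    have "coeffs \<rho>' = (\<lambda>i. adj Q * (coeffs \<rho> i * Q))" using K by blast
    then have L': "pencil \<rho>' n p = kron J' (1\<^sub>m n) - lin (d * n) (d * n) (\<lambda>i. adj Q * (coeffs \<rho> i * Q)) (join p)"
      using pencil_lin[OF \<rho>' p] by (simp add: \<rho>'_def)
    have "adj (kron ?C (1\<^sub>m n)) * (resolvent \<rho> n p * kron ?C (1\<^sub>m n)) =
      adj (kron (adj Q * ?C) (1\<^sub>m n)) * (resolvent \<rho>' n p * kron (adj Q * ?C) (1\<^sub>m n))"
      by (rule reduced_resolvent[OF V(1) r(1) r(7) ZJ(1,2) i(1) i'(1)[unfolded dim] r(4,5) p V(2) r(2,3) ZJ(3,4)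
          inv ZJ(5) Q_def pencil_lin[OF \<rho> p] L' i(2,3) i'(3)[unfolded dim]])
    then show "rl_eval \<rho>' n p = rl_eval \<rho> n p"
      unfolding rl_eval_def compressed_resolvent_def dim C by (simp add: mat_algebra dim)
  qed
qed

section \<open>Limits of matrices\<close>

text \<open>Entrywise convergence at a fixed shape. The shape is demanded only eventually, since
  values such as \<open>the (mat_inverse (F t))\<close> are meaningful only near the limit.\<close>

definition mat_lim :: "('a \<Rightarrow> complex mat) \<Rightarrow> complex mat \<Rightarrow> nat \<Rightarrow> nat \<Rightarrow> 'a filter \<Rightarrow> bool" where
  "mat_lim F A n m fl \<longleftrightarrow> A \<in> carrier_mat n m \<and> (\<forall>\<^sub>F t in fl. F t \<in> carrier_mat n m) \<and>
     (\<forall>i<n. \<forall>j<m. ((\<lambda>t. F t $$ (i, j)) \<longlongrightarrow> A $$ (i, j)) fl)"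

lemma mat_lim_const: "A \<in> carrier_mat n m \<Longrightarrow> mat_lim (\<lambda>_. A) A n m fl"
  by (simp add: mat_lim_def)

lemma mat_lim_cong:
  assumes F: "mat_lim F A n m fl" and e: "\<forall>\<^sub>F t in fl. F t = G t"
  shows "mat_lim G A n m fl"
  unfolding mat_lim_def
proof (intro conjI allI impI)
  show "A \<in> carrier_mat n m" using F by (simp add: mat_lim_def)
  have "\<forall>\<^sub>F t in fl. F t \<in> carrier_mat n m" using F by (simp add: mat_lim_def)
  with e show "\<forall>\<^sub>F t in fl. G t \<in> carrier_mat n m" by eventually_elim simp
  fix i j assume "i < n" "j < m"
  then have "((\<lambda>t. F t $$ (i, j)) \<longlongrightarrow> A $$ (i, j)) fl" using F by (simp add: mat_lim_def)
  moreover have "\<forall>\<^sub>F t in fl. F t $$ (i, j) = G t $$ (i, j)" using e by eventually_elim simp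
  ultimately show "((\<lambda>t. G t $$ (i, j)) \<longlongrightarrow> A $$ (i, j)) fl" by (rule Lim_transform_eventually)
qed

lemma mat_lim_add:
  assumes "mat_lim F A n m fl" "mat_lim G B n m fl"
  shows "mat_lim (\<lambda>t. F t + G t) (A + B) n m fl"
proof -
  have e: "\<forall>\<^sub>F t in fl. F t \<in> carrier_mat n m \<and> G t \<in> carrier_mat n m"
    using assms by (auto simp: mat_lim_def eventually_conj)
  show ?thesis unfolding mat_lim_def
  proof (intro conjI allI impI)
    fix i j assume ij: "i < n" "j < m"
    have "((\<lambda>t. F t $$ (i, j) + G t $$ (i, j)) \<longlongrightarrow> A $$ (i, j) + B $$ (i, j)) fl"
      using assms ij by (auto simp: mat_lim_def intro!: tendsto_add)
    moreover have "\<forall>\<^sub>F t in fl. F t $$ (i, j) + G t $$ (i, j) = (F t + G t) $$ (i, j)"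
      using e by eventually_elim (use ij in auto)
    ultimately show "((\<lambda>t. (F t + G t) $$ (i, j)) \<longlongrightarrow> (A + B) $$ (i, j)) fl"
      using assms ij by (subst index_add_mat) (auto simp: mat_lim_def intro: Lim_transform_eventually)
  qed (use assms e in \<open>auto simp: mat_lim_def elim: eventually_mono\<close>)
qed

lemma mat_lim_mult:
  assumes "mat_lim F A n m fl" "mat_lim G B m k fl"
  shows "mat_lim (\<lambda>t. F t * G t) (A * B) n k fl"
proof -
  have e: "\<forall>\<^sub>F t in fl. F t \<in> carrier_mat n m \<and> G t \<in> carrier_mat m k"
    using assms by (auto simp: mat_lim_def eventually_conj)
  show ?thesis unfolding mat_lim_def
  proof (intro conjI allI impI)
    fix i j assume ij: "i < n" "j < k"
    have "((\<lambda>t. \<Sum>l<m. F t $$ (i, l) * G t $$ (l, j)) \<longlongrightarrow> (\<Sum>l<m. A $$ (i, l) * B $$ (l, j))) fl"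
      using assms ij by (auto simp: mat_lim_def intro!: tendsto_sum tendsto_mult)
    moreover have "\<forall>\<^sub>F t in fl. (\<Sum>l<m. F t $$ (i, l) * G t $$ (l, j)) = (F t * G t) $$ (i, j)"
      using e by eventually_elim (use ij in \<open>auto simp: scalar_prod_def atLeast0LessThan intro!: sum.cong\<close>)
    moreover have "(\<Sum>l<m. A $$ (i, l) * B $$ (l, j)) = (A * B) $$ (i, j)"
      using assms ij by (auto simp: mat_lim_def scalar_prod_def atLeast0LessThan intro!: sum.cong)
    ultimately show "((\<lambda>t. (F t * G t) $$ (i, j)) \<longlongrightarrow> (A * B) $$ (i, j)) fl"
      by (auto intro: Lim_transform_eventually)
  next
    show "\<forall>\<^sub>F t in fl. F t * G t \<in> carrier_mat n k" using e by eventually_elim auto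
  qed (use assms in \<open>auto simp: mat_lim_def\<close>)
qed

lemma mat_lim_smult:
  assumes "mat_lim F A n m fl" "(f \<longlongrightarrow> a) fl"
  shows "mat_lim (\<lambda>t. f t \<cdot>\<^sub>m F t) (a \<cdot>\<^sub>m A) n m fl"
proof -
  have e: "\<forall>\<^sub>F t in fl. F t \<in> carrier_mat n m" using assms by (auto simp: mat_lim_def)
  show ?thesis unfolding mat_lim_def
  proof (intro conjI allI impI)
    fix i j assume ij: "i < n" "j < m"
    have "((\<lambda>t. f t * F t $$ (i, j)) \<longlongrightarrow> a * A $$ (i, j)) fl"
      using assms ij by (auto simp: mat_lim_def intro!: tendsto_mult)
    moreover have "\<forall>\<^sub>F t in fl. f t * F t $$ (i, j) = (f t \<cdot>\<^sub>m F t) $$ (i, j)"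
      using e by eventually_elim (use ij in auto)
    moreover have "a * A $$ (i, j) = (a \<cdot>\<^sub>m A) $$ (i, j)" using assms ij by (auto simp: mat_lim_def)
    ultimately show "((\<lambda>t. (f t \<cdot>\<^sub>m F t) $$ (i, j)) \<longlongrightarrow> (a \<cdot>\<^sub>m A) $$ (i, j)) fl"
      by (auto intro: Lim_transform_eventually)
  next
    show "\<forall>\<^sub>F t in fl. f t \<cdot>\<^sub>m F t \<in> carrier_mat n m" using e by eventually_elim auto
  qed (use assms in \<open>auto simp: mat_lim_def\<close>)
qed

lemma mat_lim_unique:
  assumes "mat_lim F A n m fl" "mat_lim F B n m fl" "fl \<noteq> bot"
  shows "A = B"
proof (rule eq_matI)
  fix i j assume "i < dim_row B" "j < dim_col B"
  then have "i < n" "j < m" using assms by (auto simp: mat_lim_def)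
  then have "((\<lambda>t. F t $$ (i, j)) \<longlongrightarrow> A $$ (i, j)) fl" "((\<lambda>t. F t $$ (i, j)) \<longlongrightarrow> B $$ (i, j)) fl"
    using assms by (auto simp: mat_lim_def)
  then show "A $$ (i, j) = B $$ (i, j)" by (rule tendsto_unique[OF assms(3)])
qed (use assms in \<open>auto simp: mat_lim_def\<close>)

text \<open>By the Leibniz formula the determinant is a polynomial in the entries.\<close>

lemma tendsto_det:
  assumes "mat_lim F A n n fl"
  shows "((\<lambda>t. det (F t)) \<longlongrightarrow> det A) fl"
proof -
  have "((\<lambda>t. \<Sum>p | p permutes {0..<n}. signof p * (\<Prod>i = 0..<n. F t $$ (i, p i))) \<longlongrightarrow>
     (\<Sum>p | p permutes {0..<n}. signof p * (\<Prod>i = 0..<n. A $$ (i, p i)))) fl"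
  proof (intro tendsto_sum tendsto_mult tendsto_const tendsto_prod)
    fix p i assume "p \<in> {p. p permutes {0..<n}}" "i \<in> {0..<n}"
    then have "i < n" "p i < n" using permutes_in_image[of p "{0..<n}" i] by auto
    then show "((\<lambda>t. F t $$ (i, p i)) \<longlongrightarrow> A $$ (i, p i)) fl" using assms by (auto simp: mat_lim_def)
  qed
  moreover have "\<forall>\<^sub>F t in fl. (\<Sum>p | p permutes {0..<n}. signof p * (\<Prod>i = 0..<n. F t $$ (i, p i))) = det (F t)"
    using assms unfolding mat_lim_def by (auto elim!: eventually_mono simp: det_def')
  ultimately show ?thesis using assms by (auto simp: mat_lim_def det_def' intro: Lim_transform_eventually)
qed

lemma mat_lim_adj_mat:
  assumes F: "mat_lim F A n n fl"
  shows "mat_lim (\<lambda>t. adj_mat (F t)) (adj_mat A) n n fl"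
proof -
  have e: "\<forall>\<^sub>F t in fl. F t \<in> carrier_mat n n" and A: "A \<in> carrier_mat n n" using F by (auto simp: mat_lim_def)
  have del: "mat_lim (\<lambda>t. mat_delete (F t) j i) (mat_delete A j i) (n - 1) (n - 1) fl" if "i < n" "j < n" for i j
    unfolding mat_lim_def
  proof (intro conjI allI impI)
    show "mat_delete A j i \<in> carrier_mat (n - 1) (n - 1)" using A by (rule mat_delete_carrier)
    show "\<forall>\<^sub>F t in fl. mat_delete (F t) j i \<in> carrier_mat (n - 1) (n - 1)"
      using e by eventually_elim (rule mat_delete_carrier)
    fix a b assume ab: "a < n - 1" "b < n - 1"
    let ?a = "if a < j then a else Suc a" and ?b = "if b < i then b else Suc b"
    have "((\<lambda>t. F t $$ (?a, ?b)) \<longlongrightarrow> A $$ (?a, ?b)) fl" using F ab by (auto simp: mat_lim_def)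
    moreover have "\<forall>\<^sub>F t in fl. F t $$ (?a, ?b) = mat_delete (F t) j i $$ (a, b)"
      using e by eventually_elim (use ab in \<open>auto simp: mat_delete_def\<close>)
    moreover have "A $$ (?a, ?b) = mat_delete A j i $$ (a, b)" using A ab by (auto simp: mat_delete_def)
    ultimately show "((\<lambda>t. mat_delete (F t) j i $$ (a, b)) \<longlongrightarrow> mat_delete A j i $$ (a, b)) fl"
      by (auto intro: Lim_transform_eventually)
  qed
  show ?thesis unfolding mat_lim_def
  proof (intro conjI allI impI)
    show "adj_mat A \<in> carrier_mat n n" by (rule adj_mat(1)[OF A])
    show "\<forall>\<^sub>F t in fl. adj_mat (F t) \<in> carrier_mat n n" using e by eventually_elim (rule adj_mat(1))
    fix i j assume ij: "i < n" "j < n"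
    have "((\<lambda>t. (-1) ^ (j + i) * det (mat_delete (F t) j i)) \<longlongrightarrow> (-1) ^ (j + i) * det (mat_delete A j i)) fl"
      by (intro tendsto_intros tendsto_det[OF del] ij)
    moreover have "\<forall>\<^sub>F t in fl. (-1) ^ (j + i) * det (mat_delete (F t) j i) = adj_mat (F t) $$ (i, j)"
      using e by eventually_elim (use ij in \<open>auto simp: adj_mat_def cofactor_def\<close>)
    moreover have "(-1) ^ (j + i) * det (mat_delete A j i) = adj_mat A $$ (i, j)"
      using A ij by (auto simp: adj_mat_def cofactor_def)
    ultimately show "((\<lambda>t. adj_mat (F t) $$ (i, j)) \<longlongrightarrow> adj_mat A $$ (i, j)) fl"
      by (auto intro: Lim_transform_eventually)
  qed
qed

lemma mat_inverse_adj_mat: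
  fixes A :: "complex mat"
  assumes A: "A \<in> carrier_mat n n" and d: "det A \<noteq> 0"
  shows "mat_inverse A = Some ((1 / det A) \<cdot>\<^sub>m adj_mat A)"
proof (rule mat_inverse_eqI[OF A])
  note [simp] = carrier_matD[OF A] carrier_matD[OF adj_mat(1)[OF A]]
  show "(1 / det A) \<cdot>\<^sub>m adj_mat A \<in> carrier_mat n n" by (simp add: carrier_mat_iff)
  show "A * ((1 / det A) \<cdot>\<^sub>m adj_mat A) = 1\<^sub>m n"
    using d by (auto simp: mat_algebra adj_mat(2)[OF A] intro!: eq_matI)
qed

text \<open>Continuity of inversion by Cramer's rule (\<open>mat_inverse_adj_mat\<close>). Near the
  limit the determinant is nonzero, so the unspecified value of \<open>the None\<close> is never met
  there.\<close>

lemma mat_lim_inverse: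
  assumes F: "mat_lim F A n n fl" and d: "det A \<noteq> 0"
  shows "\<forall>\<^sub>F t in fl. det (F t) \<noteq> 0"
    and "mat_lim (\<lambda>t. the (mat_inverse (F t))) (the (mat_inverse A)) n n fl"
proof -
  have e: "\<forall>\<^sub>F t in fl. F t \<in> carrier_mat n n" and A: "A \<in> carrier_mat n n" using F by (auto simp: mat_lim_def)
  show d': "\<forall>\<^sub>F t in fl. det (F t) \<noteq> 0"
    using tendsto_imp_eventually_ne[OF tendsto_det[OF F] d] .
  have "mat_lim (\<lambda>t. (1 / det (F t)) \<cdot>\<^sub>m adj_mat (F t)) ((1 / det A) \<cdot>\<^sub>m adj_mat A) n n fl"
    by (intro mat_lim_smult mat_lim_adj_mat F tendsto_divide tendsto_const tendsto_det[OF F] d)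
  then show "mat_lim (\<lambda>t. the (mat_inverse (F t))) (the (mat_inverse A)) n n fl"
    unfolding mat_inverse_adj_mat[OF A d] option.sel
    by (rule mat_lim_cong) (use e d' in eventually_elim, simp add: mat_inverse_adj_mat)
qed

section \<open>Continuity of noncommutative expressions\<close>

text \<open>Domains of expressions are open and evaluation is continuous on them. Definedness is at
  stake only at an inverse, where \<open>mat_lim_inverse\<close> supplies both claims.\<close>

lemma nc_eval_lim:
  assumes A: "\<And>j. mat_lim (\<lambda>t. A t j) (A0 j) n n fl" and X: "\<And>i. mat_lim (\<lambda>t. X t i) (X0 i) n n fl"
    and r: "nc_eval n (A0, X0) r = Some M"
  shows "(\<forall>\<^sub>F t in fl. nc_eval n (A t, X t) r \<noteq> None) \<and> mat_lim (\<lambda>t. the (nc_eval n (A t, X t) r)) M n n fl"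
  using r
proof (induction r arbitrary: M)
  case (AVar j)
  then show ?case using A[of j] by auto
next
  case (XVar i)
  then show ?case using X[of i] by auto
next
  case (Scalar z)
  then show ?case by (auto intro!: mat_lim_const)
next
  case (Plus r s)
  then obtain R S where RS: "nc_eval n (A0, X0) r = Some R" "nc_eval n (A0, X0) s = Some S" "M = R + S"
    by (auto split: option.splits)
  note IH = Plus.IH(1)[OF RS(1)] Plus.IH(2)[OF RS(2)]
  have e: "\<forall>\<^sub>F t in fl. nc_eval n (A t, X t) r \<noteq> None \<and> nc_eval n (A t, X t) s \<noteq> None" using IH by (simp add: eventually_conj)
  have "mat_lim (\<lambda>t. the (nc_eval n (A t, X t) r) + the (nc_eval n (A t, X t) s)) M n n fl"
    unfolding RS using IH by (intro mat_lim_add) auto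
  then have "mat_lim (\<lambda>t. the (nc_eval n (A t, X t) (Plus r s))) M n n fl"
    by (rule mat_lim_cong) (use e in eventually_elim, auto)
  moreover have "\<forall>\<^sub>F t in fl. nc_eval n (A t, X t) (Plus r s) \<noteq> None" using e by eventually_elim auto
  ultimately show ?case by blast
next
  case (Times r s)
  then obtain R S where RS: "nc_eval n (A0, X0) r = Some R" "nc_eval n (A0, X0) s = Some S" "M = R * S"
    by (auto split: option.splits)
  note IH = Times.IH(1)[OF RS(1)] Times.IH(2)[OF RS(2)]
  have e: "\<forall>\<^sub>F t in fl. nc_eval n (A t, X t) r \<noteq> None \<and> nc_eval n (A t, X t) s \<noteq> None" using IH by (simp add: eventually_conj)
  have "mat_lim (\<lambda>t. the (nc_eval n (A t, X t) r) * the (nc_eval n (A t, X t) s)) M n n fl"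
    unfolding RS using IH by (intro mat_lim_mult) auto
  then have "mat_lim (\<lambda>t. the (nc_eval n (A t, X t) (Times r s))) M n n fl"
    by (rule mat_lim_cong) (use e in eventually_elim, auto)
  moreover have "\<forall>\<^sub>F t in fl. nc_eval n (A t, X t) (Times r s) \<noteq> None" using e by eventually_elim auto
  ultimately show ?case by blast
next
  case (Inverse r)
  then obtain R where R: "nc_eval n (A0, X0) r = Some R" "mat_inverse R = Some M"
    by (auto split: option.splits)
  note IH = Inverse.IH[OF R(1)]
  have Rc: "R \<in> carrier_mat n n" using IH by (simp add: mat_lim_def)
  have "det R \<noteq> 0" using mat_inverse(2)[OF Rc R(2)] inverse_det_nonzero[OF Rc] by blast
  note l = mat_lim_inverse[OF conjunct2[OF IH] this]
  have e: "\<forall>\<^sub>F t in fl. nc_eval n (A t, X t) (Inverse r) = mat_inverse (the (nc_eval n (A t, X t) r))"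
    using conjunct1[OF IH] by eventually_elim auto
  have "\<forall>\<^sub>F t in fl. the (nc_eval n (A t, X t) r) \<in> carrier_mat n n" using IH by (simp add: mat_lim_def)
  with e l(1) have "\<forall>\<^sub>F t in fl. nc_eval n (A t, X t) (Inverse r) \<noteq> None"
    by eventually_elim (simp add: mat_inverse_adj_mat)
  moreover have "mat_lim (\<lambda>t. the (nc_eval n (A t, X t) (Inverse r))) M n n fl"
    using l(2) unfolding R(2) option.sel by (rule mat_lim_cong) (use e in eventually_elim, simp)
  ultimately show ?case by blast
qed

lemma mat_lim_minus:
  assumes "mat_lim F A n m fl" "mat_lim G B n m fl"
  shows "mat_lim (\<lambda>t. F t - G t) (A - B) n m fl"
proof -
  have "mat_lim (\<lambda>t. F t + (- 1) \<cdot>\<^sub>m G t) (A + (- 1) \<cdot>\<^sub>m B) n m fl"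
    by (intro mat_lim_add mat_lim_smult assms tendsto_const)
  moreover have "\<forall>\<^sub>F t in fl. F t \<in> carrier_mat n m \<and> G t \<in> carrier_mat n m"
    using assms by (auto simp: mat_lim_def eventually_conj)
  then have "\<forall>\<^sub>F t in fl. F t + (- 1) \<cdot>\<^sub>m G t = F t - G t"
    by eventually_elim (rule eq_matI, auto)
  moreover have "A + (- 1) \<cdot>\<^sub>m B = A - B" using assms by (intro eq_matI) (auto simp: mat_lim_def)
  ultimately show ?thesis using mat_lim_cong by metis
qed

section \<open>Minimality\<close>

lemma pencil_shift:
  assumes \<rho>: "sym_realization \<rho>" and p: "\<And>i. join p i \<in> carrier_mat n n" and q: "\<And>i. q i \<in> carrier_mat n n"
    and p': "\<And>i. join p' i = join p i + k \<cdot>\<^sub>m q i"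
  shows "pencil \<rho> n p' = pencil \<rho> n p - k \<cdot>\<^sub>m rl_lin \<rho> n n q"
proof -
  let ?N = "rl_dim \<rho> * n" and ?l = "\<lambda>q. rl_lin \<rho> n n q"
  have c: "join p' i \<in> carrier_mat n n" for i using p q p' by simp
  have "join p' = (\<lambda>i. join p i + k \<cdot>\<^sub>m q i)" using p' by blast
  then have "?l (join p') = ?l (join p) + ?l (\<lambda>i. k \<cdot>\<^sub>m q i)"
    by (simp only:) (rule lin_add_right, use rl_carriers(4)[OF \<rho>] p q in auto)
  also have "?l (\<lambda>i. k \<cdot>\<^sub>m q i) = k \<cdot>\<^sub>m ?l q"
    by (rule lin_smult_right[OF rl_carriers(4)[OF \<rho>] q])
  finally have l: "?l (join p') = ?l (join p) + k \<cdot>\<^sub>m ?l q" .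
  have [simp]: "dim_row (rl_J \<rho>) = rl_dim \<rho>" "dim_col (rl_J \<rho>) = rl_dim \<rho>" using rl_carriers(1)[OF \<rho>] by auto
  show ?thesis unfolding pencil_lin[OF \<rho> p] pencil_lin[OF \<rho> c] l by (rule eq_matI) auto
qed

lemma pencil_shift_lim:
  assumes \<rho>: "sym_realization \<rho>" and p: "\<And>i. join p i \<in> carrier_mat n n" and q: "\<And>i. q i \<in> carrier_mat n n"
    and p': "\<And>t i. join (p' t) i = join p i + f t \<cdot>\<^sub>m q i" and f: "(f \<longlongrightarrow> 0) fl"
  shows "mat_lim (\<lambda>t. pencil \<rho> n (p' t)) (pencil \<rho> n p) (rl_dim \<rho> * n) (rl_dim \<rho> * n) fl"
proof -
  let ?N = "rl_dim \<rho> * n" and ?l = "rl_lin \<rho> n n q"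
  have "mat_lim (\<lambda>t. pencil \<rho> n p - f t \<cdot>\<^sub>m ?l) (pencil \<rho> n p - 0 \<cdot>\<^sub>m ?l) ?N ?N fl"
    by (intro mat_lim_minus mat_lim_smult mat_lim_const f pencil_carrier[OF \<rho> p] lin_carrier)
  moreover have "pencil \<rho> n p - 0 \<cdot>\<^sub>m ?l = pencil \<rho> n p"
    using pencil_carrier[OF \<rho> p, THEN carrier_matD(1)] pencil_carrier[OF \<rho> p, THEN carrier_matD(2)]
    by (intro eq_matI) auto
  ultimately show ?thesis using pencil_shift[OF \<rho> p q p'] by simp
qed

lemma resolvent_lim:
  assumes "mat_lim (\<lambda>t. pencil \<rho> n (p' t)) (pencil \<rho> n p) (rl_dim \<rho> * n) (rl_dim \<rho> * n) fl" "det (pencil \<rho> n p) \<noteq> 0"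
  shows "\<forall>\<^sub>F t in fl. det (pencil \<rho> n (p' t)) \<noteq> 0"
    "mat_lim (\<lambda>t. resolvent \<rho> n (p' t)) (resolvent \<rho> n p) (rl_dim \<rho> * n) (rl_dim \<rho> * n) fl"
  using mat_lim_inverse[OF assms] by (simp_all add: resolvent_def)

text \<open>Multiplication by \<open>J\<close> turns a kernel vector of
  \<open>J - t \<Lambda>\<close> into an eigenvector of \<open>J \<Lambda>\<close> for
  \<open>1 / t\<close>; the value \<open>t = 0\<close> is excluded as \<open>J\<close> is
  invertible. The characteristic polynomial has finitely many roots.\<close>

lemma finite_singular_pencil:
  fixes J \<Lambda> :: "complex mat"
  assumes J: "J \<in> carrier_mat n n" "J * J = 1\<^sub>m n" and \<Lambda>: "\<Lambda> \<in> carrier_mat n n"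
  shows "finite {t. det (J - t \<cdot>\<^sub>m \<Lambda>) = 0}"
proof (rule finite_subset)
  note [simp] = carrier_matD[OF J(1)] carrier_matD[OF \<Lambda>]
  define B where "B = J * \<Lambda>"
  have B: "B \<in> carrier_mat n n" by (simp add: B_def carrier_mat_iff)
  have "char_poly B \<noteq> 0" using degree_monic_char_poly[OF B] by auto
  then show "finite (inverse ` {k. poly (char_poly B) k = 0})" by (simp add: poly_roots_finite)
  show "{t. det (J - t \<cdot>\<^sub>m \<Lambda>) = 0} \<subseteq> inverse ` {k. poly (char_poly B) k = 0}"
  proof
    fix t assume "t \<in> {t. det (J - t \<cdot>\<^sub>m \<Lambda>) = 0}"
    then have "det (J - t \<cdot>\<^sub>m \<Lambda>) = 0" by simp
    moreover have c: "J - t \<cdot>\<^sub>m \<Lambda> \<in> carrier_mat n n" by (simp add: carrier_mat_iff)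
    ultimately obtain v where v: "v \<in> carrier_mat n 1" "v \<noteq> 0\<^sub>m n 1" "(J - t \<cdot>\<^sub>m \<Lambda>) * v = 0\<^sub>m n 1"
      using det_nonzeroI[OF c] by blast
    note [simp] = carrier_matD[OF v(1)] carrier_matD[OF B]
    have "J * ((J - t \<cdot>\<^sub>m \<Lambda>) * v) = 0\<^sub>m n 1" unfolding v(3) by (simp add: mat_algebra)
    then have z: "v - t \<cdot>\<^sub>m (B * v) = 0\<^sub>m n 1" by (simp add: B_def mat_algebra mult_eq_assoc[OF J(2)])
    have t: "t \<noteq> 0"
    proof
      assume "t = 0"
      then have "v - t \<cdot>\<^sub>m (B * v) = v" by (intro eq_matI) (auto simp del: index_mult_mat(1))
      with z v(2) show False by simp
    qed
    have "char_matrix B (1 / t) * v = (- (1 / t)) \<cdot>\<^sub>m (v - t \<cdot>\<^sub>m (B * v))"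
      using t by (intro eq_matI) (auto simp: char_matrix_def mat_algebra algebra_simps simp del: index_mult_mat(1))
    also have "\<dots> = 0\<^sub>m n 1" unfolding z by auto
    finally have kv: "char_matrix B (1 / t) * v = 0\<^sub>m n 1" .
    have "det (char_matrix B (1 / t)) = 0"
    proof (rule ccontr)
      assume d: "det (char_matrix B (1 / t)) \<noteq> 0"
      have cc: "char_matrix B (1 / t) \<in> carrier_mat n n" by (simp add: char_matrix_def carrier_mat_iff)
      obtain X where X: "X \<in> carrier_mat n n" "X * char_matrix B (1 / t) = 1\<^sub>m n"
        using mat_inverse_det[OF cc d] by metis
      note [simp] = carrier_matD[OF X(1)] carrier_matD[OF cc]
      have "X * (char_matrix B (1 / t) * v) = v" by (simp add: mult_eq_assoc[OF X(2)] mat_algebra)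
      then show False using v(2) unfolding kv by (simp add: mat_algebra)
    qed
    then have "eigenvalue B (1 / t)" using eigenvalue_det[OF B] by simp
    then have "poly (char_poly B) (1 / t) = 0" using eigenvalue_root_char_poly[OF B] by simp
    then show "t \<in> inverse ` {k. poly (char_poly B) k = 0}"
      by (intro image_eqI[of _ _ "1 / t"]) (auto simp: field_simps)
  qed
qed

text \<open>
  The two pencils may be singular at different points, so the values at \<open>P\<close> are obtained as limits
  along \<open>t \<mapsto> t P\<close> as \<open>t \<rightarrow> 1\<close>.
\<close>
lemma realizes_extend:
  fixes \<rho> \<rho>' :: "('h::finite, 'g::finite) realization"
  assumes \<rho>: "sym_realization \<rho>" and r: "realizes \<rho> r" and \<rho>': "sym_realization \<rho>'"
    and eq: "\<And>n p. (\<And>i. join p i \<in> carrier_mat n n) \<Longrightarrow> det (pencil \<rho> n p) \<noteq> 0 \<Longrightarrow> det (pencil \<rho>' n p) \<noteq> 0 \<Longrightarrow>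
      rl_eval \<rho>' n p = rl_eval \<rho> n p"
  shows "realizes \<rho>' r"
  unfolding realizes_def
proof (intro allI impI)
  fix n A X M
  assume n: "1 \<le> n" and A: "\<forall>j. A j \<in> carrier_mat n n" and X: "\<forall>i. X i \<in> carrier_mat n n"
    and M: "nc_eval n (A, X) r = Some M" and d: "det (pencil \<rho>' n (A, X)) \<noteq> 0"
  have p: "join (A, X) i \<in> carrier_mat n n" for i using A X by (auto simp: join_def split: sum.splits)
  \<comment> \<open>The parameter \<open>t\<close> is complex, so these tuples are in general not
    hermitian, even for hermitian \<open>(A, X)\<close>; \<open>realizes\<close> covers arbitrary
    tuples.\<close>
  define P where "P t = ((\<lambda>j. t \<cdot>\<^sub>m A j), (\<lambda>i. t \<cdot>\<^sub>m X i))" for t :: complex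
  have jP: "join (P t) i = t \<cdot>\<^sub>m join (A, X) i" for t i by (cases i) (auto simp: P_def join_def)
  have cP: "join (P t) i \<in> carrier_mat n n" for t i using p jP by simp
  have jP': "join (P t) i = join (A, X) i + (t - 1) \<cdot>\<^sub>m join (A, X) i" for t i
    unfolding jP by (rule eq_matI) (auto simp: algebra_simps)
  have t1: "((\<lambda>t. t - 1) \<longlongrightarrow> (0::complex)) (at 1)" by (auto intro!: tendsto_eq_intros)
  note l = resolvent_lim[OF pencil_shift_lim[OF \<rho>' p p jP' t1] d]
  let ?C = "kron (rl_C \<rho>') (1\<^sub>m n)"
  have C: "?C \<in> carrier_mat (rl_dim \<rho>' * n) n" using rl_carriers(7)[OF \<rho>'] by (simp add: carrier_mat_iff)
  have lim1: "mat_lim (\<lambda>t. rl_eval \<rho>' n (P t)) (rl_eval \<rho>' n (A, X)) n n (at 1)"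
    unfolding rl_eval_def compressed_resolvent_def
    by (rule mat_lim_mult[OF mat_lim_mult[OF mat_lim_const[OF adj_carrier[OF C]] l(2)] mat_lim_const[OF C]])
  have "(\<forall>\<^sub>F t in at 1. nc_eval n (P t) r \<noteq> None) \<and> mat_lim (\<lambda>t. the (nc_eval n (P t) r)) M n n (at 1)"
    unfolding P_def
  proof (rule nc_eval_lim[OF _ _ M])
    have "mat_lim (\<lambda>t. t \<cdot>\<^sub>m Y) Y n n (at (1::complex))" if "Y \<in> carrier_mat n n" for Y
    proof -
      have "mat_lim (\<lambda>t. t \<cdot>\<^sub>m Y) (1 \<cdot>\<^sub>m Y) n n (at (1::complex))"
        by (intro mat_lim_smult mat_lim_const that tendsto_ident_at)
      moreover have "1 \<cdot>\<^sub>m Y = Y" by (rule eq_matI) auto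
      ultimately show ?thesis by simp
    qed
    then show "mat_lim (\<lambda>t. t \<cdot>\<^sub>m A j) (A j) n n (at 1)" "mat_lim (\<lambda>t. t \<cdot>\<^sub>m X i) (X i) n n (at 1)" for i j
      using A X by auto
  qed
  then have some: "\<forall>\<^sub>F t in at 1. nc_eval n (P t) r \<noteq> None" and lim2: "mat_lim (\<lambda>t. the (nc_eval n (P t) r)) M n n (at 1)"
    by auto
  have "finite {t. det (pencil \<rho> n (P t)) = 0}"
  proof -
    let ?J = "kron (rl_J \<rho>) (1\<^sub>m n)" and ?l = "rl_lin \<rho> n n (join (A, X))"
    have "pencil \<rho> n (P t) = ?J - t \<cdot>\<^sub>m ?l" for t
    proof -
      have "join (P t) = (\<lambda>i. t \<cdot>\<^sub>m join (A, X) i)" using jP by blast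
      then show ?thesis
        unfolding pencil_lin[OF \<rho> cP]
          using lin_smult_right[where Z = "coeffs \<rho>" and z = "join (A, X)" and k = t, OF rl_carriers(4)[OF \<rho>] p] by simp
    qed
    moreover have "finite {t. det (?J - t \<cdot>\<^sub>m ?l) = 0}"
    proof (rule finite_singular_pencil)
      show "?J \<in> carrier_mat (rl_dim \<rho> * n) (rl_dim \<rho> * n)" using rl_carriers(1)[OF \<rho>] by auto
      have "?J * ?J = kron (rl_J \<rho> * rl_J \<rho>) (1\<^sub>m n * 1\<^sub>m n)"
        by (rule kron_mult) (use rl_carriers(1)[OF \<rho>] in auto)
      then show "?J * ?J = 1\<^sub>m (rl_dim \<rho> * n)" by (simp add: rl_carriers(3)[OF \<rho>] kron_one)
    qed simp
    ultimately show ?thesis by simp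
  qed
  \<comment> \<open>The point 1 is taken out of the singular set because the pencil of
    \<open>\<rho>\<close> may well be singular at the limit itself; the filter \<open>at 1\<close>
    ignores that point.\<close>
  then have "open (- ({t. det (pencil \<rho> n (P t)) = 0} - {1}))"
    by (intro open_Compl finite_imp_closed) simp
  then have d\<rho>: "\<forall>\<^sub>F t in at 1. det (pencil \<rho> n (P t)) \<noteq> 0"
    unfolding eventually_at_topological by (intro exI[of _ "- ({t. det (pencil \<rho> n (P t)) = 0} - {1})"]) auto
  have "\<forall>\<^sub>F t in at 1. the (nc_eval n (P t) r) = rl_eval \<rho>' n (P t)"
    using some d\<rho> l(1)
  proof eventually_elim
    case (elim t)
    then obtain M' where M': "nc_eval n (P t) r = Some M'" by auto
    have "(\<forall>j. fst (P t) j \<in> carrier_mat n n) \<and> (\<forall>i. snd (P t) i \<in> carrier_mat n n)" using A X by (simp add: P_def)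
    then have "rl_eval \<rho> n (P t) = M'"
      using r n M' elim unfolding realizes_def by (metis prod.collapse)
    with M' eq[OF cP elim(2,3)] show ?case by simp
  qed
  from mat_lim_cong[OF lim2 this] have "mat_lim (\<lambda>t. rl_eval \<rho>' n (P t)) M n n (at 1)" .
  from mat_lim_unique[OF lim1 this] show "rl_eval \<rho>' n (A, X) = M" by simp
qed

text \<open>Controllability of a minimal realization: a subspace that contains \<open>J c\<close>
  and is invariant under all \<open>J T\<^sub>i\<close> and \<open>J S\<^sub>j\<close> carries a
  symmetric realization of \<open>r\<close> whose size is its dimension.\<close>

lemma SMR_minimal:
  fixes \<rho> :: "('h::finite, 'g::finite) realization"
  assumes smr: "is_SMR r \<rho>" and V: "V \<in> carrier_mat (rl_dim \<rho>) d" "adj V * V = 1\<^sub>m d"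
    and inv: "\<And>i. rl_J \<rho> * (coeffs \<rho> i * V) = V * (adj V * (rl_J \<rho> * (coeffs \<rho> i * V)))"
      "rl_J \<rho> * rl_C \<rho> = V * (adj V * (rl_J \<rho> * rl_C \<rho>))"
  shows "rl_dim \<rho> \<le> d"
proof -
  have \<rho>: "sym_realization \<rho>" "realizes \<rho> r" using smr by (auto simp: is_SMR_def)
  obtain \<rho>' :: "('h, 'g) realization" where \<rho>': "sym_realization \<rho>'" "rl_dim \<rho>' = d"
    "\<And>n p. (\<And>i. join p i \<in> carrier_mat n n) \<Longrightarrow> det (pencil \<rho> n p) \<noteq> 0 \<Longrightarrow> det (pencil \<rho>' n p) \<noteq> 0 \<Longrightarrow>
      rl_eval \<rho>' n p = rl_eval \<rho> n p"
    using realization_compress[OF \<rho>(1) V inv] by metis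
  from realizes_extend[OF \<rho> \<rho>'(1) \<rho>'(3)] have "realizes \<rho>' r" .
  then show ?thesis using smr \<rho>'(1,2) by (auto simp: is_SMR_def)
qed

section \<open>The inclusion of the span of the ranges\<close>

lemma mat_of_cols_mult_vec:
  fixes A :: "complex mat"
  assumes A: "A \<in> carrier_mat n m" and v: "v \<in> carrier_vec m"
  shows "mat_of_cols n [A *\<^sub>v v] = A * mat_of_cols m [v]"
proof (rule eq_matI)
  note [simp] = carrier_matD[OF A] carrier_vecD[OF v]
  fix i j assume "i < dim_row (A * mat_of_cols m [v])" "j < dim_col (A * mat_of_cols m [v])"
  then have "i < n" "j = 0" by auto
  then show "mat_of_cols n [A *\<^sub>v v] $$ (i, j) = (A * mat_of_cols m [v]) $$ (i, j)"
    by (simp add: mat_of_cols_index scalar_prod_def)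
qed (use A in simp_all)

lemma mat_of_cols_col: "x \<in> carrier_mat n 1 \<Longrightarrow> mat_of_cols n [col x 0] = x"
  by (rule eq_matI) (auto simp: mat_of_cols_index)

lemma mat_eq_vecI:
  fixes A B :: "complex mat"
  assumes c: "A \<in> carrier_mat n m" "B \<in> carrier_mat n m" and e: "\<And>v. v \<in> carrier_mat m 1 \<Longrightarrow> A * v = B * v"
  shows "A = B"
proof -
  note [simp] = c[unfolded carrier_mat_iff]
  have "A - B = 0\<^sub>m n m"
  proof (rule mat_eq_zeroI)
    fix v :: "complex mat" assume v: "v \<in> carrier_mat m 1"
    then have "(A - B) * v = B * v - B * v" by (simp add: mmult_minus_left e)
    then show "(A - B) * v = 0\<^sub>m n 1" using v by (simp add: add_zero_mat)
  qed (simp add: carrier_mat_iff)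
  then have "(A - B) $$ (i, j) = (0\<^sub>m n m :: complex mat) $$ (i, j)" for i j by simp
  then have "A $$ (i, j) = B $$ (i, j)" if "i < n" "j < m" for i j
    using that by (metis index_minus_mat(1) index_zero_mat(1) c carrier_matD right_minus_eq)
  then show ?thesis by (intro eq_matI) auto
qed

text \<open>\<open>subspace_basis\<close> provides an orthonormal basis of the span, so the choice
  in \<open>V_T\<close> is satisfiable. The last claim holds because the \<open>T\<^sub>i\<close>
  are hermitian: their common kernel is orthogonal to all their ranges.\<close>

lemma V_T_props:
  fixes \<rho> :: "('h, 'g) realization"
  assumes \<rho>: "sym_realization \<rho>"
  shows "V_T \<rho> \<in> carrier_mat (rl_dim \<rho>) (dim_col (V_T \<rho>))" (is ?A)
    "adj (V_T \<rho>) * V_T \<rho> = 1\<^sub>m (dim_col (V_T \<rho>))" (is ?B)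
    "V_T \<rho> * (adj (V_T \<rho>) * rl_T \<rho> i) = rl_T \<rho> i" (is ?C)
    "\<lbrakk>u \<in> carrier_mat (rl_dim \<rho>) 1; \<And>i. rl_T \<rho> i * u = 0\<^sub>m (rl_dim \<rho>) 1\<rbrakk> \<Longrightarrow> adj (V_T \<rho>) * u = 0\<^sub>m (dim_col (V_T \<rho>)) 1"
proof -
  let ?e = "rl_dim \<rho>"
  interpret vec_space "TYPE(complex)" ?e .
  define R where "R = (\<Union>i. mat_range (rl_T \<rho> i))"
  have T: "rl_T \<rho> i \<in> carrier_mat ?e ?e" "adj (rl_T \<rho> i) = rl_T \<rho> i" for i
    using \<rho> by (auto simp: sym_realization_def hermitian_mat_def)
  note [simp] = T(1)[unfolded carrier_mat_iff]
  have R: "R \<subseteq> carrier_vec ?e"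
  proof
    fix x assume "x \<in> R"
    then obtain i v where "v \<in> carrier_vec ?e" "x = rl_T \<rho> i *\<^sub>v v" by (auto simp: R_def mat_range_def)
    then show "x \<in> carrier_vec ?e" using T(1)[of i] by auto
  qed
  have sub: "submodule class_ring (span R) V" by (rule span_is_submodule[OF R])
  have spc: "span R \<subseteq> carrier_vec ?e" using span_closed[OF R] by blast
  \<comment> \<open>The span, a set of vectors, carried over to columns so that
    \<open>subspace_basis\<close> applies.\<close>
  define S where "S = {M \<in> carrier_mat ?e 1. col M 0 \<in> span R}"
  have "col_subspace ?e S"
    unfolding col_subspace_def
  proof (intro conjI ballI allI)
    show "S \<subseteq> carrier_mat ?e 1" by (auto simp: S_def)
    have "col (0\<^sub>m ?e 1 :: complex mat) 0 = 0\<^sub>v ?e" by auto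
    then show "0\<^sub>m ?e 1 \<in> S" using submodule.zero_closed[OF sub] by (simp add: S_def)
    fix v assume v: "v \<in> S"
    show "v + w \<in> S" if w: "w \<in> S" for w
    proof -
      have "col (v + w) 0 = col v 0 + col w 0" using v w by (auto simp: S_def)
      then show ?thesis using v w submodule.m_closed[OF sub, of "col v 0" "col w 0"] by (simp add: S_def)
    qed
    show "k \<cdot>\<^sub>m v \<in> S" for k
    proof -
      have "col (k \<cdot>\<^sub>m v) 0 = k \<cdot>\<^sub>v col v 0" using v by (auto simp: S_def)
      then show ?thesis using v submodule.smult_closed[OF sub, of k "col v 0"] by (simp add: S_def)
    qed
  qed
  then obtain W d where W: "W \<in> carrier_mat ?e d" "adj W * W = 1\<^sub>m d" "\<And>v. v \<in> carrier_mat d 1 \<Longrightarrow> W * v \<in> S"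
    "\<And>w. w \<in> S \<Longrightarrow> W * (adj W * w) = w" using subspace_basis by metis
  note [simp] = carrier_matD[OF W(1)]
  have "mat_range W = span R"
  proof (intro equalityI subsetI)
    fix x assume "x \<in> mat_range W"
    then obtain v where v: "v \<in> carrier_vec d" "x = W *\<^sub>v v" by (auto simp: mat_range_def)
    have "W * mat_of_cols d [v] \<in> S" by (rule W(3)[OF mat_of_cols_single])
    then have "mat_of_cols ?e [x] \<in> S" using mat_of_cols_mult_vec[OF W(1) v(1)] v by simp
    moreover have "x \<in> carrier_vec ?e" using v W(1) by auto
    ultimately show "x \<in> span R" by (simp add: S_def)
  next
    fix x assume x: "x \<in> span R"
    then have xc: "x \<in> carrier_vec ?e" using spc by blast
    then have "mat_of_cols ?e [x] \<in> S" using x by (simp add: S_def)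
    then have "W * (adj W * mat_of_cols ?e [x]) = mat_of_cols ?e [x]" by (rule W(4))
    moreover have "adj W * mat_of_cols ?e [x] = mat_of_cols d [adj W *\<^sub>v x]"
      using mat_of_cols_mult_vec[OF adj_carrier[OF W(1)] xc] by simp
    moreover have wx: "adj W *\<^sub>v x \<in> carrier_vec d"
      by (rule mult_mat_vec_carrier[OF adj_carrier[OF W(1)] xc])
    ultimately have "mat_of_cols ?e [W *\<^sub>v (adj W *\<^sub>v x)] = mat_of_cols ?e [x]"
      using mat_of_cols_mult_vec[OF W(1) wx] by simp
    then have "col (mat_of_cols ?e [W *\<^sub>v (adj W *\<^sub>v x)]) 0 = col (mat_of_cols ?e [x]) 0" by simp
    moreover have "W *\<^sub>v (adj W *\<^sub>v x) \<in> carrier_vec ?e" by (rule mult_mat_vec_carrier[OF W(1) wx])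
    ultimately have "W *\<^sub>v (adj W *\<^sub>v x) = x" using xc by simp
    then show "x \<in> mat_range W" using wx unfolding mat_range_def mem_Collect_eq
      by (intro exI[of _ "adj W *\<^sub>v x"] conjI) simp_all
  qed
  then have "\<exists>V. V \<in> carrier_mat ?e (dim_col V) \<and> adj V * V = 1\<^sub>m (dim_col V) \<and> mat_range V = span R"
    using W by (intro exI[of _ W]) simp
  from someI_ex[OF this] have V: "V_T \<rho> \<in> carrier_mat ?e (dim_col (V_T \<rho>))" 
    "adj (V_T \<rho>) * V_T \<rho> = 1\<^sub>m (dim_col (V_T \<rho>))" "mat_range (V_T \<rho>) = span R"
    unfolding V_T_def R_def by auto
  show ?A by (rule V(1))
  show ?B by (rule V(2))
  note [simp] = carrier_matD(1)[OF V(1)]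
  show ?C
  proof (rule mat_eq_vecI)
    fix v :: "complex mat" assume v: "v \<in> carrier_mat ?e 1"
    note [simp] = carrier_matD[OF v]
    have "rl_T \<rho> i *\<^sub>v col v 0 \<in> R" unfolding R_def mat_range_def
    proof (rule UN_I[of i])
      show "rl_T \<rho> i *\<^sub>v col v 0 \<in> {rl_T \<rho> i *\<^sub>v w |w. w \<in> carrier_vec (dim_col (rl_T \<rho> i))}"
        unfolding mem_Collect_eq by (intro exI[of _ "col v 0"] conjI refl carrier_vecI) simp
    qed simp
    then have "rl_T \<rho> i *\<^sub>v col v 0 \<in> mat_range (V_T \<rho>)" using V(3) in_own_span[OF R] by blast
    then obtain y where y: "y \<in> carrier_vec (dim_col (V_T \<rho>))" "rl_T \<rho> i *\<^sub>v col v 0 = V_T \<rho> *\<^sub>v y"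
      by (auto simp: mat_range_def)
    have vc: "col v 0 \<in> carrier_vec ?e" by (rule carrier_vecI) simp
    have "rl_T \<rho> i * v = mat_of_cols ?e [rl_T \<rho> i *\<^sub>v col v 0]"
      using mat_of_cols_mult_vec[OF T(1)[of i] vc] mat_of_cols_col[OF v] by simp
    also have "\<dots> = V_T \<rho> * mat_of_cols (dim_col (V_T \<rho>)) [y]"
      unfolding y(2) by (rule mat_of_cols_mult_vec[OF V(1) y(1)])
    finally have e: "rl_T \<rho> i * v = V_T \<rho> * mat_of_cols (dim_col (V_T \<rho>)) [y]" .
    show "V_T \<rho> * (adj (V_T \<rho>) * rl_T \<rho> i) * v = rl_T \<rho> i * v"
      by (simp add: mmult_assoc e mult_eq_assoc[OF V(2)] mat_algebra mat_of_cols_def)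
  qed (auto simp: carrier_mat_iff)
  assume u: "u \<in> carrier_mat ?e 1" "\<And>i. rl_T \<rho> i * u = 0\<^sub>m ?e 1"
  note [simp] = carrier_matD[OF u(1)]
  \<comment> \<open>The orthogonal complement of \<open>u\<close>, as a set of vectors. It is a
    submodule that contains the ranges of the \<open>T\<^sub>i\<close>, hence it contains their
    span.\<close>
  define N where "N = {w \<in> carrier_vec ?e. adj u * mat_of_cols ?e [w] = 0\<^sub>m 1 1}"
  have N1: "mat_of_cols ?e [v + w] = mat_of_cols ?e [v] + mat_of_cols ?e [w]" if "v \<in> carrier_vec ?e" "w \<in> carrier_vec ?e" for v w :: "complex vec"
    using that by (intro eq_matI) (auto simp: mat_of_cols_index mat_of_cols_def)
  have N2: "mat_of_cols ?e [k \<cdot>\<^sub>v v] = k \<cdot>\<^sub>m mat_of_cols ?e [v]" if "v \<in> carrier_vec ?e" for v :: "complex vec" and k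
    using that by (intro eq_matI) (auto simp: mat_of_cols_index mat_of_cols_def)
  have N3: "mat_of_cols ?e [0\<^sub>v ?e] = (0\<^sub>m ?e 1 :: complex mat)"
    by (intro eq_matI) (auto simp: mat_of_cols_index mat_of_cols_def)
  have [simp]: "dim_row (mat_of_cols ?e [w]) = ?e" "dim_col (mat_of_cols ?e [w]) = 1" for w :: "complex vec"
    by (simp_all add: mat_of_cols_def)
  have "submodule class_ring N V"
  proof (unfold_locales)
    show "N \<subseteq> carrier V" by (auto simp: N_def)
    show "v \<oplus>\<^bsub>V\<^esub> w \<in> N" if "v \<in> N" "w \<in> N" for v w
      using that by (auto simp: N_def N1 mat_algebra add_zero_mat)
    show "\<zero>\<^bsub>V\<^esub> \<in> N" by (simp add: N_def N3 mat_algebra)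
    show "k \<odot>\<^bsub>V\<^esub> v \<in> N" if "k \<in> carrier class_ring" "v \<in> N" for k v
      using that by (auto simp: N_def N2 mat_algebra)
  qed
  moreover have "R \<subseteq> N"
  proof
    fix x assume "x \<in> R"
    then obtain i v where v: "v \<in> carrier_vec ?e" "x = rl_T \<rho> i *\<^sub>v v" by (auto simp: R_def mat_range_def)
    have uT: "adj u * rl_T \<rho> i = 0\<^sub>m 1 ?e" using arg_cong[OF u(2)[of i], of adj] by (simp add: mat_algebra T)
    have "x \<in> carrier_vec ?e" using v T(1)[of i] by auto
    then show "x \<in> N" using v mat_of_cols_mult_vec[OF T(1)[of i] v(1)]
      by (simp add: N_def mult_eq_assoc[OF uT] mat_algebra)
  qed
  ultimately have RN: "mat_range (V_T \<rho>) \<subseteq> N" unfolding V(3) by (intro span_is_subset)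
  have "adj u * V_T \<rho> = 0\<^sub>m 1 (dim_col (V_T \<rho>))"
  proof (rule mat_eq_zeroI)
    fix x :: "complex mat" assume x: "x \<in> carrier_mat (dim_col (V_T \<rho>)) 1"
    note [simp] = carrier_matD[OF x]
    have xc: "col x 0 \<in> carrier_vec (dim_col (V_T \<rho>))" by (rule carrier_vecI) simp
    then have "V_T \<rho> *\<^sub>v col x 0 \<in> N" using RN by (auto simp: mat_range_def)
    then have "adj u * mat_of_cols ?e [V_T \<rho> *\<^sub>v col x 0] = 0\<^sub>m 1 1" by (simp add: N_def)
    then show "adj u * V_T \<rho> * x = 0\<^sub>m 1 1"
      unfolding mat_of_cols_mult_vec[OF V(1) xc] mat_of_cols_col[OF x] by (simp add: mmult_assoc)
  qed (rule mult_carrier_mat[OF adj_carrier[OF u(1)] V(1)])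
  then have "adj (adj u * V_T \<rho>) = 0\<^sub>m (dim_col (V_T \<rho>)) 1" by (simp only: adj_zero)
  then show "adj (V_T \<rho>) * u = 0\<^sub>m (dim_col (V_T \<rho>)) 1" by (subst (asm) adj_mult) simp_all
qed

section \<open>Direct sums and unitary conjugation\<close>

lemma join_herm:
  assumes "p \<in> herm_pairs n"
  shows "join p i \<in> carrier_mat n n" "adj (join p i) = join p i"
  using assms by (auto simp: herm_pairs_def herm_tuples_def hermitian_mat_def join_def split: sum.splits)

lemma herm_pairsI:
  assumes "\<And>i. join p i \<in> carrier_mat n n" "\<And>i. adj (join p i) = join p i"
  shows "p \<in> herm_pairs n"
proof -
  have "hermitian_mat n (snd p i)" for i using assms[of "Inl i"] by (simp add: join_def hermitian_mat_def)
  moreover have "hermitian_mat n (fst p i)" for i using assms[of "Inr i"] by (simp add: join_def hermitian_mat_def)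
  ultimately show ?thesis by (cases p) (simp add: herm_pairs_def herm_tuples_def)
qed

text \<open>The index type is nonempty, so the dimension of any one component fixes the size. Hence
  the unions over \<open>n\<close> in \<open>rl_dom\<close> and \<open>rl_dom_plus\<close> do not
  mix sizes.\<close>

lemma herm_pairs_size: "p \<in> herm_pairs n \<Longrightarrow> p \<in> herm_pairs m \<Longrightarrow> n = m"
  using join_herm(1)[of p n undefined] join_herm(1)[of p m undefined] by auto

lemma pencil_hermitian:
  assumes \<rho>: "sym_realization \<rho>" and p: "p \<in> herm_pairs n"
  shows "adj (pencil \<rho> n p) = pencil \<rho> n p"
proof -
  note r = rl_carriers[OF \<rho>] and j = join_herm[OF p]
  have [simp]: "dim_row (rl_J \<rho>) = rl_dim \<rho>" "dim_col (rl_J \<rho>) = rl_dim \<rho>" using r(1) by auto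
  have "adj (rl_lin \<rho> n n (join p)) = rl_lin \<rho> n n (join p)"
    by (subst adj_lin[OF r(4) j(1)]) (simp add: r(5) j(2))
  then show ?thesis unfolding pencil_lin[OF \<rho> j(1)] by (simp add: adj_minus adj_kron r(2))
qed

lemma resolvent_eqI:
  assumes "sym_realization \<rho>" "\<And>i. join p i \<in> carrier_mat n n"
    "B \<in> carrier_mat (rl_dim \<rho> * n) (rl_dim \<rho> * n)" "pencil \<rho> n p * B = 1\<^sub>m (rl_dim \<rho> * n)"
  shows "det (pencil \<rho> n p) \<noteq> 0" "resolvent \<rho> n p = B"
  using inverse_det_nonzero[OF pencil_carrier[OF assms(1,2)] assms(3,4)]
    mat_inverse_eqI[OF pencil_carrier[OF assms(1,2)] assms(3,4)] by (simp_all add: resolvent_def)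

definition pair_dsum :: "('h, 'g) pair \<Rightarrow> ('h, 'g) pair \<Rightarrow> ('h, 'g) pair" where
  "pair_dsum p q = (tuple_dsum (fst p) (fst q), tuple_dsum (snd p) (snd q))"

lemma join_dsum:
  assumes "join p i \<in> carrier_mat n n" "join q i \<in> carrier_mat m m"
  shows "join (pair_dsum p q) i = inl_mat n m * (join p i * adj (inl_mat n m)) + inr_mat n m * (join q i * adj (inr_mat n m))"
  by (subst diag_block_inlr[OF assms, symmetric]) (cases i, simp_all add: join_def pair_dsum_def tuple_dsum_def)

lemma herm_pairs_dsum:
  assumes p: "p \<in> herm_pairs n" and q: "q \<in> herm_pairs m"
  shows "pair_dsum p q \<in> herm_pairs (n + m)"
proof (rule herm_pairsI)
  fix i
  note j = join_herm[OF p, of i] join_herm[OF q, of i]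
  note [simp] = j(1,3)[unfolded carrier_mat_iff]
  note e = join_dsum[OF j(1,3)]
  show "join (pair_dsum p q) i \<in> carrier_mat (n + m) (n + m)" by (simp add: e carrier_mat_iff)
  show "adj (join (pair_dsum p q) i) = join (pair_dsum p q) i" by (simp add: e mat_algebra j)
qed

text \<open>The coefficient space is the left Kronecker factor, so operators on the matrix side act
  as \<open>1 \<otimes> U\<close>.\<close>

definition ampl :: "nat \<Rightarrow> complex mat \<Rightarrow> complex mat" where
  "ampl e U = kron (1\<^sub>m e) U"

lemma dim_ampl [simp]: "dim_row (ampl e U) = e * dim_row U" "dim_col (ampl e U) = e * dim_col U"
  by (simp_all add: ampl_def)

lemma ampl_mult: "dim_col A = dim_row B \<Longrightarrow> ampl e A * ampl e B = ampl e (A * B)"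
  by (simp add: ampl_def kron_mult mat_algebra)

lemma adj_ampl: "adj (ampl e A) = ampl e (adj A)"
  by (simp add: ampl_def adj_kron)

lemma ampl_zero [simp]: "ampl e (0\<^sub>m n m) = 0\<^sub>m (e * n) (e * m)"
  by (simp add: ampl_def kron_zero)

lemma ampl_one [simp]: "ampl e (1\<^sub>m n) = 1\<^sub>m (e * n)"
  by (simp add: ampl_def kron_one)

lemma ampl_add: "dim_row A = dim_row B \<Longrightarrow> dim_col A = dim_col B \<Longrightarrow> ampl e (A + B) = ampl e A + ampl e B"
  by (simp add: ampl_def kron_add_right)

text \<open>With the coefficients as left factor, the pencil at a direct sum is block diagonal only
  up to a permutation of the basis; the amplified isometries absorb this permutation.\<close>

lemma pencil_dsum:
  assumes \<rho>: "sym_realization \<rho>" and p: "\<And>i. join p i \<in> carrier_mat n n" and q: "\<And>i. join q i \<in> carrier_mat m m"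
  shows "pencil \<rho> (n + m) (pair_dsum p q) =
    ampl (rl_dim \<rho>) (inl_mat n m) * (pencil \<rho> n p * ampl (rl_dim \<rho>) (adj (inl_mat n m))) +
    ampl (rl_dim \<rho>) (inr_mat n m) * (pencil \<rho> m q * ampl (rl_dim \<rho>) (adj (inr_mat n m)))"
proof -
  let ?e = "rl_dim \<rho>" and ?E = "inl_mat n m" and ?F = "inr_mat n m"
  note r = rl_carriers[OF \<rho>]
  note [simp] = r(1,4)[unfolded carrier_mat_iff] p[unfolded carrier_mat_iff]
    q[unfolded carrier_mat_iff]
  have j: "join (pair_dsum p q) i \<in> carrier_mat (n + m) (n + m)" for i
    by (simp add: join_dsum[OF p q] carrier_mat_iff)
  have J: "kron (rl_J \<rho>) (1\<^sub>m (n + m)) = kron (rl_J \<rho>) (?E * adj ?E) + kron (rl_J \<rho>) (?F * adj ?F)"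
    unfolding inl_inr_sum[symmetric] by (rule kron_add_right) simp_all
  have "join (pair_dsum p q) = (\<lambda>i. ?E * (join p i * adj ?E) + ?F * (join q i * adj ?F))"
    using join_dsum[OF p q] by blast
  then have l: "rl_lin \<rho> (n + m) (n + m) (join (pair_dsum p q)) =
      rl_lin \<rho> (n + m) (n + m) (\<lambda>i. ?E * (join p i * adj ?E)) +
      rl_lin \<rho> (n + m) (n + m) (\<lambda>i. ?F * (join q i * adj ?F))"
    by (simp only:) (rule lin_add_right[OF r(4)], simp_all add: carrier_mat_iff)
  have P: "ampl ?e E * (pencil \<rho> k P * ampl ?e (adj E)) = kron (rl_J \<rho>) (E * adj E)
     - rl_lin \<rho> (n + m) (n + m) (\<lambda>i. E * (join P i * adj E))"
    if E: "E \<in> carrier_mat (n + m) k" and c: "\<And>i. join P i \<in> carrier_mat k k" for E P k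
  proof -
    note [simp] = carrier_matD[OF E] c[unfolded carrier_mat_iff]
    show ?thesis unfolding pencil_lin[OF \<rho> c] by (simp add: ampl_def mat_algebra kron_merge carrier_mat_iff)
  qed
  show ?thesis
    unfolding pencil_lin[OF \<rho> j] P[OF inlr_carrier(1) p] P[OF inlr_carrier(2) q] J l
    by (rule eq_matI) (simp_all)
qed

lemma resolvent_dsum:
  assumes \<rho>: "sym_realization \<rho>" and p: "\<And>i. join p i \<in> carrier_mat n n" and q: "\<And>i. join q i \<in> carrier_mat m m"
    and d: "det (pencil \<rho> n p) \<noteq> 0" "det (pencil \<rho> m q) \<noteq> 0"
  shows "det (pencil \<rho> (n + m) (pair_dsum p q)) \<noteq> 0"
   "resolvent \<rho> (n + m) (pair_dsum p q) =
    ampl (rl_dim \<rho>) (inl_mat n m) * (resolvent \<rho> n p * ampl (rl_dim \<rho>) (adj (inl_mat n m))) +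
    ampl (rl_dim \<rho>) (inr_mat n m) * (resolvent \<rho> m q * ampl (rl_dim \<rho>) (adj (inr_mat n m)))" (is "_ = ?B")
proof -
  let ?e = "rl_dim \<rho>" and ?E = "inl_mat n m" and ?F = "inr_mat n m"
  note P = resolvent_inverse[OF \<rho> p d(1)] and Q = resolvent_inverse[OF \<rho> q d(2)]
  note cp = pencil_carrier[OF \<rho> p] and cq = pencil_carrier[OF \<rho> q]
  note [simp] = P(1)[unfolded carrier_mat_iff] Q(1)[unfolded carrier_mat_iff]
    carrier_matD[OF cp] carrier_matD[OF cq]
  note [simp] = p[unfolded carrier_mat_iff]
    q[unfolded carrier_mat_iff]
  have j: "join (pair_dsum p q) i \<in> carrier_mat (n + m) (n + m)" for i
    by (simp add: join_dsum[OF p q] carrier_mat_iff)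
  have am: "ampl ?e A * (ampl ?e B * X) = ampl ?e (A * B) * X" if "dim_col A = dim_row B" "dim_row X = ?e * dim_col B" for A B X
    by (rule mult_eq_assoc[OF ampl_mult]) (use that in auto)
  have one: "ampl ?e (?E * adj ?E) + ampl ?e (?F * adj ?F) = 1\<^sub>m (?e * (n + m))"
    by (simp add: ampl_add[symmetric] inl_inr_sum)
  have "pencil \<rho> (n + m) (pair_dsum p q) * ?B = 1\<^sub>m (?e * (n + m))"
    unfolding pencil_dsum[OF \<rho> p q] one[symmetric]
    by (simp add: mat_algebra ampl_mult am inlr P(2)[THEN mult_eq_assoc] Q(2)[THEN mult_eq_assoc] add_zero_mat)
  moreover have "?B \<in> carrier_mat (?e * (n + m)) (?e * (n + m))" by (simp add: carrier_mat_iff)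
  ultimately show "det (pencil \<rho> (n + m) (pair_dsum p q)) \<noteq> 0" "resolvent \<rho> (n + m) (pair_dsum p q) = ?B"
    using resolvent_eqI[OF \<rho> j] by blast+
qed

definition pair_conj :: "complex mat \<Rightarrow> ('h, 'g) pair \<Rightarrow> ('h, 'g) pair" where
  "pair_conj U p = (tuple_conj U (fst p), tuple_conj U (snd p))"

lemma join_conj: "join (pair_conj U p) i = adj U * join p i * U"
  by (cases i) (simp_all add: join_def pair_conj_def tuple_conj_def)

lemma resolvent_conj:
  assumes \<rho>: "sym_realization \<rho>" and p: "\<And>i. join p i \<in> carrier_mat n n" and U: "unitary_mat n U"
    and d: "det (pencil \<rho> n p) \<noteq> 0"
  shows "det (pencil \<rho> n (pair_conj U p)) \<noteq> 0"
   "resolvent \<rho> n (pair_conj U p) = ampl (rl_dim \<rho>) (adj U) * (resolvent \<rho> n p * ampl (rl_dim \<rho>) U)" (is "_ = ?B")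
proof -
  let ?e = "rl_dim \<rho>"
  have Uc: "U \<in> carrier_mat n n" and UU: "adj U * U = 1\<^sub>m n" "U * adj U = 1\<^sub>m n" using U by (auto simp: unitary_mat_def)
  note r = rl_carriers[OF \<rho>] and P = resolvent_inverse[OF \<rho> p d] and cp = pencil_carrier[OF \<rho> p]
  note [simp] = P(1)[unfolded carrier_mat_iff] carrier_matD[OF cp] carrier_matD[OF Uc]
    r(1,4)[unfolded carrier_mat_iff] p[unfolded carrier_mat_iff]
  have j: "join (pair_conj U p) i \<in> carrier_mat n n" for i by (simp add: join_conj carrier_mat_iff)
  have am: "ampl ?e A * (ampl ?e B * X) = ampl ?e (A * B) * X" if "dim_col A = dim_row B" "dim_row X = ?e * dim_col B" for A B X
    by (rule mult_eq_assoc[OF ampl_mult]) (use that in auto)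
  have "join (pair_conj U p) = (\<lambda>i. adj U * (join p i * U))"
    by (rule ext) (simp add: join_conj mmult_assoc)
  then have "pencil \<rho> n (pair_conj U p) = ampl ?e (adj U) * (pencil \<rho> n p * ampl ?e U)"
    unfolding pencil_lin[OF \<rho> j] pencil_lin[OF \<rho> p] by (simp add: ampl_def mat_algebra kron_merge carrier_mat_iff UU)
  then have "pencil \<rho> n (pair_conj U p) * ?B = 1\<^sub>m (?e * n)"
    by (simp add: mat_algebra ampl_mult am UU P(2)[THEN mult_eq_assoc])
  moreover have "?B \<in> carrier_mat (?e * n) (?e * n)" by (simp add: carrier_mat_iff)
  ultimately show "det (pencil \<rho> n (pair_conj U p)) \<noteq> 0" "resolvent \<rho> n (pair_conj U p) = ?B"
    using resolvent_eqI[OF \<rho> j] by blast+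
qed

section \<open>The positive part of the domain\<close>

lemma rl_dom_iff:
  assumes p: "p \<in> herm_pairs n" and n: "1 \<le> n"
  shows "p \<in> rl_dom \<rho> \<longleftrightarrow> det (pencil \<rho> n p) \<noteq> 0"
proof
  assume "p \<in> rl_dom \<rho>"
  then obtain m where m: "p \<in> herm_pairs m" "det (pencil \<rho> m p) \<noteq> 0" by (auto simp: rl_dom_def)
  then show "det (pencil \<rho> n p) \<noteq> 0" using herm_pairs_size[OF m(1) p] by simp
next
  assume "det (pencil \<rho> n p) \<noteq> 0"
  then show "p \<in> rl_dom \<rho>" unfolding rl_dom_def using p n by (intro UN_I[of n]) simp_all
qed

lemma rl_dom_plus_cases:
  assumes "p \<in> rl_dom_plus \<rho>"
  obtains n where "1 \<le> n" "p \<in> herm_pairs n" "det (pencil \<rho> n p) \<noteq> 0" "psd_mat (dim_col (V_T \<rho>) * n) (R_T \<rho> n p)"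
proof -
  obtain n where n: "1 \<le> n" "p \<in> rl_dom \<rho>" "p \<in> herm_pairs n" "psd_mat (dim_col (V_T \<rho>) * n) (R_T \<rho> n p)"
    using assms by (auto simp: rl_dom_plus_def)
  then show thesis using that[OF n(1,3) _ n(4)] rl_dom_iff[OF n(3,1), of \<rho>] by simp
qed

lemma rl_dom_plus_iff:
  assumes p: "p \<in> herm_pairs n" and n: "1 \<le> n"
  shows "p \<in> rl_dom_plus \<rho> \<longleftrightarrow> det (pencil \<rho> n p) \<noteq> 0 \<and> psd_mat (dim_col (V_T \<rho>) * n) (R_T \<rho> n p)"
proof
  assume "p \<in> rl_dom_plus \<rho>"
  then obtain m where m: "p \<in> herm_pairs m" "det (pencil \<rho> m p) \<noteq> 0" "psd_mat (dim_col (V_T \<rho>) * m) (R_T \<rho> m p)"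
    by (rule rl_dom_plus_cases)
  then show "det (pencil \<rho> n p) \<noteq> 0 \<and> psd_mat (dim_col (V_T \<rho>) * n) (R_T \<rho> n p)"
    using herm_pairs_size[OF m(1) p] by simp
next
  assume "det (pencil \<rho> n p) \<noteq> 0 \<and> psd_mat (dim_col (V_T \<rho>) * n) (R_T \<rho> n p)"
  then show "p \<in> rl_dom_plus \<rho>"
    unfolding rl_dom_plus_def using p n rl_dom_iff[OF p n, of \<rho>] by (intro UN_I[of n]) simp_all
qed

lemma R_T_eq:
  assumes \<rho>: "sym_realization \<rho>" and p: "\<And>i. join p i \<in> carrier_mat n n" and d: "det (pencil \<rho> n p) \<noteq> 0"
  shows "R_T \<rho> n p = adj (kron (V_T \<rho>) (1\<^sub>m n)) * (resolvent \<rho> n p * kron (V_T \<rho>) (1\<^sub>m n))"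
  unfolding R_T_def compressed_resolvent_def
  using carrier_matD[OF V_T_props(1)[OF \<rho>]] carrier_matD[OF resolvent_inverse(1)[OF \<rho> p d]]
  by (simp add: mmult_assoc)

text \<open>Each summand is written as a congruence \<open>adj G * (R * G)\<close>, the shape in
  which \<open>psd_congruence\<close> and \<open>psd_add\<close> give positivity at a direct
  sum.\<close>

lemma R_T_dsum:
  assumes \<rho>: "sym_realization \<rho>" and p: "\<And>i. join p i \<in> carrier_mat n n" and q: "\<And>i. join q i \<in> carrier_mat m m"
    and d: "det (pencil \<rho> n p) \<noteq> 0" "det (pencil \<rho> m q) \<noteq> 0"
  defines "v \<equiv> dim_col (V_T \<rho>)"
  shows "R_T \<rho> (n + m) (pair_dsum p q) =
    adj (ampl v (adj (inl_mat n m))) * (R_T \<rho> n p * ampl v (adj (inl_mat n m))) +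
    adj (ampl v (adj (inr_mat n m))) * (R_T \<rho> m q * ampl v (adj (inr_mat n m)))"
proof -
  note P = resolvent_inverse[OF \<rho> p d(1)] and Q = resolvent_inverse[OF \<rho> q d(2)] and rd = resolvent_dsum[OF \<rho> p q d]
  note [simp] = P(1)[unfolded carrier_mat_iff] Q(1)[unfolded carrier_mat_iff]
    carrier_matD(1)[OF V_T_props(1)[OF \<rho>]] p[unfolded carrier_mat_iff]
    q[unfolded carrier_mat_iff]
  have [simp]: "dim_col (V_T \<rho>) = v" by (simp add: v_def)
  have j: "join (pair_dsum p q) i \<in> carrier_mat (n + m) (n + m)" for i
    by (simp add: join_dsum[OF p q] carrier_mat_iff)
  show ?thesis
    unfolding R_T_eq[OF \<rho> j rd(1)] R_T_eq[OF \<rho> p d(1)] R_T_eq[OF \<rho> q d(2)] rd(2)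
    by (simp add: mat_algebra ampl_def adj_kron kron_merge)
qed

lemma R_T_conj:
  assumes \<rho>: "sym_realization \<rho>" and p: "\<And>i. join p i \<in> carrier_mat n n" and U: "unitary_mat n U"
    and d: "det (pencil \<rho> n p) \<noteq> 0"
  defines "v \<equiv> dim_col (V_T \<rho>)"
  shows "R_T \<rho> n (pair_conj U p) = adj (ampl v U) * (R_T \<rho> n p * ampl v U)"
proof -
  note P = resolvent_inverse[OF \<rho> p d] and rd = resolvent_conj[OF \<rho> p U d]
  have Uc: "U \<in> carrier_mat n n" using U by (auto simp: unitary_mat_def)
  note [simp] = P(1)[unfolded carrier_mat_iff] carrier_matD[OF Uc]
    carrier_matD(1)[OF V_T_props(1)[OF \<rho>]] p[unfolded carrier_mat_iff]
  have [simp]: "dim_col (V_T \<rho>) = v" by (simp add: v_def)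
  have j: "join (pair_conj U p) i \<in> carrier_mat n n" for i by (simp add: join_conj carrier_mat_iff)
  show ?thesis
    unfolding R_T_eq[OF \<rho> j rd(1)] R_T_eq[OF \<rho> p d] rd(2)
    by (simp add: mat_algebra ampl_def adj_kron kron_merge)
qed

lemma free_set_rl_dom_plus:
  fixes \<rho> :: "('h::finite, 'g::finite) realization"
  assumes \<rho>: "sym_realization \<rho>"
  shows "free_set (rl_dom_plus \<rho>)"
  unfolding free_set_def
proof (intro conjI allI impI)
  show "rl_dom_plus \<rho> \<subseteq> all_herm_pairs" by (auto simp: rl_dom_plus_def all_herm_pairs_def)
next
  fix A B :: "'h tuple" and X Y :: "'g tuple"
  assume 1: "(A, X) \<in> rl_dom_plus \<rho>" and 2: "(B, Y) \<in> rl_dom_plus \<rho>"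
  obtain n where n: "1 \<le> n" "(A, X) \<in> herm_pairs n" "det (pencil \<rho> n (A, X)) \<noteq> 0" "psd_mat (dim_col (V_T \<rho>) * n) (R_T \<rho> n (A, X))"
    by (rule rl_dom_plus_cases[OF 1])
  obtain m where m: "1 \<le> m" "(B, Y) \<in> herm_pairs m" "det (pencil \<rho> m (B, Y)) \<noteq> 0" "psd_mat (dim_col (V_T \<rho>) * m) (R_T \<rho> m (B, Y))"
    by (rule rl_dom_plus_cases[OF 2])
  note j = join_herm(1)[OF n(2)] join_herm(1)[OF m(2)]
  define v where "v = dim_col (V_T \<rho>)"
  note psd = n(4)[folded v_def] m(4)[folded v_def]
  have "psd_mat (v * (n + m)) (adj (ampl v (adj (inl_mat n m))) * (R_T \<rho> n (A, X) * ampl v (adj (inl_mat n m))))"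
    by (rule psd_congruence[OF psd(1)]) (simp add: carrier_mat_iff)
  moreover have "psd_mat (v * (n + m)) (adj (ampl v (adj (inr_mat n m))) * (R_T \<rho> m (B, Y) * ampl v (adj (inr_mat n m))))"
    by (rule psd_congruence[OF psd(2)]) (simp add: carrier_mat_iff)
  ultimately have "psd_mat (v * (n + m)) (R_T \<rho> (n + m) (pair_dsum (A, X) (B, Y)))"
    unfolding v_def by (subst R_T_dsum[OF \<rho> j n(3) m(3)]) (rule psd_add)
  moreover have "1 \<le> n + m" using n(1) by simp
  ultimately have "pair_dsum (A, X) (B, Y) \<in> rl_dom_plus \<rho>"
    using rl_dom_plus_iff[OF herm_pairs_dsum[OF n(2) m(2)]] resolvent_dsum(1)[OF \<rho> j n(3) m(3)] by (simp add: v_def)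
  then show "(tuple_dsum A B, tuple_dsum X Y) \<in> rl_dom_plus \<rho>" by (simp add: pair_dsum_def)
next
  fix n :: nat and A :: "'h tuple" and X :: "'g tuple" and U
  assume n: "1 \<le> n" and p: "(A, X) \<in> rl_dom_plus \<rho> \<inter> herm_pairs n" and U: "unitary_mat n U"
  then have h: "(A, X) \<in> herm_pairs n" and d: "det (pencil \<rho> n (A, X)) \<noteq> 0" "psd_mat (dim_col (V_T \<rho>) * n) (R_T \<rho> n (A, X))"
    using rl_dom_plus_iff[of "(A, X)" n \<rho>] by auto
  have Uc: "U \<in> carrier_mat n n" using U by (auto simp: unitary_mat_def)
  note j = join_herm[OF h]
  note [simp] = carrier_matD[OF Uc] j(1)[unfolded carrier_mat_iff]
  have h': "pair_conj U (A, X) \<in> herm_pairs n"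
    by (rule herm_pairsI) (simp_all add: join_conj carrier_mat_iff mat_algebra j(2))
  define v where "v = dim_col (V_T \<rho>)"
  have "ampl v U \<in> carrier_mat (v * n) (v * n)" using Uc by (simp add: ampl_def)
  from psd_congruence[OF d(2)[folded v_def] this]
  have "psd_mat (v * n) (R_T \<rho> n (pair_conj U (A, X)))"
    unfolding R_T_conj[OF \<rho> j(1) U d(1), folded v_def] .
  with resolvent_conj(1)[OF \<rho> j(1) U d(1)] have "pair_conj U (A, X) \<in> rl_dom_plus \<rho>"
    unfolding rl_dom_plus_iff[OF h' n] v_def by blast
  then show "(tuple_conj U A, tuple_conj U X) \<in> rl_dom_plus \<rho>" by (simp add: pair_conj_def)
qed

section \<open>Change of the pencil within a fibre\<close>

text \<open>The matrix \<open>H\<close> of a perturbation \<open>V H V\<^sup>*\<close>. The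
  difference is new point minus old point, so that the pencil at the old point is the pencil at the
  new one plus \<open>V H V\<^sup>*\<close>. The terms of the variables a vanish when both points
  share \<open>A\<close>.\<close>

definition xdiff :: "('h::finite, 'g::finite) realization \<Rightarrow> nat \<Rightarrow> ('h, 'g) pair \<Rightarrow> ('h, 'g) pair \<Rightarrow> complex mat" where
  "xdiff \<rho> n p q = lin (dim_col (V_T \<rho>) * n) (dim_col (V_T \<rho>) * n)
     (\<lambda>i. adj (V_T \<rho>) * (coeffs \<rho> i * V_T \<rho>)) (\<lambda>i. join q i - join p i)"

lemma xdiff_hermitian:
  assumes \<rho>: "sym_realization \<rho>" and p: "p \<in> herm_pairs n" and q: "q \<in> herm_pairs n"
  shows "hermitian_mat (dim_col (V_T \<rho>) * n) (xdiff \<rho> n p q)"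
proof -
  note r = rl_carriers[OF \<rho>] and j = join_herm[OF p] join_herm[OF q]
  define v where "v = dim_col (V_T \<rho>)"
  have [simp]: "dim_col (V_T \<rho>) = v" by (simp add: v_def)
  note [simp] = carrier_matD(1)[OF V_T_props(1)[OF \<rho>]] r(4)[unfolded carrier_mat_iff]
    j(1,3)[unfolded carrier_mat_iff]
  have "adj (xdiff \<rho> n p q) = xdiff \<rho> n p q"
    unfolding xdiff_def by (subst adj_lin) (simp_all add: carrier_mat_iff mat_algebra r(5) j(2,4))
  then show ?thesis by (simp add: hermitian_mat_def xdiff_def)
qed

text \<open>\<open>V V\<^sup>*\<close> fixes every \<open>T\<^sub>i\<close> from the left and, these
  being hermitian, from the right, so it can be inserted on both sides of each coefficient that
  contributes.\<close>

lemma pencil_xdiff: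
  assumes \<rho>: "sym_realization \<rho>" and p: "(A, X) \<in> herm_pairs n" and q: "(A, Y) \<in> herm_pairs n"
  shows "pencil \<rho> n (A, X) = pencil \<rho> n (A, Y) +
     kron (V_T \<rho>) (1\<^sub>m n) * (xdiff \<rho> n (A, X) (A, Y) * adj (kron (V_T \<rho>) (1\<^sub>m n)))"
proof -
  note r = rl_carriers[OF \<rho>] and j = join_herm[OF p] join_herm[OF q] and V = V_T_props(1-3)[OF \<rho>]
  define v where "v = dim_col (V_T \<rho>)"
  have [simp]: "dim_col (V_T \<rho>) = v" by (simp add: v_def)
  let ?N = "rl_dim \<rho> * n"
  note [simp] = carrier_matD(1)[OF V_T_props(1)[OF \<rho>]] r(1,4)[unfolded carrier_mat_iff]
    j(1,3)[unfolded carrier_mat_iff]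
  define q where "q i = join (A, Y) i - join (A, X) i" for i
  have qc: "q i \<in> carrier_mat n n" for i by (simp add: q_def carrier_mat_iff)
  have s: "pencil \<rho> n (A, X) = pencil \<rho> n (A, Y) - (- 1) \<cdot>\<^sub>m lin ?N ?N (coeffs \<rho>) q"
    by (rule pencil_shift[OF \<rho> j(3) qc]) (rule eq_matI, auto simp: q_def)
  have k: "kron (V_T \<rho> * (adj (V_T \<rho>) * (coeffs \<rho> i * (V_T \<rho> * adj (V_T \<rho>))))) (q i) = kron (coeffs \<rho> i) (q i)" for i
  proof (cases i)
    case (Inl l)
    have T: "coeffs \<rho> i = rl_T \<rho> l" by (simp add: Inl coeffs_def)
    have 1: "V_T \<rho> * (adj (V_T \<rho>) * coeffs \<rho> i) = coeffs \<rho> i" unfolding T by (rule V(3))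
    have 2: "coeffs \<rho> i * (V_T \<rho> * adj (V_T \<rho>)) = coeffs \<rho> i" using arg_cong[OF 1, of adj] by (simp add: mat_algebra r(5))
    show ?thesis unfolding 2 1 ..
  next
    case (Inr l)
    have "A l \<in> carrier_mat n n" using j(1)[of "Inr l"] by (simp add: join_def)
    then have "q i = 0\<^sub>m n n" by (auto simp: q_def Inr join_def)
    then show ?thesis by (simp add: kron_zero)
  qed
  have "kron (V_T \<rho>) (1\<^sub>m n) * (xdiff \<rho> n (A, X) (A, Y) * adj (kron (V_T \<rho>) (1\<^sub>m n))) =
     lin ?N ?N (\<lambda>i. V_T \<rho> * (adj (V_T \<rho>) * (coeffs \<rho> i * (V_T \<rho> * adj (V_T \<rho>))))) q"
    unfolding xdiff_def q_def[symmetric] by (simp add: adj_kron kron_merge mat_algebra carrier_mat_iff qc qc[unfolded carrier_mat_iff])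
  also have "\<dots> = lin ?N ?N (coeffs \<rho>) q" unfolding lin_def k ..
  finally show ?thesis unfolding s
    using carrier_matD[OF pencil_carrier[OF \<rho> j(3)]] by (intro eq_matI) auto
qed

text \<open>\<open>H\<close> is linear in the difference of the points, with coefficients that
  depend on the realization only, so one \<open>\<epsilon>\<close> serves all base points of size
  \<open>n\<close>.\<close>

lemma xdiff_small:
  fixes \<rho> :: "('h::finite, 'g::finite) realization"
  assumes \<rho>: "sym_realization \<rho>" and \<delta>: "0 < \<delta>"
  obtains \<epsilon> where "0 < \<epsilon>" "\<And>A X Y i j. (A, X) \<in> herm_pairs n \<Longrightarrow> (A, Y) \<in> herm_pairs n \<Longrightarrow> tuple_close \<epsilon> n X Y \<Longrightarrow>
    i < dim_col (V_T \<rho>) * n \<Longrightarrow> j < dim_col (V_T \<rho>) * n \<Longrightarrow> cmod (xdiff \<rho> n (A, X) (A, Y) $$ (i, j)) \<le> \<delta>"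
proof -
  note r = rl_carriers[OF \<rho>]
  define v where "v = dim_col (V_T \<rho>)"
  have [simp]: "dim_col (V_T \<rho>) = v" by (simp add: v_def)
  note [simp] = carrier_matD(1)[OF V_T_props(1)[OF \<rho>]] r(1,4)[unfolded carrier_mat_iff]
  define \<tau> where "\<tau> k = adj (V_T \<rho>) * (coeffs \<rho> k * V_T \<rho>)" for k
  have [simp]: "dim_row (\<tau> k) = v" "dim_col (\<tau> k) = v" for k by (simp_all add: \<tau>_def)
  define C where "C = (\<Sum>k\<in>UNIV. \<Sum>a<v. \<Sum>b<v. cmod (\<tau> k $$ (a, b)))"
  have C0: "0 \<le> C" by (simp add: C_def sum_nonneg)
  \<comment> \<open>\<open>C\<close> adds up the moduli of all entries of all compressed
    coefficients and so bounds the total weight in any entry of \<open>H\<close>;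
    \<open>C + 1\<close> avoids a division by zero.\<close>
  define \<epsilon> where "\<epsilon> = \<delta> / (C + 1)"
  have \<epsilon>: "0 < \<epsilon>" using \<delta> C0 by (simp add: \<epsilon>_def)
  show ?thesis
  proof (rule that[OF \<epsilon>])
    fix A :: "'h tuple" and X Y :: "'g tuple" and i j :: nat
    assume p: "(A, X) \<in> herm_pairs n" and q: "(A, Y) \<in> herm_pairs n" and close: "tuple_close \<epsilon> n X Y"
      and "i < dim_col (V_T \<rho>) * n" "j < dim_col (V_T \<rho>) * n"
    then have ij: "i < v * n" "j < v * n" by auto
    note ij' = div_mod_less[OF ij(1)] div_mod_less[OF ij(2)]
    note jc = join_herm(1)[OF p] join_herm(1)[OF q]
    note [simp] = jc[unfolded carrier_mat_iff]
    have q: "cmod ((join (A, Y) k - join (A, X) k) $$ (a, b)) \<le> \<epsilon>" if ab: "a < n" "b < n" for k a b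
    proof (cases k)
      case (Inl l)
      have "cmod (X l $$ (a, b) - Y l $$ (a, b)) < \<epsilon>" using close ab by (auto simp: tuple_close_def)
      moreover have "(join (A, Y) k - join (A, X) k) $$ (a, b) = Y l $$ (a, b) - X l $$ (a, b)"
        using ab by (subst index_minus_mat) (simp_all, simp add: Inl join_def)
      ultimately show ?thesis by (simp add: norm_minus_commute)
    next
      case (Inr l)
      have "(join (A, Y) k - join (A, X) k) $$ (a, b) = 0"
        using ab by (subst index_minus_mat) (simp_all, simp add: Inr join_def)
      then show ?thesis using \<epsilon> by simp
    qed
    have "xdiff \<rho> n (A, X) (A, Y) $$ (i, j) =
       (\<Sum>k\<in>UNIV. \<tau> k $$ (i div n, j div n) * (join (A, Y) k - join (A, X) k) $$ (i mod n, j mod n))"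
      using ij by (simp add: xdiff_def lin_def index_mat_sum \<tau>_def[symmetric] index_kron del: index_minus_mat)
    also have "cmod \<dots> \<le> (\<Sum>k\<in>UNIV. cmod (\<tau> k $$ (i div n, j div n)) * \<epsilon>)"
      using q ij' by (intro order_trans[OF norm_sum] sum_mono) (auto simp: norm_mult intro!: mult_left_mono simp del: index_minus_mat)
    also have "\<dots> \<le> (\<Sum>k\<in>UNIV. (\<Sum>a<v. \<Sum>b<v. cmod (\<tau> k $$ (a, b))) * \<epsilon>)"
    proof (intro sum_mono mult_right_mono)
      fix k
      have "cmod (\<tau> k $$ (i div n, j div n)) \<le> (\<Sum>b<v. cmod (\<tau> k $$ (i div n, b)))"
        using ij' by (intro member_le_sum) auto
      also have "\<dots> \<le> (\<Sum>a<v. \<Sum>b<v. cmod (\<tau> k $$ (a, b)))"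
        using ij' by (intro member_le_sum[where f = "\<lambda>a. \<Sum>b<v. cmod (\<tau> k $$ (a, b))"]) (auto simp: sum_nonneg)
      finally show "cmod (\<tau> k $$ (i div n, j div n)) \<le> (\<Sum>a<v. \<Sum>b<v. cmod (\<tau> k $$ (a, b)))" .
    qed (use \<epsilon> in auto)
    also have "\<dots> = C * \<epsilon>" by (simp add: C_def sum_distrib_right)
    also have "\<dots> \<le> \<delta>" using \<delta> C0 by (simp add: \<epsilon>_def field_simps)
    finally show "cmod (xdiff \<rho> n (A, X) (A, Y) $$ (i, j)) \<le> \<delta>" .
  qed
qed

text \<open>The positive part of a fibre described by \<open>H\<close> at a base point with
  invertible pencil. At the second point invertibility is either derived, from injectivity of
  \<open>1 - H R\<close>, or contained in the membership.\<close>

lemma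
  assumes \<rho>: "sym_realization \<rho>" and n: "1 \<le> n" and p: "(A, X) \<in> herm_pairs n" and q: "(A, Y) \<in> herm_pairs n"
    and d: "det (pencil \<rho> n (A, X)) \<noteq> 0"
  defines "v \<equiv> dim_col (V_T \<rho>)" and "R \<equiv> R_T \<rho> n (A, X)" and "H \<equiv> xdiff \<rho> n (A, X) (A, Y)"
  shows rl_dom_plus_xdiffI: "psd_mat (v * n) (R - R * (H * R)) \<Longrightarrow>
      (\<And>z. z \<in> carrier_mat (v * n) 1 \<Longrightarrow> z = H * (R * z) \<Longrightarrow> z = 0\<^sub>m (v * n) 1) \<Longrightarrow> (A, Y) \<in> rl_dom_plus \<rho>"
    and rl_dom_plus_xdiffD: "(A, Y) \<in> rl_dom_plus \<rho> \<Longrightarrow> psd_mat (v * n) (R - R * (H * R))"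
    and rl_dom_plus_xdiff_inj: "(A, Y) \<in> rl_dom_plus \<rho> \<Longrightarrow>
      z \<in> carrier_mat (v * n) 1 \<Longrightarrow> z = H * (R * z) \<Longrightarrow> z = 0\<^sub>m (v * n) 1"
proof -
  note j = join_herm(1)[OF p] join_herm(1)[OF q]
  note c = pencil_carrier[OF \<rho> j(1)] pencil_carrier[OF \<rho> j(2)] and i = resolvent_inverse[OF \<rho> j(1) d]
  have W: "kron (V_T \<rho>) (1\<^sub>m n) \<in> carrier_mat (rl_dim \<rho> * n) (v * n)" 
    unfolding v_def by (rule kron_carrier[OF V_T_props(1)[OF \<rho>] one_carrier_mat])
  have H: "H \<in> carrier_mat (v * n) (v * n)" "adj H = H"
    using xdiff_hermitian[OF \<rho> p q] by (auto simp: hermitian_mat_def H_def v_def)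
  note L = pencil_xdiff[OF \<rho> p q, folded H_def] and R = R_T_eq[OF \<rho> j(1) d, folded R_def]
  note h = pencil_hermitian[OF \<rho> p] H(2) pencil_hermitian[OF \<rho> q]
  {
    assume d': "det (pencil \<rho> n (A, Y)) \<noteq> 0"
    note i' = resolvent_inverse[OF \<rho> j(2) d'] and R' = R_T_eq[OF \<rho> j(2) d']
    note compression_psd_iff[OF c i(1) i'(1) W H(1) i(2,3) i'(2,3) L h R R']
      compression_inj[OF c i(1) i'(1) W H(1) i(2,3) i'(2,3) L h R R']
  } note * = this
  note iff = rl_dom_plus_iff[OF q n, of \<rho>, folded v_def]
  show "(A, Y) \<in> rl_dom_plus \<rho>" if "psd_mat (v * n) (R - R * (H * R))"
    "\<And>z. z \<in> carrier_mat (v * n) 1 \<Longrightarrow> z = H * (R * z) \<Longrightarrow> z = 0\<^sub>m (v * n) 1"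
  proof -
    have d': "det (pencil \<rho> n (A, Y)) \<noteq> 0" by (rule compression_det[OF c i(1) W H(1) i(3) L R that(2)])
    with that(1) *(1)[OF d'] show ?thesis unfolding iff by simp
  qed
  show "psd_mat (v * n) (R - R * (H * R))" if "(A, Y) \<in> rl_dom_plus \<rho>"
    using that *(1) unfolding iff by simp
  show "z = 0\<^sub>m (v * n) 1" if "(A, Y) \<in> rl_dom_plus \<rho>" "z \<in> carrier_mat (v * n) 1" "z = H * (R * z)"
  proof -
    have d': "det (pencil \<rho> n (A, Y)) \<noteq> 0" using that(1) unfolding iff by simp
    show ?thesis by (rule *(2)[OF d' that(2,3)])
  qed
qed

lemma open_in_x_rl_dom_plus:
  fixes \<rho> :: "('h::finite, 'g::finite) realization"
  assumes \<rho>: "sym_realization \<rho>"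
  shows "open_in_x (rl_dom_plus \<rho>)"
  unfolding open_in_x_def open_tuples_def
proof (intro allI impI ballI conjI)
  fix n :: nat and A :: "'h tuple" assume n: "1 \<le> n" and A: "A \<in> herm_tuples n"
  show "fiber (rl_dom_plus \<rho>) n A \<subseteq> herm_tuples n" by (auto simp: fiber_def)
  fix X assume X: "X \<in> fiber (rl_dom_plus \<rho>) n A"
  then have p: "(A, X) \<in> herm_pairs n" using A by (auto simp: fiber_def herm_pairs_def)
  have d: "det (pencil \<rho> n (A, X)) \<noteq> 0" "psd_mat (dim_col (V_T \<rho>) * n) (R_T \<rho> n (A, X))"
    using X rl_dom_plus_iff[OF p n, of \<rho>] by (auto simp: fiber_def)
  obtain \<delta> where \<delta>: "0 < \<delta>" "\<And>H. hermitian_mat (dim_col (V_T \<rho>) * n) H \<Longrightarrow>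
      (\<And>i j. i < dim_col (V_T \<rho>) * n \<Longrightarrow> j < dim_col (V_T \<rho>) * n \<Longrightarrow> cmod (H $$ (i, j)) \<le> \<delta>) \<Longrightarrow>
     psd_mat (dim_col (V_T \<rho>) * n) (R_T \<rho> n (A, X) - R_T \<rho> n (A, X) * (H * R_T \<rho> n (A, X))) \<and>
     (\<forall>z\<in>carrier_mat (dim_col (V_T \<rho>) * n) 1. z = H * (R_T \<rho> n (A, X) * z) \<longrightarrow> z = 0\<^sub>m (dim_col (V_T \<rho>) * n) 1)"
    by (rule psd_perturb[OF d(2)]) blast
  obtain \<epsilon> where \<epsilon>: "0 < \<epsilon>" "\<And>A X Y i j. (A, X) \<in> herm_pairs n \<Longrightarrow> (A, Y) \<in> herm_pairs n \<Longrightarrow> tuple_close \<epsilon> n X Y \<Longrightarrow>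
    i < dim_col (V_T \<rho>) * n \<Longrightarrow> j < dim_col (V_T \<rho>) * n \<Longrightarrow> cmod (xdiff \<rho> n (A, X) (A, Y) $$ (i, j)) \<le> \<delta>"
    by (rule xdiff_small[OF \<rho> \<delta>(1), of n]) blast
  show "\<exists>\<epsilon>>0. \<forall>Y\<in>herm_tuples n. tuple_close \<epsilon> n X Y \<longrightarrow> Y \<in> fiber (rl_dom_plus \<rho>) n A"
  proof (intro exI[of _ \<epsilon>] conjI \<epsilon>(1) ballI impI)
    fix Y :: "'g tuple" assume Y: "Y \<in> herm_tuples n" "tuple_close \<epsilon> n X Y"
    then have q: "(A, Y) \<in> herm_pairs n" using A by (auto simp: herm_pairs_def)
    note s = \<delta>(2)[OF xdiff_hermitian[OF \<rho> p q] \<epsilon>(2)[OF p q Y(2)]]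
    have "(A, Y) \<in> rl_dom_plus \<rho>"
      by (rule rl_dom_plus_xdiffI[OF \<rho> n p q d(1)]) (use s in blast)+
    then show "Y \<in> fiber (rl_dom_plus \<rho>) n A" using Y by (simp add: fiber_def)
  qed
qed

lemma herm_tuples_comb:
  assumes "X \<in> herm_tuples n" "Y \<in> herm_tuples n"
  shows "tuple_comb s X t Y \<in> herm_tuples n"
  unfolding herm_tuples_def mem_Collect_eq hermitian_mat_def
proof (intro allI conjI)
  fix i
  have c: "X i \<in> carrier_mat n n" "Y i \<in> carrier_mat n n" and a: "adj (X i) = X i" "adj (Y i) = Y i"
    using assms by (auto simp: herm_tuples_def hermitian_mat_def)
  note [simp] = c[unfolded carrier_mat_iff]
  show "tuple_comb s X t Y i \<in> carrier_mat n n" "adj (tuple_comb s X t Y i) = tuple_comb s X t Y i"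
    by (simp_all add: tuple_comb_def adj_add adj_smult a carrier_mat_iff)
qed

lemma convex_in_x_rl_dom_plus:
  fixes \<rho> :: "('h::finite, 'g::finite) realization"
  assumes \<rho>: "sym_realization \<rho>"
  shows "convex_in_x (rl_dom_plus \<rho>)"
  unfolding convex_in_x_def convex_tuples_def
proof (intro allI impI ballI)
  fix n :: nat and A :: "'h tuple" and X Y :: "'g tuple" and s t :: real
  assume n: "1 \<le> n" and A: "A \<in> herm_tuples n" and X: "X \<in> fiber (rl_dom_plus \<rho>) n A" and Y: "Y \<in> fiber (rl_dom_plus \<rho>) n A"
    and st: "0 \<le> s" "0 \<le> t" "s + t = 1"
  have p: "(A, X) \<in> herm_pairs n" and q: "(A, Y) \<in> herm_pairs n" using X Y A by (auto simp: fiber_def herm_pairs_def)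
  define Z where "Z = tuple_comb s X t Y"
  have Zh: "Z \<in> herm_tuples n" unfolding Z_def using X Y by (intro herm_tuples_comb) (auto simp: fiber_def)
  then have z: "(A, Z) \<in> herm_pairs n" using A by (simp add: herm_pairs_def)
  have d: "det (pencil \<rho> n (A, X)) \<noteq> 0" "psd_mat (dim_col (V_T \<rho>) * n) (R_T \<rho> n (A, X))"
    using X rl_dom_plus_iff[OF p n, of \<rho>] by (auto simp: fiber_def)
  have Yd: "(A, Y) \<in> rl_dom_plus \<rho>" using Y by (simp add: fiber_def)
  let ?H = "xdiff \<rho> n (A, X) (A, Y)" and ?R = "R_T \<rho> n (A, X)" and ?v = "dim_col (V_T \<rho>)"
  note r = rl_carriers[OF \<rho>] and V = V_T_props(1)[OF \<rho>] and j = join_herm(1)[OF p] join_herm(1)[OF q]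
  have t1: "t \<le> 1" using st by simp
  have s: "complex_of_real s = 1 - complex_of_real t" using st(3) by (metis add_diff_cancel_right' of_real_1 of_real_diff)
  have "join (A, Z) i - join (A, X) i = complex_of_real t \<cdot>\<^sub>m (join (A, Y) i - join (A, X) i)" for i
  proof (cases i)
    case (Inl l)
    have "X l \<in> carrier_mat n n" "Y l \<in> carrier_mat n n" using j(1)[of "Inl l"] j(2)[of "Inl l"] by (auto simp: join_def)
    then show ?thesis by (intro eq_matI) (auto simp: Inl join_def Z_def tuple_comb_def s algebra_simps)
  next
    case (Inr l)
    show ?thesis unfolding Inr join_def by (intro eq_matI) simp_all
  qed
  then have df: "(\<lambda>i. join (A, Z) i - join (A, X) i) = (\<lambda>i. complex_of_real t \<cdot>\<^sub>m (join (A, Y) i - join (A, X) i))"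
    by (rule ext)
  \<comment> \<open>Along the segment the perturbation is scaled by the weight \<open>t\<close> of
    \<open>Y\<close>, the base point being \<open>X\<close>; \<open>psd_interpolate\<close> is then
    applied with this \<open>t\<close>.\<close>
  have H: "xdiff \<rho> n (A, X) (A, Z) = complex_of_real t \<cdot>\<^sub>m ?H"
    unfolding xdiff_def df
    by (rule lin_smult_right[OF mult_carrier_mat[OF adj_carrier[OF V] mult_carrier_mat[OF r(4) V]]])
      (rule minus_carrier_mat[OF j(1)])
  note xh = xdiff_hermitian[OF \<rho> p q] and xd = rl_dom_plus_xdiffD[OF \<rho> n p q d(1) Yd]
    and inj = rl_dom_plus_xdiff_inj[OF \<rho> n p q d(1) Yd]
  have "(A, Z) \<in> rl_dom_plus \<rho>"
  proof (rule rl_dom_plus_xdiffI[OF \<rho> n p z d(1)], unfold H)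
    show "psd_mat (?v * n) (?R - ?R * (complex_of_real t \<cdot>\<^sub>m ?H * ?R))"
      by (rule psd_interpolate(1)[OF d(2) xh xd _ st(2) t1]) (erule (1) inj)
    fix z assume "z \<in> carrier_mat (?v * n) 1" "z = complex_of_real t \<cdot>\<^sub>m ?H * (?R * z)"
    then show "z = 0\<^sub>m (?v * n) 1"
      by (rule psd_interpolate(2)[OF d(2) xh xd _ st(2) t1, rotated]) (erule (1) inj)
  qed
  then show "tuple_comb s X t Y \<in> fiber (rl_dom_plus \<rho>) n A" using Zh by (simp add: fiber_def Z_def)
qed

section \<open>Midpoint differences of \<open>r\<close> in \<open>x\<close>\<close>

lemma rl_eval_eq:
  assumes \<rho>: "sym_realization \<rho>" and p: "\<And>i. join p i \<in> carrier_mat n n" and d: "det (pencil \<rho> n p) \<noteq> 0"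
  defines "C \<equiv> kron (rl_C \<rho>) (1\<^sub>m n)"
  shows "rl_eval \<rho> n p = adj C * (resolvent \<rho> n p * C)" "C \<in> carrier_mat (rl_dim \<rho> * n) n"
proof -
  note [simp] = carrier_matD[OF rl_carriers(7)[OF \<rho>]] carrier_matD[OF resolvent_inverse(1)[OF \<rho> p d]]
  show "rl_eval \<rho> n p = adj C * (resolvent \<rho> n p * C)"
    by (simp add: rl_eval_def compressed_resolvent_def C_def mmult_assoc)
  show "C \<in> carrier_mat (rl_dim \<rho> * n) n" by (simp add: C_def carrier_mat_iff)
qed

text \<open>\<open>M\<close> is left general: it is \<open>V H V\<^sup>*\<close> in the proof of
  convexity on the positive part, and a multiple of a hermitian direction in the proof that
  convexity forces positivity.\<close>

lemma midpoint_difference: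
  assumes \<rho>: "sym_realization \<rho>" and X: "\<And>i. join p i \<in> carrier_mat n n" and Y: "\<And>i. join q i \<in> carrier_mat n n"
    and Z: "\<And>i. join z i \<in> carrier_mat n n"
    and d: "det (pencil \<rho> n p) \<noteq> 0" "det (pencil \<rho> n q) \<noteq> 0" "det (pencil \<rho> n z) \<noteq> 0"
    and M: "M \<in> carrier_mat (rl_dim \<rho> * n) (rl_dim \<rho> * n)"
    and L: "pencil \<rho> n p = pencil \<rho> n z + M" "pencil \<rho> n z = pencil \<rho> n q + M"
  defines "C \<equiv> kron (rl_C \<rho>) (1\<^sub>m n)"
  shows "(1/2) \<cdot>\<^sub>m (rl_eval \<rho> n p + rl_eval \<rho> n q) - rl_eval \<rho> n z =
    complex_of_real (1/2) \<cdot>\<^sub>m (adj C * (resolvent \<rho> n z * (M * ((resolvent \<rho> n p + resolvent \<rho> n q) * (M * (resolvent \<rho> n z * C))))))"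
proof -
  note P = resolvent_inverse[OF \<rho> X d(1)] and Q = resolvent_inverse[OF \<rho> Y d(2)] and R = resolvent_inverse[OF \<rho> Z d(3)]
  note C = rl_eval_eq(2)[OF \<rho> X d(1), folded C_def]
  note [simp] = P(1)[unfolded carrier_mat_iff] Q(1)[unfolded carrier_mat_iff]
     R(1)[unfolded carrier_mat_iff] carrier_matD[OF M] carrier_matD[OF C]
  have s: "resolvent \<rho> n p + resolvent \<rho> n q = (resolvent \<rho> n z + resolvent \<rho> n z) +
    resolvent \<rho> n z * (M * ((resolvent \<rho> n p + resolvent \<rho> n q) * (M * resolvent \<rho> n z)))" (is "_ = _ + ?D")
    by (rule second_difference[OF pencil_carrier[OF \<rho> Z] M pencil_carrier[OF \<rho> X] pencil_carrier[OF \<rho> Y]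
          R(1) P(1) Q(1) R(2,3) P(2,3) Q(2,3) L])
  have "adj C * ((resolvent \<rho> n p + resolvent \<rho> n q) * C) = adj C * (((resolvent \<rho> n z + resolvent \<rho> n z) + ?D) * C)"
    by (subst s) (rule refl)
  then have "adj C * (resolvent \<rho> n p * C) + adj C * (resolvent \<rho> n q * C) =
    (adj C * (resolvent \<rho> n z * C) + adj C * (resolvent \<rho> n z * C)) + adj C * (?D * C)"
    by (simp add: mmult_add_left mmult_add_right)
  then have e: "rl_eval \<rho> n p + rl_eval \<rho> n q = (rl_eval \<rho> n z + rl_eval \<rho> n z) + adj C * (?D * C)"
    unfolding rl_eval_eq(1)[OF \<rho> X d(1)] rl_eval_eq(1)[OF \<rho> Y d(2)] rl_eval_eq(1)[OF \<rho> Z d(3)] C_def .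
  have c: "dim_row (rl_eval \<rho> n z) = n" "dim_col (rl_eval \<rho> n z) = n"
    unfolding rl_eval_eq(1)[OF \<rho> Z d(3)] C_def[symmetric] by simp_all
  have "adj C * (?D * C) = adj C * (resolvent \<rho> n z * (M * ((resolvent \<rho> n p + resolvent \<rho> n q) * (M * (resolvent \<rho> n z * C)))))"
    by (simp add: mmult_assoc)
  then show ?thesis unfolding e
    by (intro eq_matI) (simp_all add: c add_divide_distrib del: index_mult_mat(1))
qed

lemma r_convex_in_x_rl_dom_plus:
  fixes \<rho> :: "('h::finite, 'g::finite) realization"
  assumes \<rho>: "sym_realization \<rho>"
  shows "r_convex_in_x \<rho> (rl_dom_plus \<rho>)"
  unfolding r_convex_in_x_def
proof (intro conjI allI impI ballI)
  show "rl_dom_plus \<rho> \<subseteq> rl_dom \<rho>" by (auto simp: rl_dom_plus_def)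
  fix n :: nat and A :: "'h tuple" and X Y :: "'g tuple"
  assume n: "1 \<le> n" and A: "A \<in> herm_tuples n" and X: "X \<in> fiber (rl_dom_plus \<rho>) n A" and Y: "Y \<in> fiber (rl_dom_plus \<rho>) n A"
    and Z: "tuple_comb (1/2) X (1/2) Y \<in> fiber (rl_dom_plus \<rho>) n A"
  define Z' where "Z' = tuple_comb (1/2) X (1/2) Y"
  note Z = Z[folded Z'_def]
  have p: "(A, X) \<in> herm_pairs n" and q: "(A, Y) \<in> herm_pairs n" and z: "(A, Z') \<in> herm_pairs n"
    using X Y Z A by (simp_all add: fiber_def herm_pairs_def)
  have dX: "det (pencil \<rho> n (A, X)) \<noteq> 0" "psd_mat (dim_col (V_T \<rho>) * n) (R_T \<rho> n (A, X))"
    using X rl_dom_plus_iff[OF p n, of \<rho>] by (simp_all add: fiber_def)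
  have dY: "det (pencil \<rho> n (A, Y)) \<noteq> 0" "psd_mat (dim_col (V_T \<rho>) * n) (R_T \<rho> n (A, Y))"
    using Y rl_dom_plus_iff[OF q n, of \<rho>] by (simp_all add: fiber_def)
  have dZ: "det (pencil \<rho> n (A, Z')) \<noteq> 0"
    using Z rl_dom_plus_iff[OF z n, of \<rho>] by (simp add: fiber_def)
  note j = join_herm(1)[OF p] join_herm(1)[OF q] join_herm(1)[OF z]
  define v where "v = dim_col (V_T \<rho>)"
  define W where "W = kron (V_T \<rho>) (1\<^sub>m n)"
  define H where "H = xdiff \<rho> n (A, X) (A, Z')"
  have W: "W \<in> carrier_mat (rl_dim \<rho> * n) (v * n)"
    unfolding W_def v_def by (rule kron_carrier[OF V_T_props(1)[OF \<rho>] one_carrier_mat])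
  have H: "H \<in> carrier_mat (v * n) (v * n)" "adj H = H"
    using xdiff_hermitian[OF \<rho> p z] by (simp_all add: hermitian_mat_def H_def v_def)
  have "join (A, Y) i - join (A, Z') i = join (A, Z') i - join (A, X) i" for i
  proof (cases i)
    case (Inl l)
    have "X l \<in> carrier_mat n n" "Y l \<in> carrier_mat n n" using j(1)[of "Inl l"] j(2)[of "Inl l"] by (auto simp: join_def)
    then show ?thesis by (intro eq_matI) (auto simp: Inl join_def Z'_def tuple_comb_def)
  next
    case (Inr l)
    show ?thesis unfolding Inr join_def by (intro eq_matI) simp_all
  qed
  then have H': "xdiff \<rho> n (A, Z') (A, Y) = H" unfolding xdiff_def H_def by simp
  note L = pencil_xdiff[OF \<rho> p z, folded H_def W_def] pencil_xdiff[OF \<rho> z q, unfolded H', folded W_def]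
  define C where "C = kron (rl_C \<rho>) (1\<^sub>m n)"
  note C = rl_eval_eq(2)[OF \<rho> j(1) dX(1), folded C_def]
  note P = resolvent_inverse[OF \<rho> j(1) dX(1)] and Q = resolvent_inverse[OF \<rho> j(2) dY(1)] and R = resolvent_inverse[OF \<rho> j(3) dZ]
  note [simp] = P(1)[unfolded carrier_mat_iff] Q(1)[unfolded carrier_mat_iff]
     R(1)[unfolded carrier_mat_iff] carrier_matD[OF H(1)] carrier_matD[OF C] carrier_matD[OF W]
  have M: "W * (H * adj W) \<in> carrier_mat (rl_dim \<rho> * n) (rl_dim \<rho> * n)" by (simp add: carrier_mat_iff)
  have a: "adj (resolvent \<rho> n (A, Z')) = resolvent \<rho> n (A, Z')"
    by (rule hermitian_inverse[OF pencil_carrier[OF \<rho> j(3)] R(1,2) pencil_hermitian[OF \<rho> z]])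
  \<comment> \<open>As the increment is \<open>W H W\<^sup>*\<close>, the remainder involves the two
    outer resolvents only through their compressions by \<open>W\<close>, that is, through the two
    values of \<open>R_T\<close>.\<close>
  define G where "G = H * (adj W * (resolvent \<rho> n (A, Z') * C))"
  have G: "G \<in> carrier_mat (v * n) n" by (simp add: G_def carrier_mat_iff)
  note R1 = R_T_eq[OF \<rho> j(1) dX(1), folded W_def] and R2 = R_T_eq[OF \<rho> j(2) dY(1), folded W_def]
  have "psd_mat n (complex_of_real (1/2) \<cdot>\<^sub>m (adj G * ((R_T \<rho> n (A, X) + R_T \<rho> n (A, Y)) * G)))"
    by (rule psd_smult[OF psd_congruence[OF psd_add[OF dX(2)[folded v_def] dY(2)[folded v_def]] G]]) simp
  also have "adj G * ((R_T \<rho> n (A, X) + R_T \<rho> n (A, Y)) * G) =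
    adj C * (resolvent \<rho> n (A, Z') * (W * (H * adj W) * ((resolvent \<rho> n (A, X) + resolvent \<rho> n (A, Y)) * (W * (H * adj W) * (resolvent \<rho> n (A, Z') * C)))))"
    unfolding R1 R2 G_def by (simp add: mat_algebra a H(2))
  also have "complex_of_real (1/2) \<cdot>\<^sub>m \<dots> = (1/2) \<cdot>\<^sub>m (rl_eval \<rho> n (A, X) + rl_eval \<rho> n (A, Y)) - rl_eval \<rho> n (A, Z')"
    unfolding C_def by (rule midpoint_difference[OF \<rho> j dX(1) dY(1) dZ M L, symmetric])
  finally show "psd_mat n ((1/2) \<cdot>\<^sub>m (rl_eval \<rho> n (A, X) + rl_eval \<rho> n (A, Y)) - rl_eval \<rho> n (A, tuple_comb (1/2) X (1/2) Y))"
    by (simp only: Z'_def)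
qed

lemma domain_rl_dom_plus:
  fixes \<rho> :: "('h::finite, 'g::finite) realization"
  assumes "sym_realization \<rho>"
  shows "domain_of_partial_convexity \<rho> (rl_dom_plus \<rho>)"
  unfolding domain_of_partial_convexity_def
  by (intro conjI free_set_rl_dom_plus[OF assms] open_in_x_rl_dom_plus[OF assms] convex_in_x_rl_dom_plus[OF assms]
      r_convex_in_x_rl_dom_plus[OF assms])

section \<open>Off-diagonal perturbations of a direct sum\<close>

lemma ampl_mult_left: "dim_col A = dim_row B \<Longrightarrow> dim_row X = e * dim_col B \<Longrightarrow> ampl e A * (ampl e B * X) = ampl e (A * B) * X"
  by (rule mult_eq_assoc[OF ampl_mult]) auto

lemma kron_one_Suc [simp]: "kron A (1\<^sub>m (Suc 0)) = A"
  using kron_one_one[of A] by simp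

lemma lin_kron_ampl:
  assumes "\<And>i. Z i \<in> carrier_mat e f" "\<And>i. z i \<in> carrier_mat n m" "F \<in> carrier_mat m k"
  shows "lin (e * n) (f * m) Z z * ampl f F = lin (e * n) (f * k) Z (\<lambda>i. z i * F)"
proof -
  have "Z i * 1\<^sub>m f = Z i" for i using assms(1)[of i] by auto
  then show ?thesis unfolding ampl_def by (subst lin_mult_kron[OF assms(1,2) one_carrier_mat assms(3)]) simp
qed

lemma ampl_lin:
  assumes "\<And>i. Z i \<in> carrier_mat e f" "\<And>i. z i \<in> carrier_mat n m" "F \<in> carrier_mat k n"
  shows "ampl e F * lin (e * n) (f * m) Z z = lin (e * k) (f * m) Z (\<lambda>i. F * z i)"
proof -
  have "1\<^sub>m e * Z i = Z i" for i using assms(1)[of i] by auto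
  then show ?thesis unfolding ampl_def by (subst kron_mult_lin[OF assms(1,2) one_carrier_mat assms(3)]) simp
qed

text \<open>The hermitian block matrix with corner \<open>q\<close> and zero diagonal blocks:
  through it an arbitrary rectangular \<open>q\<close> becomes an admissible direction at a direct
  sum.\<close>

definition offdiag :: "nat \<Rightarrow> nat \<Rightarrow> ('i \<Rightarrow> complex mat) \<Rightarrow> 'i \<Rightarrow> complex mat" where
  "offdiag n m q = (\<lambda>i. inl_mat n m * (q i * adj (inr_mat n m)) + inr_mat n m * (adj (q i) * adj (inl_mat n m)))"

lemma offdiag_hermitian:
  assumes "q i \<in> carrier_mat n m"
  shows "offdiag n m q i \<in> carrier_mat (n + m) (n + m)" "adj (offdiag n m q i) = offdiag n m q i"
proof -
  note [simp] = carrier_matD[OF assms]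
  show "offdiag n m q i \<in> carrier_mat (n + m) (n + m)" by (simp add: offdiag_def carrier_mat_iff)
  show "adj (offdiag n m q i) = offdiag n m q i"
    by (rule eq_matI) (simp_all add: offdiag_def mat_algebra del: index_mult_mat(1))
qed

text \<open>Applied to the second summand, the perturbation acts by \<open>q\<close> alone and has
  its values in the first summand.\<close>

lemma lin_offdiag_inr:
  assumes Z: "\<And>i. Z i \<in> carrier_mat e e" and q: "\<And>i. q i \<in> carrier_mat n m"
  shows "lin (e * (n + m)) (e * (n + m)) Z (offdiag n m q) * ampl e (inr_mat n m) =
    ampl e (inl_mat n m) * lin (e * n) (e * m) Z q"
proof -
  note [simp] = q[unfolded carrier_mat_iff]
  have "lin (e * (n + m)) (e * (n + m)) Z (offdiag n m q) * ampl e (inr_mat n m) =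
     lin (e * (n + m)) (e * m) Z (\<lambda>i. offdiag n m q i * inr_mat n m)"
    by (rule lin_kron_ampl[OF Z offdiag_hermitian(1)[where q = q, OF q] inlr_carrier(2)])
  also have "(\<lambda>i. offdiag n m q i * inr_mat n m) = (\<lambda>i. inl_mat n m * q i)"
    by (rule ext) (simp add: offdiag_def mat_algebra inlr add_zero_mat)
  also have "lin (e * (n + m)) (e * m) Z (\<lambda>i. inl_mat n m * q i) = ampl e (inl_mat n m) * lin (e * n) (e * m) Z q"
    by (rule ampl_lin[OF Z q inlr_carrier(1), symmetric])
  finally show ?thesis .
qed

lemma resolvent_dsum_ampl:
  assumes \<rho>: "sym_realization \<rho>" and p: "\<And>i. join p i \<in> carrier_mat n n" and q: "\<And>i. join q i \<in> carrier_mat m m"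
    and d: "det (pencil \<rho> n p) \<noteq> 0" "det (pencil \<rho> m q) \<noteq> 0"
  shows "resolvent \<rho> (n + m) (pair_dsum p q) * ampl (rl_dim \<rho>) (inr_mat n m) = ampl (rl_dim \<rho>) (inr_mat n m) * resolvent \<rho> m q"
    "resolvent \<rho> (n + m) (pair_dsum p q) * ampl (rl_dim \<rho>) (inl_mat n m) = ampl (rl_dim \<rho>) (inl_mat n m) * resolvent \<rho> n p"
    "ampl (rl_dim \<rho>) (adj (inl_mat n m)) * resolvent \<rho> (n + m) (pair_dsum p q) = resolvent \<rho> n p * ampl (rl_dim \<rho>) (adj (inl_mat n m))"
proof -
  note P = resolvent_inverse[OF \<rho> p d(1)] and Q = resolvent_inverse[OF \<rho> q d(2)]
  note [simp] = P(1)[unfolded carrier_mat_iff] Q(1)[unfolded carrier_mat_iff]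
  note s = resolvent_dsum(2)[OF \<rho> p q d]
  show "resolvent \<rho> (n + m) (pair_dsum p q) * ampl (rl_dim \<rho>) (inr_mat n m) = ampl (rl_dim \<rho>) (inr_mat n m) * resolvent \<rho> m q"
    unfolding s by (simp add: mat_algebra ampl_mult inlr add_zero_mat)
  show "resolvent \<rho> (n + m) (pair_dsum p q) * ampl (rl_dim \<rho>) (inl_mat n m) = ampl (rl_dim \<rho>) (inl_mat n m) * resolvent \<rho> n p"
    unfolding s by (simp add: mat_algebra ampl_mult inlr add_zero_mat)
  show "ampl (rl_dim \<rho>) (adj (inl_mat n m)) * resolvent \<rho> (n + m) (pair_dsum p q) = resolvent \<rho> n p * ampl (rl_dim \<rho>) (adj (inl_mat n m))"
    unfolding s by (simp add: mat_algebra ampl_mult ampl_mult_left inlr add_zero_mat)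
qed

lemma kron_ampl:
  assumes "C \<in> carrier_mat e k" "F \<in> carrier_mat m n"
  shows "kron C (1\<^sub>m m) * ampl k F = ampl e F * kron C (1\<^sub>m n)"
  using carrier_matD[OF assms(1)] carrier_matD[OF assms(2)] by (simp add: ampl_def kron_mult mmult_one)

text \<open>\<open>C \<otimes> 1\<close> intertwines \<open>F\<close> with its amplification; this
  moves the coordinate isometries past the column of the realization.\<close>

lemma kron_ampl_one:
  assumes "C \<in> carrier_mat e 1" "F \<in> carrier_mat m n"
  shows "kron C (1\<^sub>m m) * F = ampl e F * kron C (1\<^sub>m n)"
proof -
  have "ampl 1 F = F" unfolding ampl_def by (rule eq_matI) (auto simp: index_kron)
  then show ?thesis using kron_ampl[OF assms] by simp
qed

lemma free_set_dsum: "free_set U \<Longrightarrow> p \<in> U \<Longrightarrow> q \<in> U \<Longrightarrow> pair_dsum p q \<in> U"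
  unfolding free_set_def pair_dsum_def by (metis prod.collapse)

section \<open>First-order expansion\<close>

definition pair_shift :: "('h, 'g) pair \<Rightarrow> complex \<Rightarrow> ('g + 'h \<Rightarrow> complex mat) \<Rightarrow> ('h, 'g) pair" where
  "pair_shift p k q = ((\<lambda>j. fst p j + k \<cdot>\<^sub>m q (Inr j)), (\<lambda>i. snd p i + k \<cdot>\<^sub>m q (Inl i)))"

lemma join_shift: "join (pair_shift p k q) i = join p i + k \<cdot>\<^sub>m q i"
  by (cases i) (simp_all add: join_def pair_shift_def)

lemma herm_pairs_shift:
  assumes p: "p \<in> herm_pairs n" and q: "\<And>i. q i \<in> carrier_mat n n" "\<And>i. adj (q i) = q i"
  shows "pair_shift p (complex_of_real t) q \<in> herm_pairs n"
proof (rule herm_pairsI)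
  fix i
  note j = join_herm[OF p, of i]
  note [simp] = carrier_matD[OF j(1)] carrier_matD[OF q(1)]
  show "join (pair_shift p (complex_of_real t) q) i \<in> carrier_mat n n" by (simp add: join_shift carrier_mat_iff)
  show "adj (join (pair_shift p (complex_of_real t) q) i) = join (pair_shift p (complex_of_real t) q) i"
    by (simp add: join_shift adj_add adj_smult j(2) q(2))
qed

lemma small_shift:
  fixes q :: "'i::finite \<Rightarrow> complex mat"
  assumes "0 < \<epsilon>"
  shows "\<forall>\<^sub>F t in at_right (0::real). \<forall>k. \<forall>a<n. \<forall>b<n. cmod (complex_of_real t * q k $$ (a, b)) < \<epsilon>"
proof -
  define B where "B = (\<Sum>k\<in>UNIV. \<Sum>a<n. \<Sum>b<n. cmod (q k $$ (a, b)))"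
  have B0: "0 \<le> B" by (simp add: B_def sum_nonneg)
  have B: "cmod (q k $$ (a, b)) \<le> B" if ab: "a < n" "b < n" for k a b
  proof -
    have "cmod (q k $$ (a, b)) \<le> (\<Sum>b<n. cmod (q k $$ (a, b)))"
      using ab by (intro member_le_sum) auto
    also have "\<dots> \<le> (\<Sum>a<n. \<Sum>b<n. cmod (q k $$ (a, b)))"
      using ab by (intro member_le_sum[where f = "\<lambda>a. \<Sum>b<n. cmod (q k $$ (a, b))"]) (auto simp: sum_nonneg)
    also have "\<dots> \<le> B" unfolding B_def
      by (intro member_le_sum[where f = "\<lambda>k. \<Sum>a<n. \<Sum>b<n. cmod (q k $$ (a, b))"]) (auto simp: sum_nonneg)
    finally show ?thesis .
  qed
  show ?thesis
  proof (rule eventually_at_rightI[of 0 "\<epsilon> / (B + 1)"])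
    fix t assume t: "t \<in> {0<..<\<epsilon> / (B + 1)}"
    show "\<forall>k. \<forall>a<n. \<forall>b<n. cmod (complex_of_real t * q k $$ (a, b)) < \<epsilon>"
    proof (intro allI impI)
      fix k a b assume ab: "a < n" "b < n"
      have "cmod (complex_of_real t * q k $$ (a, b)) = t * cmod (q k $$ (a, b))" using t by (simp add: norm_mult)
      also have "\<dots> \<le> t * (B + 1)" using t B[OF ab, of k] by (intro mult_left_mono) auto
      also have "\<dots> < \<epsilon>" using t B0 by (simp add: pos_less_divide_eq)
      finally show "cmod (complex_of_real t * q k $$ (a, b)) < \<epsilon>" .
    qed
  qed (use assms B0 in simp)
qed

lemma open_graded_shift:
  fixes q :: "'g::finite + 'h::finite \<Rightarrow> complex mat"
  assumes U: "open_graded U" and n: "1 \<le> n" and p: "p \<in> U" "p \<in> herm_pairs n"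
    and q: "\<And>i. q i \<in> carrier_mat n n" "\<And>i. adj (q i) = q i"
  shows "\<forall>\<^sub>F t in at_right 0. pair_shift p (complex_of_real t) q \<in> U"
proof -
  have "open_pairs n (U \<inter> herm_pairs n)" using U n by (simp add: open_graded_def)
  then obtain \<epsilon> where \<epsilon>: "0 < \<epsilon>" "\<And>B Y. (B, Y) \<in> herm_pairs n \<Longrightarrow> tuple_close \<epsilon> n (fst p) B \<Longrightarrow> tuple_close \<epsilon> n (snd p) Y \<Longrightarrow> (B, Y) \<in> U"
    using p unfolding open_pairs_def by (cases p) fastforce
  show ?thesis
    using small_shift[OF \<epsilon>(1), of n q]
  proof eventually_elim
    case (elim t)
    let ?p = "pair_shift p (complex_of_real t) q"
    have qc: "dim_row (q i) = n" "dim_col (q i) = n" for i using q(1)[of i] by auto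
    have "tuple_close \<epsilon> n (fst p) (fst ?p)"
      unfolding tuple_close_def using elim by (simp add: pair_shift_def qc)
    moreover have "tuple_close \<epsilon> n (snd p) (snd ?p)"
      unfolding tuple_close_def using elim by (simp add: pair_shift_def qc)
    ultimately show ?case using \<epsilon>(2)[of "fst ?p" "snd ?p"] herm_pairs_shift[where q = q, OF p(2) q, of t] by simp
  qed
qed

lemma tendsto_of_real_at_right: "((\<lambda>t. complex_of_real t) \<longlongrightarrow> 0) (at_right 0)"
  by (auto intro!: tendsto_eq_intros)

lemma resolvent_shift_lim:
  assumes \<rho>: "sym_realization \<rho>" and p: "\<And>i. join p i \<in> carrier_mat n n" and q: "\<And>i. q i \<in> carrier_mat n n"
    and d: "det (pencil \<rho> n p) \<noteq> 0" and f: "(f \<longlongrightarrow> 0) fl"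
  shows "\<forall>\<^sub>F t in fl. det (pencil \<rho> n (pair_shift p (f t) q)) \<noteq> 0"
    "mat_lim (\<lambda>t. resolvent \<rho> n (pair_shift p (f t) q)) (resolvent \<rho> n p) (rl_dim \<rho> * n) (rl_dim \<rho> * n) fl"
  using resolvent_lim[OF pencil_shift_lim[where p' = "\<lambda>t. pair_shift p (f t) q", OF \<rho> p q join_shift f] d] by simp_all

lemma pencil_pair_shift:
  assumes \<rho>: "sym_realization \<rho>" and p: "\<And>i. join p i \<in> carrier_mat n n" and q: "\<And>i. q i \<in> carrier_mat n n"
  shows "pencil \<rho> n p = pencil \<rho> n (pair_shift p k q) + k \<cdot>\<^sub>m rl_lin \<rho> n n q"
  unfolding pencil_shift[OF \<rho> p q join_shift]
  using carrier_matD[OF pencil_carrier[OF \<rho> p]] by (intro eq_matI) simp_all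

text \<open>The derivative of a function that vanishes on an open set. By the resolvent identity the
  difference quotient is an exact product of resolvents, so continuity of the resolvent is all that
  the limit requires. The direction is hermitian, as \<open>U\<close> consists of hermitian
  tuples.\<close>

lemma first_order_vanishing:
  assumes \<rho>: "sym_realization \<rho>" and U: "open_graded U" "U \<subseteq> rl_dom \<rho>" and n: "1 \<le> n" and p: "p \<in> U" "p \<in> herm_pairs n"
    and q: "\<And>i. q i \<in> carrier_mat n n" "\<And>i. adj (q i) = q i"
    and B: "B \<in> carrier_mat m (rl_dim \<rho> * n)"
    and van: "\<And>P. P \<in> U \<Longrightarrow> P \<in> herm_pairs n \<Longrightarrow> B * (resolvent \<rho> n P * kron (rl_C \<rho>) (1\<^sub>m n)) = 0\<^sub>m m n"
  shows "B * (resolvent \<rho> n p * (rl_lin \<rho> n n q * (resolvent \<rho> n p * kron (rl_C \<rho>) (1\<^sub>m n)))) = 0\<^sub>m m n"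
proof -
  let ?N = "rl_dim \<rho> * n" and ?M = "rl_lin \<rho> n n q" and ?C = "kron (rl_C \<rho>) (1\<^sub>m n)"
    and ?p = "\<lambda>t. pair_shift p (complex_of_real t) q"
  note j = join_herm(1)[OF p(2)]
  have d: "det (pencil \<rho> n p) \<noteq> 0" using rl_dom_iff[OF p(2) n, of \<rho>] U(2) p(1) by blast
  note i = resolvent_inverse[OF \<rho> j d]
  have C: "?C \<in> carrier_mat ?N n" using rl_eval_eq(2)[OF \<rho> j d] .
  note [simp] = carrier_matD[OF B] carrier_matD[OF i(1)] carrier_matD[OF C]
  note l = resolvent_shift_lim[where q = q and f = complex_of_real, OF \<rho> j q(1) d tendsto_of_real_at_right]
  have lim: "mat_lim (\<lambda>t. B * (resolvent \<rho> n p * (?M * (resolvent \<rho> n (?p t) * ?C))))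
     (B * (resolvent \<rho> n p * (?M * (resolvent \<rho> n p * ?C)))) m n (at_right 0)"
    by (rule mat_lim_mult[OF mat_lim_const[OF B] mat_lim_mult[OF mat_lim_const[OF i(1)]
        mat_lim_mult[OF mat_lim_const[OF lin_carrier] mat_lim_mult[OF l(2) mat_lim_const[OF C]]]]])
  have "\<forall>\<^sub>F t in at_right 0. 0\<^sub>m m n = B * (resolvent \<rho> n p * (?M * (resolvent \<rho> n (?p t) * ?C)))"
    using open_graded_shift[where q = q, OF U(1) n p q] l(1) eventually_at_right_less[of "0::real"]
  proof eventually_elim
    case (elim t)
    have h: "?p t \<in> herm_pairs n" by (rule herm_pairs_shift[where q = q, OF p(2) q])
    note j' = join_herm(1)[OF h] and i' = resolvent_inverse[OF \<rho> join_herm(1)[OF h] elim(2)]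
    note [simp] = carrier_matD[OF i'(1)]
    have "resolvent \<rho> n (?p t) = resolvent \<rho> n p + resolvent \<rho> n p * (complex_of_real t \<cdot>\<^sub>m ?M * resolvent \<rho> n (?p t))"
      by (rule resolvent_identity[OF pencil_carrier[OF \<rho> j] pencil_carrier[OF \<rho> j'] _ i(1) i'(1) i(3) i'(2) pencil_pair_shift[where q = q, OF \<rho> j q(1)]])
        (simp add: carrier_mat_iff)
    then have "B * (resolvent \<rho> n (?p t) * ?C) = B * ((resolvent \<rho> n p + resolvent \<rho> n p * (complex_of_real t \<cdot>\<^sub>m ?M * resolvent \<rho> n (?p t))) * ?C)"
      by simp
    also have "\<dots> = B * (resolvent \<rho> n p * ?C) + complex_of_real t \<cdot>\<^sub>m (B * (resolvent \<rho> n p * (?M * (resolvent \<rho> n (?p t) * ?C))))"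
      by (simp add: mat_algebra)
    finally have e: "0\<^sub>m m n = 0\<^sub>m m n + complex_of_real t \<cdot>\<^sub>m (B * (resolvent \<rho> n p * (?M * (resolvent \<rho> n (?p t) * ?C))))"
      unfolding van[OF p] van[OF elim(1) h] .
    show ?case
    proof (rule eq_matI)
      fix a b assume "a < dim_row (B * (resolvent \<rho> n p * (?M * (resolvent \<rho> n (?p t) * ?C))))"
        "b < dim_col (B * (resolvent \<rho> n p * (?M * (resolvent \<rho> n (?p t) * ?C))))"
      then show "0\<^sub>m m n $$ (a, b) = (B * (resolvent \<rho> n p * (?M * (resolvent \<rho> n (?p t) * ?C)))) $$ (a, b)"
        using arg_cong[OF e, of "\<lambda>A. A $$ (a, b)"] elim(3) by (simp del: index_mult_mat(1))
    qed simp_all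
  qed
  from mat_lim_cong[OF mat_lim_const[OF zero_carrier_mat] this]
  show ?thesis using mat_lim_unique[OF lim] by (metis trivial_limit_at_right_real)
qed

section \<open>Controllability\<close>

definition annih :: "('h::finite, 'g::finite) realization \<Rightarrow> ('h, 'g) pair set \<Rightarrow> complex mat set" where
  "annih \<rho> U = {u \<in> carrier_mat (rl_dim \<rho>) 1. \<forall>N\<ge>1. \<forall>P\<in>U \<inter> herm_pairs N.
     adj (kron u (1\<^sub>m N)) * (resolvent \<rho> N P * kron (rl_C \<rho>) (1\<^sub>m N)) = 0\<^sub>m N N}"

lemma mat_sum_subspace:
  fixes F :: "'i::finite \<Rightarrow> complex mat"
  assumes S: "col_subspace n S" and F: "\<And>k. F k \<in> S"
  shows "mat_sum n 1 F \<in> S"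
proof -
  have "mat n 1 (\<lambda>p. \<Sum>k\<in>I. F k $$ p) \<in> S" if "finite I" for I :: "'i set"
    using that
  proof (induction I rule: finite_induct)
    case empty
    have "mat n 1 (\<lambda>p. \<Sum>k\<in>{}. F k $$ p) = 0\<^sub>m n 1" by (rule eq_matI) simp_all
    then show ?case using S by (simp add: col_subspace_def)
  next
    case (insert k I)
    have "F k \<in> carrier_mat n 1" using F S by (auto simp: col_subspace_def)
    then have "mat n 1 (\<lambda>p. \<Sum>l\<in>insert k I. F l $$ p) = F k + mat n 1 (\<lambda>p. \<Sum>l\<in>I. F l $$ p)"
      using insert.hyps by (intro eq_matI) auto
    then show ?case using S F[of k] insert.IH by (simp add: col_subspace_def)
  qed
  moreover have "(\<lambda>(i, j). \<Sum>k\<in>UNIV. F k $$ (i, j)) = (\<lambda>p. \<Sum>k\<in>UNIV. F k $$ p)" by auto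
  ultimately show ?thesis unfolding mat_sum_def by (metis finite)
qed

lemma mat_zero_by_rows:
  fixes M :: "complex mat"
  assumes M: "M \<in> carrier_mat n m" and z: "\<And>h. h \<in> carrier_mat 1 n \<Longrightarrow> h * M = 0\<^sub>m 1 m"
  shows "M = 0\<^sub>m n m"
proof -
  note [simp] = carrier_matD[OF M]
  have "adj M = 0\<^sub>m m n"
  proof (rule mat_eq_zeroI)
    fix v :: "complex mat" assume v: "v \<in> carrier_mat n 1"
    have "adj (adj v * M) = 0\<^sub>m m 1" by (simp add: z[OF adj_carrier[OF v]])
    then show "adj M * v = 0\<^sub>m m 1" using v by (subst (asm) adj_mult) auto
  qed (rule adj_carrier[OF M])
  then have "adj (adj M) = adj (0\<^sub>m m n)" by simp
  then show ?thesis by simp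
qed

text \<open>The point \<open>p0\<close> of size 1 is a parameter: its pencil is an
  \<open>e \<times> e\<close> matrix and can be applied to the vectors of
  \<open>annih\<close>.\<close>

locale free_open_subdomain =
  fixes \<rho> :: "('h::finite, 'g::finite) realization" and U :: "('h, 'g) pair set" and p0
  assumes \<rho>: "sym_realization \<rho>" and free: "free_set U" and op: "open_graded U" and dom: "U \<subseteq> rl_dom \<rho>"
    and p0: "p0 \<in> U" "p0 \<in> herm_pairs 1"
begin

lemma U_det: "P \<in> U \<Longrightarrow> P \<in> herm_pairs N \<Longrightarrow> 1 \<le> N \<Longrightarrow> det (pencil \<rho> N P) \<noteq> 0"
  using rl_dom_iff[of P N \<rho>] dom by blast

lemma annihD: "u \<in> annih \<rho> U \<Longrightarrow> P \<in> U \<Longrightarrow> P \<in> herm_pairs N \<Longrightarrow> 1 \<le> N \<Longrightarrow>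
   adj (kron u (1\<^sub>m N)) * (resolvent \<rho> N P * kron (rl_C \<rho>) (1\<^sub>m N)) = 0\<^sub>m N N"
  by (simp add: annih_def)

lemma annihI: "u \<in> carrier_mat (rl_dim \<rho>) 1 \<Longrightarrow> (\<And>N P. 1 \<le> N \<Longrightarrow> P \<in> U \<Longrightarrow> P \<in> herm_pairs N \<Longrightarrow>
   adj (kron u (1\<^sub>m N)) * (resolvent \<rho> N P * kron (rl_C \<rho>) (1\<^sub>m N)) = 0\<^sub>m N N) \<Longrightarrow> u \<in> annih \<rho> U"
  unfolding annih_def by blast

lemma annih_subspace: "col_subspace (rl_dim \<rho>) (annih \<rho> U)"
proof -
  let ?e = "rl_dim \<rho>"
  have r: "dim_row (resolvent \<rho> N P) = ?e * N" "dim_col (resolvent \<rho> N P) = ?e * N"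
    if "P \<in> U" "P \<in> herm_pairs N" "1 \<le> N" for P N
    using carrier_matD[OF resolvent_inverse(1)[OF \<rho> join_herm(1)[OF that(2)] U_det[OF that]]] by simp_all
  show ?thesis
    unfolding col_subspace_def
  proof (intro conjI ballI allI)
    show "annih \<rho> U \<subseteq> carrier_mat ?e 1" by (auto simp: annih_def)
    show "0\<^sub>m ?e 1 \<in> annih \<rho> U"
      by (rule annihI) (simp_all add: kron_zero mmult_zero r)
    fix v assume v: "v \<in> annih \<rho> U"
    then have [simp]: "dim_row v = ?e" "dim_col v = 1" by (auto simp: annih_def)
    show "v + w \<in> annih \<rho> U" if w: "w \<in> annih \<rho> U" for w
    proof -
      have [simp]: "dim_row w = ?e" "dim_col w = 1" using w by (auto simp: annih_def)
      show ?thesis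
      proof (rule annihI)
        fix N P assume a: "1 \<le> N" "P \<in> U" "P \<in> herm_pairs N"
        show "adj (kron (v + w) (1\<^sub>m N)) * (resolvent \<rho> N P * kron (rl_C \<rho>) (1\<^sub>m N)) = 0\<^sub>m N N"
          by (simp add: kron_add_left adj_add mmult_add_left add_zero_mat r[OF a(2,3,1)] annihD[OF v a(2,3,1)] annihD[OF w a(2,3,1)])
      qed (simp add: carrier_mat_iff)
    qed
    show "k \<cdot>\<^sub>m v \<in> annih \<rho> U" for k
    proof -
      show ?thesis
      proof (rule annihI)
        fix N P assume a: "1 \<le> N" "P \<in> U" "P \<in> herm_pairs N"
        show "adj (kron (k \<cdot>\<^sub>m v) (1\<^sub>m N)) * (resolvent \<rho> N P * kron (rl_C \<rho>) (1\<^sub>m N)) = 0\<^sub>m N N"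
          by (simp add: kron_smult_left adj_smult mmult_smult_left r[OF a(2,3,1)] annihD[OF v a(2,3,1)])
      qed (simp add: carrier_mat_iff)
    qed
  qed
qed

definition "base_pencil = pencil \<rho> 1 p0"
definition "base_resolvent = resolvent \<rho> 1 p0"

lemma base_inverse:
  "base_pencil \<in> carrier_mat (rl_dim \<rho>) (rl_dim \<rho>)" "base_resolvent \<in> carrier_mat (rl_dim \<rho>) (rl_dim \<rho>)"
  "base_pencil * base_resolvent = 1\<^sub>m (rl_dim \<rho>)" "base_resolvent * base_pencil = 1\<^sub>m (rl_dim \<rho>)" "adj base_pencil = base_pencil" "adj base_resolvent = base_resolvent"
proof -
  note j = join_herm(1)[OF p0(2)] and d = U_det[OF p0 order_refl]
  show 1: "base_pencil \<in> carrier_mat (rl_dim \<rho>) (rl_dim \<rho>)" using pencil_carrier[OF \<rho> j] by (simp add: base_pencil_def)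
  show 2: "base_resolvent \<in> carrier_mat (rl_dim \<rho>) (rl_dim \<rho>)" "base_pencil * base_resolvent = 1\<^sub>m (rl_dim \<rho>)" "base_resolvent * base_pencil = 1\<^sub>m (rl_dim \<rho>)"
    using resolvent_inverse[OF \<rho> j d] by (simp_all add: base_pencil_def base_resolvent_def)
  show 3: "adj base_pencil = base_pencil" unfolding base_pencil_def by (rule pencil_hermitian[OF \<rho> p0(2)])
  show "adj base_resolvent = base_resolvent" by (rule hermitian_inverse[OF 1 2(1,2) 3])
qed

text \<open>First-order expansion at \<open>p \<oplus> P\<close> in an off-diagonal hermitian
  direction, read off in the upper right corner. The gain is that \<open>q\<close> is arbitrary and
  rectangular and that two different points enter.\<close>

lemma annih_corner:
  assumes u: "u \<in> annih \<rho> U" and p: "p \<in> U" "p \<in> herm_pairs n" "1 \<le> n" and P: "P \<in> U" "P \<in> herm_pairs N" "1 \<le> N"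
    and q: "\<And>i. q i \<in> carrier_mat n N"
  shows "adj (kron u (1\<^sub>m n)) * (resolvent \<rho> n p * (rl_lin \<rho> n N q *
     (resolvent \<rho> N P * kron (rl_C \<rho>) (1\<^sub>m N)))) = 0\<^sub>m n N"
proof -
  let ?e = "rl_dim \<rho>"
  note r = rl_carriers[OF \<rho>]
  have uc: "u \<in> carrier_mat ?e 1" using u by (auto simp: annih_def)
  note jp = join_herm(1)[OF p(2)] and jP = join_herm(1)[OF P(2)]
  note dp = U_det[OF p] and dP = U_det[OF P]
  note ip = resolvent_inverse[OF \<rho> jp dp] and iP = resolvent_inverse[OF \<rho> jP dP]
  have Q: "pair_dsum p P \<in> U" "pair_dsum p P \<in> herm_pairs (n + N)" "1 \<le> n + N"
    using free_set_dsum[OF free p(1) P(1)] herm_pairs_dsum[OF p(2) P(2)] p(3) by simp_all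
  note iQ = resolvent_inverse[OF \<rho> join_herm(1)[OF Q(2)] U_det[OF Q]]
  define X where "X = resolvent \<rho> N P * kron (rl_C \<rho>) (1\<^sub>m N)"
  have Xc: "X \<in> carrier_mat (?e * N) N"
    unfolding X_def using mult_carrier_mat[OF iP(1) kron_carrier[OF r(7) one_carrier_mat]] by simp
  note [simp] = carrier_matD[OF uc] carrier_matD[OF Xc] carrier_matD[OF ip(1)] carrier_matD[OF iP(1)] carrier_matD[OF iQ(1)]
  let ?M = "rl_lin \<rho> (n + N) (n + N) (offdiag n N q)"
  let ?C = "kron (rl_C \<rho>) (1\<^sub>m (n + N))" and ?R = "resolvent \<rho> (n + N) (pair_dsum p P)" and ?B = "adj (kron u (1\<^sub>m (n + N)))"
  have B: "?B \<in> carrier_mat (n + N) (?e * (n + N))" by (simp add: carrier_mat_iff)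
  have z: "?B * (?R * (?M * (?R * ?C))) = 0\<^sub>m (n + N) (n + N)"
    by (rule first_order_vanishing[where q = "offdiag n N q", OF \<rho> op dom Q(3) Q(1,2)
        offdiag_hermitian(1)[where q = q, OF q] offdiag_hermitian(2)[where q = q, OF q] B])
      (rule annihD[OF u _ _ Q(3)])
  have 1: "?C * inr_mat n N = ampl ?e (inr_mat n N) * kron (rl_C \<rho>) (1\<^sub>m N)"
    by (rule kron_ampl_one[OF r(7) inlr_carrier(2)])
  note s = resolvent_dsum_ampl[OF \<rho> jp jP dp dP]
  have 2: "?R * (?C * inr_mat n N) = ampl ?e (inr_mat n N) * X"
    unfolding 1 X_def by (subst mult_eq_assoc[OF s(1)]) (simp_all add: mmult_assoc)
  have 3: "?M * (?R * (?C * inr_mat n N)) = ampl ?e (inl_mat n N) * (rl_lin \<rho> n N q * X)"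
    unfolding 2 by (subst mult_eq_assoc[OF lin_offdiag_inr[where q = q, OF r(4) q]]) (simp_all add: mmult_assoc)
  define Y where "Y = rl_lin \<rho> n N q * X"
  have [simp]: "dim_row Y = ?e * n" "dim_col Y = N" by (simp_all add: Y_def)
  have 4: "?R * (ampl ?e (inl_mat n N) * Y) = ampl ?e (inl_mat n N) * (resolvent \<rho> n p * Y)"
    by (subst mult_eq_assoc[OF s(2)]) (simp_all add: mmult_assoc)
  have "kron u (1\<^sub>m (n + N)) * inl_mat n N = ampl ?e (inl_mat n N) * kron u (1\<^sub>m n)"
    by (rule kron_ampl_one[OF uc inlr_carrier(1)])
  then have "adj (kron u (1\<^sub>m (n + N)) * inl_mat n N) = adj (ampl ?e (inl_mat n N) * kron u (1\<^sub>m n))" by simp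
  then have 5: "adj (inl_mat n N) * ?B = adj (kron u (1\<^sub>m n)) * ampl ?e (adj (inl_mat n N))"
    by (simp add: adj_mult adj_ampl)
  have "adj (inl_mat n N) * (?B * (?R * (?M * (?R * (?C * inr_mat n N))))) = adj (inl_mat n N) * (?B * (?R * (?M * (?R * ?C))) * inr_mat n N)"
    by (simp add: mmult_assoc)
  also have "\<dots> = 0\<^sub>m n N" unfolding z by (simp add: mat_algebra)
  finally have "adj (inl_mat n N) * (?B * (ampl ?e (inl_mat n N) * (resolvent \<rho> n p * Y))) = 0\<^sub>m n N"
    unfolding 3 Y_def[symmetric] 4 .
  then have "adj (kron u (1\<^sub>m n)) * (ampl ?e (adj (inl_mat n N)) * (ampl ?e (inl_mat n N) * (resolvent \<rho> n p * Y))) = 0\<^sub>m n N"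
    by (subst (asm) mult_eq_assoc[OF 5]) (simp_all add: mmult_assoc)
  then show ?thesis
    by (simp add: ampl_mult_left inlr mmult_one Y_def X_def)
qed

text \<open>The corner identity at \<open>p0\<close> for a direction with a single nonzero
  component, a row \<open>h\<close>. As \<open>h\<close> is arbitrary, the coefficient and the
  resolvent at \<open>p0\<close> can be moved to the side of \<open>u\<close>.\<close>

lemma annih_coeffs:
  assumes u: "u \<in> annih \<rho> U"
  shows "coeffs \<rho> k * (base_resolvent * u) \<in> annih \<rho> U"
proof -
  let ?e = "rl_dim \<rho>"
  note r = rl_carriers[OF \<rho>]
  have uc: "u \<in> carrier_mat ?e 1" using u by (auto simp: annih_def)
  note [simp] = carrier_matD[OF uc] carrier_matD[OF base_inverse(2)] r(4)[unfolded carrier_mat_iff]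
  define v where "v = coeffs \<rho> k * (base_resolvent * u)"
  have vc: "v \<in> carrier_mat ?e 1" by (simp add: v_def carrier_mat_iff)
  note [simp] = carrier_matD[OF vc]
  have av: "adj v = adj u * (base_resolvent * coeffs \<rho> k)" by (simp add: v_def mat_algebra r(5) base_inverse(6))
  have "adj (kron v (1\<^sub>m N)) * (resolvent \<rho> N P * kron (rl_C \<rho>) (1\<^sub>m N)) = 0\<^sub>m N N"
    if N: "1 \<le> N" and P: "P \<in> U" "P \<in> herm_pairs N" for N P
  proof -
    note iP = resolvent_inverse[OF \<rho> join_herm(1)[OF P(2)] U_det[OF P N]]
    define X where "X = resolvent \<rho> N P * kron (rl_C \<rho>) (1\<^sub>m N)"
    have Xc: "X \<in> carrier_mat (?e * N) N"
      unfolding X_def using mult_carrier_mat[OF iP(1) kron_carrier[OF r(7) one_carrier_mat]] by simp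
    note [simp] = carrier_matD[OF Xc]
    have hz: "h * (adj (kron v (1\<^sub>m N)) * X) = 0\<^sub>m 1 N" if h: "h \<in> carrier_mat 1 N" for h
    proof -
      note [simp] = carrier_matD[OF h]
      define q where "q = (\<lambda>j. if j = k then h else 0\<^sub>m 1 N)"
      have q: "q j \<in> carrier_mat 1 N" for j using h by (simp add: q_def)
      have 6: "adj u * (base_resolvent * (rl_lin \<rho> 1 N q * X)) = 0\<^sub>m 1 N"
        using annih_corner[where q = q, OF u p0 order_refl P N q] by (simp add: X_def base_resolvent_def)
      have "kron (coeffs \<rho> j) (q j) = (if j = k then kron (coeffs \<rho> k) h else 0\<^sub>m (?e * 1) (?e * N))" for j
        by (simp add: q_def kron_zero)
      then have "rl_lin \<rho> 1 N q = kron (coeffs \<rho> k) h"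
        unfolding lin_def by (intro eq_matI) (auto simp: index_mat_sum if_distrib[of "\<lambda>A. A $$ _"] cong: if_cong)
      then have "adj u * (base_resolvent * (kron (coeffs \<rho> k) h * X)) = 0\<^sub>m 1 N" using 6 by simp
      moreover have "adj u * (base_resolvent * (kron (coeffs \<rho> k) h * X)) = kron (adj v) h * X"
      proof -
        have "kron (adj v) h = kron (adj u * base_resolvent) (1\<^sub>m 1) * kron (coeffs \<rho> k) h"
          by (subst kron_mult) (simp_all add: av mat_algebra)
        then show ?thesis by (simp add: mmult_assoc)
      qed
      moreover have "h * (adj (kron v (1\<^sub>m N)) * X) = kron (adj v) h * X"
      proof -
        have "kron (1\<^sub>m 1) h = h" by (rule eq_matI) (auto simp: index_kron)
        then have "h * kron (adj v) (1\<^sub>m N) = kron (1\<^sub>m 1) h * kron (adj v) (1\<^sub>m N)" by simp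
        also have "\<dots> = kron (adj v) h" by (subst kron_mult) (simp_all add: mat_algebra)
        finally have "h * (kron (adj v) (1\<^sub>m N) * X) = kron (adj v) h * X" by (intro mult_eq_assoc) simp_all
        then show ?thesis by (simp add: adj_kron)
      qed
      ultimately show ?thesis by simp
    qed
    have "adj (kron v (1\<^sub>m N)) * X = 0\<^sub>m N N"
    proof (rule mat_zero_by_rows)
      show "adj (kron v (1\<^sub>m N)) * X \<in> carrier_mat N N" by (rule carrier_matI) simp_all
    qed (rule hz)
    then show ?thesis by (simp add: X_def)
  qed
  then show ?thesis unfolding v_def[symmetric] by (intro annihI[OF vc])
qed

text \<open>\<open>J\<close> is the pencil at \<open>p0\<close> plus a scalar combination of the
  coefficients, so \<open>J L(p0)\<inverse> u\<close> is \<open>u\<close> plus a combination of the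
  vectors of \<open>annih_coeffs\<close>.\<close>

lemma annih_J:
  assumes u: "u \<in> annih \<rho> U"
  shows "rl_J \<rho> * (base_resolvent * u) \<in> annih \<rho> U"
proof -
  let ?e = "rl_dim \<rho>"
  note r = rl_carriers[OF \<rho>] and j = join_herm(1)[OF p0(2)]
  have uc: "u \<in> carrier_mat ?e 1" using u by (auto simp: annih_def)
  note [simp] = carrier_matD[OF uc] carrier_matD[OF base_inverse(1)] carrier_matD[OF base_inverse(2)] r(1,4)[unfolded carrier_mat_iff]
    j[unfolded carrier_mat_iff]
  have "base_pencil = rl_J \<rho> - lin ?e ?e (coeffs \<rho>) (join p0)" using pencil_lin[OF \<rho> j] by (simp add: base_pencil_def)
  then have J: "rl_J \<rho> = base_pencil + lin ?e ?e (coeffs \<rho>) (join p0)" by (intro eq_matI) auto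
  have "rl_J \<rho> * (base_resolvent * u) = u + lin ?e ?e (coeffs \<rho>) (join p0) * (base_resolvent * u)"
    by (subst J) (simp add: mat_algebra mult_eq_assoc[OF base_inverse(3)])
  also have "lin ?e ?e (coeffs \<rho>) (join p0) * (base_resolvent * u) = mat_sum ?e 1 (\<lambda>k. kron (coeffs \<rho> k) (join p0 k) * (base_resolvent * u))"
    unfolding lin_def by (rule mat_sum_mult_right) (simp_all add: carrier_mat_iff)
  finally have e: "rl_J \<rho> * (base_resolvent * u) = u + mat_sum ?e 1 (\<lambda>k. kron (coeffs \<rho> k) (join p0 k) * (base_resolvent * u))" .
  have "mat_sum ?e 1 (\<lambda>k. kron (coeffs \<rho> k) (join p0 k) * (base_resolvent * u)) \<in> annih \<rho> U"
  proof (rule mat_sum_subspace[OF annih_subspace])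
    fix k
    have "kron (coeffs \<rho> k) (join p0 k) = join p0 k $$ (0, 0) \<cdot>\<^sub>m coeffs \<rho> k"
      by (rule eq_matI) (simp_all add: index_kron)
    then have "kron (coeffs \<rho> k) (join p0 k) * (base_resolvent * u) = join p0 k $$ (0, 0) \<cdot>\<^sub>m (coeffs \<rho> k * (base_resolvent * u))"
      by (simp add: mmult_smult_left)
    then show "kron (coeffs \<rho> k) (join p0 k) * (base_resolvent * u) \<in> annih \<rho> U"
      using annih_coeffs[OF u, of k] annih_subspace by (simp add: col_subspace_def)
  qed
  then show ?thesis
    unfolding e using u annih_subspace by (simp add: col_subspace_def)
qed

text \<open>\<open>J L(p0)\<inverse>\<close> is invertible and preserves the finite-dimensional
  space \<open>annih\<close>, so its inverse \<open>L(p0) J\<close> preserves it as well.\<close>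

lemma annih_base_pencil_J:
  assumes u: "u \<in> annih \<rho> U"
  shows "base_pencil * (rl_J \<rho> * u) \<in> annih \<rho> U"
proof -
  let ?e = "rl_dim \<rho>"
  note r = rl_carriers[OF \<rho>]
  obtain V d where V: "V \<in> carrier_mat ?e d" "adj V * V = 1\<^sub>m d" "\<And>v. v \<in> carrier_mat d 1 \<Longrightarrow> V * v \<in> annih \<rho> U"
    "\<And>w. w \<in> annih \<rho> U \<Longrightarrow> V * (adj V * w) = w" using subspace_basis[OF annih_subspace] by blast
  have uc: "u \<in> carrier_mat ?e 1" using u by (auto simp: annih_def)
  note [simp] = carrier_matD[OF uc] carrier_matD[OF base_inverse(1)] carrier_matD[OF base_inverse(2)] r(1)[unfolded carrier_mat_iff]
    carrier_matD[OF V(1)]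
  have "rl_J \<rho> * base_resolvent * V = V * (adj V * (rl_J \<rho> * base_resolvent * V))"
  proof (rule mat_eq_vecI)
    fix x :: "complex mat" assume x: "x \<in> carrier_mat d 1"
    note [simp] = carrier_matD[OF x]
    have "V * (adj V * (rl_J \<rho> * (base_resolvent * (V * x)))) = rl_J \<rho> * (base_resolvent * (V * x))"
      by (rule V(4)[OF annih_J[OF V(3)[OF x]]])
    then show "rl_J \<rho> * base_resolvent * V * x = V * (adj V * (rl_J \<rho> * base_resolvent * V)) * x" by (simp add: mmult_assoc)
  qed (simp_all add: carrier_mat_iff)
  moreover have "base_pencil * rl_J \<rho> * (rl_J \<rho> * base_resolvent) = 1\<^sub>m ?e"
    by (simp add: mat_algebra mult_eq_assoc[OF r(3)] base_inverse(3))
  moreover have "rl_J \<rho> * base_resolvent \<in> carrier_mat ?e ?e" "base_pencil * rl_J \<rho> \<in> carrier_mat ?e ?e" by (simp_all add: carrier_mat_iff)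
  ultimately have "base_pencil * rl_J \<rho> * V = V * (adj V * (base_pencil * rl_J \<rho> * V))"
    using inverse_invariant[OF V(1) _ _ V(2), of "rl_J \<rho> * base_resolvent" "base_pencil * rl_J \<rho>"] by blast
  then have LV: "base_pencil * (rl_J \<rho> * V) = V * (adj V * (base_pencil * (rl_J \<rho> * V)))" by (simp add: mmult_assoc)
  have "base_pencil * (rl_J \<rho> * (V * (adj V * u))) = base_pencil * (rl_J \<rho> * V) * (adj V * u)" by (simp add: mmult_assoc)
  also have "\<dots> = V * (adj V * (base_pencil * (rl_J \<rho> * V))) * (adj V * u)" by (subst LV) (rule refl)
  also have "\<dots> = V * (adj V * (base_pencil * (rl_J \<rho> * (V * (adj V * u)))))" by (simp add: mmult_assoc)
  finally have "base_pencil * (rl_J \<rho> * u) = V * (adj V * (base_pencil * (rl_J \<rho> * u)))" unfolding V(4)[OF u] .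
  moreover have "V * (adj V * (base_pencil * (rl_J \<rho> * u))) \<in> annih \<rho> U" by (rule V(3)) (simp add: carrier_mat_iff)
  ultimately show ?thesis by simp
qed

text \<open>Inserting \<open>L(p0) J u\<close> into \<open>annih_coeffs\<close> cancels the base
  resolvent; the invariance no longer refers to \<open>p0\<close>, as the comparison with minimality
  requires.\<close>

lemma annih_coeffs_J:
  assumes u: "u \<in> annih \<rho> U"
  shows "coeffs \<rho> k * (rl_J \<rho> * u) \<in> annih \<rho> U"
proof -
  note r = rl_carriers[OF \<rho>]
  have uc: "u \<in> carrier_mat (rl_dim \<rho>) 1" using u by (auto simp: annih_def)
  note [simp] = carrier_matD[OF uc] carrier_matD[OF base_inverse(1)] carrier_matD[OF base_inverse(2)] r(1)[unfolded carrier_mat_iff]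
  have "base_resolvent * (base_pencil * (rl_J \<rho> * u)) = rl_J \<rho> * u" by (simp add: mult_eq_assoc[OF base_inverse(4)] mat_algebra)
  then show ?thesis using annih_coeffs[OF annih_base_pencil_J[OF u], of k] by simp
qed

text \<open>The defining condition of \<open>annih\<close> at \<open>p0\<close> itself, for the
  vector \<open>L(p0) J u\<close>: pencil and resolvent cancel.\<close>

lemma annih_J_C:
  assumes u: "u \<in> annih \<rho> U"
  shows "adj u * (rl_J \<rho> * rl_C \<rho>) = 0\<^sub>m 1 1"
proof -
  note r = rl_carriers[OF \<rho>]
  have uc: "u \<in> carrier_mat (rl_dim \<rho>) 1" using u by (auto simp: annih_def)
  note [simp] = carrier_matD[OF uc] carrier_matD[OF base_inverse(1)] carrier_matD[OF base_inverse(2)] r(1)[unfolded carrier_mat_iff]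
  have "adj (base_pencil * (rl_J \<rho> * u)) * (base_resolvent * rl_C \<rho>) = 0\<^sub>m 1 1"
    using annihD[OF annih_base_pencil_J[OF u] p0 order_refl] by (simp add: base_resolvent_def)
  moreover have "adj (base_pencil * (rl_J \<rho> * u)) * (base_resolvent * rl_C \<rho>) = adj u * (rl_J \<rho> * rl_C \<rho>)"
    by (simp add: mat_algebra base_inverse(5) r(2) mult_eq_assoc[OF base_inverse(3)])
  ultimately show ?thesis by simp
qed

text \<open>The orthogonal complement of \<open>annih\<close> is invariant under all
  \<open>J T\<^sub>i\<close> and \<open>J S\<^sub>j\<close>, by the adjoint form of
  \<open>annih_coeffs_J\<close>, and contains \<open>J c\<close>. By minimality it is the whole
  space, so \<open>u\<close> is orthogonal to itself.\<close>

lemma annih_trivial: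
  assumes smr: "is_SMR r \<rho>" and u: "u \<in> annih \<rho> U"
  shows "u = 0\<^sub>m (rl_dim \<rho>) 1"
proof -
  let ?e = "rl_dim \<rho>" and ?J = "rl_J \<rho>"
  note r = rl_carriers[OF \<rho>]
  define W where "W = {w \<in> carrier_mat ?e 1. \<forall>u\<in>annih \<rho> U. adj u * w = 0\<^sub>m 1 1}"
  have ac: "dim_row u = ?e" "dim_col u = 1" if "u \<in> annih \<rho> U" for u using that by (auto simp: annih_def)
  have WI: "w \<in> W" if "w \<in> carrier_mat ?e 1" "\<And>u. u \<in> annih \<rho> U \<Longrightarrow> adj u * w = 0\<^sub>m 1 1" for w
    using that by (simp add: W_def)
  have Wc: "dim_row w = ?e" "dim_col w = 1" if "w \<in> W" for w
    using that by (auto simp: W_def)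
  have WD: "adj u * w = 0\<^sub>m 1 1" if "w \<in> W" "u \<in> annih \<rho> U" for u w
    using that unfolding W_def by blast
  have W: "col_subspace ?e W"
    unfolding col_subspace_def
  proof (intro conjI ballI allI)
    show "W \<subseteq> carrier_mat ?e 1" by (auto simp: W_def)
    show "0\<^sub>m ?e 1 \<in> W"
      by (rule WI[OF zero_carrier_mat], subst mmult_zero(2)) (simp_all add: ac)
    fix v assume v: "v \<in> W"
    note [simp] = Wc[OF v]
    show "v + w \<in> W" if w: "w \<in> W" for w
    proof (rule WI)
      note [simp] = Wc[OF w]
      show "v + w \<in> carrier_mat ?e 1" by (simp add: carrier_mat_iff)
      fix u assume u: "u \<in> annih \<rho> U"
      show "adj u * (v + w) = 0\<^sub>m 1 1"
        by (subst mmult_add_right) (simp_all add: ac[OF u] WD[OF v u] WD[OF w u])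
    qed
    show "k \<cdot>\<^sub>m v \<in> W" for k
    proof (rule WI)
      show "k \<cdot>\<^sub>m v \<in> carrier_mat ?e 1" by (simp add: carrier_mat_iff)
      fix u assume u: "u \<in> annih \<rho> U"
      show "adj u * (k \<cdot>\<^sub>m v) = 0\<^sub>m 1 1"
        by (subst mmult_smult_right) (simp_all add: ac[OF u] WD[OF v u])
    qed
  qed
  obtain V d where V: "V \<in> carrier_mat ?e d" "adj V * V = 1\<^sub>m d" "\<And>v. v \<in> carrier_mat d 1 \<Longrightarrow> V * v \<in> W"
    "\<And>w. w \<in> W \<Longrightarrow> V * (adj V * w) = w" using subspace_basis[OF W] by blast
  note [simp] = r(1,4,7)[unfolded carrier_mat_iff] carrier_matD[OF V(1)]
  have inv1: "?J * (coeffs \<rho> i * V) = V * (adj V * (?J * (coeffs \<rho> i * V)))" for i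
  proof (rule mat_eq_vecI)
    fix x :: "complex mat" assume x: "x \<in> carrier_mat d 1"
    note [simp] = carrier_matD[OF x]
    have "?J * (coeffs \<rho> i * (V * x)) \<in> W"
    proof (rule WI)
      fix u assume u: "u \<in> annih \<rho> U"
      note [simp] = ac[OF u]
      have "adj (coeffs \<rho> i * (?J * u)) * (V * x) = 0\<^sub>m 1 1" by (rule WD[OF V(3)[OF x] annih_coeffs_J[OF u]])
      then show "adj u * (?J * (coeffs \<rho> i * (V * x))) = 0\<^sub>m 1 1" by (simp add: mat_algebra r(2,5))
    qed (simp add: carrier_mat_iff)
    from V(4)[OF this] show "?J * (coeffs \<rho> i * V) * x = V * (adj V * (?J * (coeffs \<rho> i * V))) * x"
      by (simp add: mmult_assoc)
  qed (simp_all add: carrier_mat_iff)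
  have "?J * rl_C \<rho> \<in> W" by (rule WI[OF _ annih_J_C]) (simp_all add: carrier_mat_iff)
  from V(4)[OF this] have inv2: "?J * rl_C \<rho> = V * (adj V * (?J * rl_C \<rho>))" by simp
  have "d = ?e" using SMR_minimal[OF smr V(1,2) inv1 inv2] isometry_dim[OF V(1,2)] by simp
  then have VV: "V * adj V = 1\<^sub>m ?e" using right_inverse_imp_left[of "adj V" ?e V] V(1,2) by simp
  note [simp] = ac[OF u]
  have "V * (adj V * u) \<in> W" by (rule V(3)) (simp add: carrier_mat_iff)
  then have "u \<in> W" by (simp add: mult_eq_assoc[OF VV] mmult_one)
  then have "adj u * u = 0\<^sub>m 1 1" using u by (simp add: W_def)
  then show ?thesis by (rule adj_self_eq_0[rotated]) (simp add: carrier_mat_iff)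
qed

end

section \<open>Second-order expansion\<close>

text \<open>A direction in x extended by zero in the variables a, since convexity in x controls only
  such directions.\<close>

definition xdir :: "nat \<Rightarrow> nat \<Rightarrow> ('g \<Rightarrow> complex mat) \<Rightarrow> 'g + 'h \<Rightarrow> complex mat" where
  "xdir n m h = case_sum h (\<lambda>_. 0\<^sub>m n m)"

lemma xdir_carrier: "(\<And>i. h i \<in> carrier_mat n m) \<Longrightarrow> xdir n m h k \<in> carrier_mat n m"
  by (cases k) (simp_all add: xdir_def)

lemma xdir_hermitian: "(\<And>i. adj (h i) = h i) \<Longrightarrow> adj (xdir n n h k) = xdir n n h k"
  by (cases k) (simp_all add: xdir_def)

text \<open>Midpoint convexity at \<open>X - t h\<close>, \<open>X\<close>, \<open>X + t h\<close>,
  which openness of the fibre keeps in \<open>D\<close>. The exact second difference, tested on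
  \<open>\<xi>\<close>, is \<open>t\<^sup>2 / 2\<close> times the form of the sum of the outer
  resolvents at \<open>y\<close>; division by this factor and the limit leave twice the form of the
  resolvent at \<open>(A, X)\<close>.\<close>

lemma second_order_nonneg:
  fixes \<rho> :: "('h::finite, 'g::finite) realization"
  assumes \<rho>: "sym_realization \<rho>" and D: "domain_of_partial_convexity \<rho> D"
    and n: "1 \<le> n" and pD: "(A, X) \<in> D" and p: "(A, X) \<in> herm_pairs n"
    and h: "\<And>i. h i \<in> carrier_mat n n" "\<And>i. adj (h i) = h i" and \<xi>: "\<xi> \<in> carrier_mat n 1"
  defines "y \<equiv> rl_lin \<rho> n n (xdir n n h) * (resolvent \<rho> n (A, X) * (kron (rl_C \<rho>) (1\<^sub>m n) * \<xi>))"
  shows "0 \<le> qform (resolvent \<rho> n (A, X)) y"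
proof -
  let ?N = "rl_dim \<rho> * n" and ?C = "kron (rl_C \<rho>) (1\<^sub>m n)"
  define q where "q = (xdir n n h :: 'g + 'h \<Rightarrow> complex mat)"
  define M where "M = lin ?N ?N (coeffs \<rho>) q"
  have q: "q k \<in> carrier_mat n n" "adj (q k) = q k" for k
    unfolding q_def by (rule xdir_carrier[OF h(1)]) (rule xdir_hermitian[OF h(2)])
  have M: "M \<in> carrier_mat ?N ?N" "adj M = M"
    unfolding M_def by (simp, subst adj_lin[OF rl_carriers(4)[OF \<rho>] q(1)]) (simp add: rl_carriers(5)[OF \<rho>] q(2))
  have Dr: "D \<subseteq> rl_dom \<rho>" and conv: "r_convex_in_x \<rho> D" and opn: "open_in_x D"
    using D by (simp_all add: domain_of_partial_convexity_def r_convex_in_x_def)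
  have A: "A \<in> herm_tuples n" and X: "X \<in> herm_tuples n" using p by (simp_all add: herm_pairs_def)
  have Xf: "X \<in> fiber D n A" using pD X by (simp add: fiber_def)
  note j = join_herm(1)[OF p]
  have d: "det (pencil \<rho> n (A, X)) \<noteq> 0" using rl_dom_iff[OF p n, of \<rho>] Dr pD by blast
  note i = resolvent_inverse[OF \<rho> j d] and C = rl_eval_eq(2)[OF \<rho> j d]
  note [simp] = carrier_matD[OF i(1)] carrier_matD[OF C] carrier_matD[OF M(1)] carrier_matD[OF \<xi>]
  have a: "adj (resolvent \<rho> n (A, X)) = resolvent \<rho> n (A, X)"
    by (rule hermitian_inverse[OF pencil_carrier[OF \<rho> j] i(1,2) pencil_hermitian[OF \<rho> p]])
  have Ac: "A k \<in> carrier_mat n n" for k using j[of "Inr k"] by (simp add: join_def)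
  have Xc: "X k \<in> carrier_mat n n" for k using j[of "Inl k"] by (simp add: join_def)
  define Xt where "Xt t = (\<lambda>i. X i + complex_of_real t \<cdot>\<^sub>m h i)" for t :: real
  have sh: "pair_shift (A, X) (complex_of_real t) q = (A, Xt t)" for t
  proof -
    have "A k + complex_of_real t \<cdot>\<^sub>m 0\<^sub>m n n = A k" for k
      using carrier_matD[OF Ac[of k]] by (intro eq_matI) auto
    then show ?thesis by (simp add: pair_shift_def q_def xdir_def Xt_def)
  qed
  have ht: "(A, Xt t) \<in> herm_pairs n" for t
    using herm_pairs_shift[where q = q, OF p q, of t] by (simp add: sh)
  then have Xth: "Xt t \<in> herm_tuples n" for t by (simp add: herm_pairs_def)
  have "open_tuples n (fiber D n A)" using opn n A by (simp add: open_in_x_def)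
  then obtain \<epsilon> where \<epsilon>: "0 < \<epsilon>" "\<And>Y. Y \<in> herm_tuples n \<Longrightarrow> tuple_close \<epsilon> n X Y \<Longrightarrow> Y \<in> fiber D n A"
    using Xf unfolding open_tuples_def by blast
  have close: "Xt t \<in> fiber D n A" if t: "\<forall>k. \<forall>a<n. \<forall>b<n. cmod (complex_of_real t * h k $$ (a, b)) < \<epsilon>" for t
  proof (rule \<epsilon>(2)[OF Xth])
    have hd: "dim_row (h k) = n" "dim_col (h k) = n" for k using h(1)[of k] by auto
    show "tuple_close \<epsilon> n X (Xt t)" unfolding tuple_close_def using t by (simp add: Xt_def hd)
  qed
  have l1: "((\<lambda>t. complex_of_real (- t)) \<longlongrightarrow> 0) (at_right 0)" by (auto intro!: tendsto_eq_intros)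
  note lp = resolvent_shift_lim[where q = q and f = complex_of_real, OF \<rho> j q(1) d tendsto_of_real_at_right, unfolded sh]
    and lm = resolvent_shift_lim[where q = q and f = "\<lambda>t. complex_of_real (- t)", OF \<rho> j q(1) d l1, unfolded sh]
  have yc: "y \<in> carrier_mat ?N 1" unfolding y_def q_def[symmetric] M_def[symmetric] by (rule carrier_matI) simp_all
  have "\<forall>\<^sub>F t in at_right 0. 0 \<le> qform (resolvent \<rho> n (A, Xt (- t)) + resolvent \<rho> n (A, Xt t)) y"
    using small_shift[OF \<epsilon>(1), of n h] lp(1) lm(1) eventually_at_right_less[of "0::real"]
  proof eventually_elim
    case (elim t)
    have f: "Xt t \<in> fiber D n A" "Xt (- t) \<in> fiber D n A"
      using close[of t] close[of "- t"] elim(1) by simp_all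
    have "tuple_comb (1/2) (Xt (- t)) (1/2) (Xt t) = X"
    proof (rule ext)
      fix k
      note [simp] = carrier_matD[OF Xc[of k]] carrier_matD[OF h(1)[of k]]
      show "tuple_comb (1/2) (Xt (- t)) (1/2) (Xt t) k = X k"
        by (rule eq_matI) (simp_all add: tuple_comb_def Xt_def field_simps)
    qed
    then have psd: "psd_mat n ((1/2) \<cdot>\<^sub>m (rl_eval \<rho> n (A, Xt (- t)) + rl_eval \<rho> n (A, Xt t)) - rl_eval \<rho> n (A, X))"
      using conv n A f Xf unfolding r_convex_in_x_def by metis
    note j' = join_herm(1)[OF ht[of t]] join_herm(1)[OF ht[of "- t"]]
    note i' = resolvent_inverse[OF \<rho> j'(1) elim(2)] and i'' = resolvent_inverse[OF \<rho> j'(2) elim(3)]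
    note [simp] = carrier_matD[OF i'(1)] carrier_matD[OF i''(1)]
    have L1: "pencil \<rho> n (A, X) = pencil \<rho> n (A, Xt t) + complex_of_real t \<cdot>\<^sub>m M"
      unfolding M_def using pencil_pair_shift[where q = q, OF \<rho> j q(1), of "complex_of_real t"] by (simp only: sh)
    have "pencil \<rho> n (A, X) = pencil \<rho> n (A, Xt (- t)) + complex_of_real (- t) \<cdot>\<^sub>m M"
      unfolding M_def using pencil_pair_shift[where q = q, OF \<rho> j q(1), of "complex_of_real (- t)"] by (simp only: sh)
    then have L2: "pencil \<rho> n (A, Xt (- t)) = pencil \<rho> n (A, X) + complex_of_real t \<cdot>\<^sub>m M"
      using carrier_matD[OF pencil_carrier[OF \<rho> j'(2)]] by (intro eq_matI) simp_all
    have tM: "complex_of_real t \<cdot>\<^sub>m M \<in> carrier_mat ?N ?N" using M(1) by simp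
    define S where "S = resolvent \<rho> n (A, Xt (- t)) + resolvent \<rho> n (A, Xt t)"
    have S: "S \<in> carrier_mat ?N ?N" unfolding S_def by (rule carrier_matI) simp_all
    note [simp] = carrier_matD[OF S]
    define G where "G = M * (resolvent \<rho> n (A, X) * ?C)"
    have G: "G \<in> carrier_mat ?N n" unfolding G_def by (rule carrier_matI) simp_all
    note [simp] = carrier_matD[OF G]
    have "adj ?C * (resolvent \<rho> n (A, X) * (complex_of_real t \<cdot>\<^sub>m M * (S * (complex_of_real t \<cdot>\<^sub>m M * (resolvent \<rho> n (A, X) * ?C))))) =
       complex_of_real (t * t) \<cdot>\<^sub>m (adj G * (S * G))"
      unfolding G_def by (rule eq_matI) (simp_all add: mat_algebra a M(2) mult.assoc del: index_mult_mat(1))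
    then have "(1/2) \<cdot>\<^sub>m (rl_eval \<rho> n (A, Xt (- t)) + rl_eval \<rho> n (A, Xt t)) - rl_eval \<rho> n (A, X) =
      complex_of_real (1/2) \<cdot>\<^sub>m (complex_of_real (t * t) \<cdot>\<^sub>m (adj G * (S * G)))"
      using midpoint_difference[OF \<rho> j'(2,1) j elim(3,2) d tM L2 L1] unfolding S_def by (simp only:)
    with psd have "psd_mat n (complex_of_real (1/2) \<cdot>\<^sub>m (complex_of_real (t * t) \<cdot>\<^sub>m (adj G * (S * G))))" by (simp only:)
    from psd_qform[OF this \<xi>]
    have "0 \<le> 1/2 * (t * t * qform (adj G * (S * G)) \<xi>)"
      by (subst (asm) qform_smult[OF _ \<xi>], simp add: carrier_mat_iff, subst (asm) qform_smult[OF _ \<xi>], simp_all add: carrier_mat_iff)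
    then have "0 \<le> (t * t) * qform (adj G * (S * G)) \<xi>" by simp
    moreover have "0 < t * t" using elim(4) by simp
    ultimately have "0 \<le> qform (adj G * (S * G)) \<xi>" by (metis zero_le_mult_iff not_less)
    also have "qform (adj G * (S * G)) \<xi> = qform S (G * \<xi>)" by (rule qform_congruence[OF S G \<xi>])
    also have "G * \<xi> = y" by (simp add: G_def y_def q_def[symmetric] M_def[symmetric] mmult_assoc)
    finally show ?case by (simp add: S_def)
  qed
  moreover have "((\<lambda>t. qform (resolvent \<rho> n (A, Xt (- t)) + resolvent \<rho> n (A, Xt t)) y) \<longlongrightarrow>
      qform (resolvent \<rho> n (A, X) + resolvent \<rho> n (A, X)) y) (at_right 0)"
  proof -
    have "mat_lim (\<lambda>t. adj y * ((resolvent \<rho> n (A, Xt (- t)) + resolvent \<rho> n (A, Xt t)) * y))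
       (adj y * ((resolvent \<rho> n (A, X) + resolvent \<rho> n (A, X)) * y)) 1 1 (at_right 0)"
      by (rule mat_lim_mult[OF mat_lim_const[OF adj_carrier[OF yc]] mat_lim_mult[OF mat_lim_add[OF lm(2) lp(2)] mat_lim_const[OF yc]]])
    then show ?thesis unfolding qform_def mat_lim_def by (intro tendsto_Re) simp
  qed
  ultimately have "0 \<le> qform (resolvent \<rho> n (A, X) + resolvent \<rho> n (A, X)) y"
    using tendsto_lowerbound trivial_limit_at_right_real by blast
  then show ?thesis by (simp add: qform_add[OF i(1) i(1) yc])
qed

section \<open>Reachable directions\<close>

definition reach :: "('h::finite, 'g::finite) realization \<Rightarrow> ('h, 'g) pair set \<Rightarrow> nat \<Rightarrow> complex mat set" where
  "reach \<rho> U n = {y. \<exists>N P \<eta> h. 1 \<le> N \<and> P \<in> U \<and> P \<in> herm_pairs N \<and> \<eta> \<in> carrier_mat N 1 \<and> (\<forall>i. h i \<in> carrier_mat n N) \<and>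
     y = rl_lin \<rho> n N (xdir n N h) * (resolvent \<rho> N P * (kron (rl_C \<rho>) (1\<^sub>m N) * \<eta>))}"

lemma resolvent_dsum_apply:
  assumes \<rho>: "sym_realization \<rho>" and p: "\<And>i. join p i \<in> carrier_mat n n" and q: "\<And>i. join q i \<in> carrier_mat m m"
    and d: "det (pencil \<rho> n p) \<noteq> 0" "det (pencil \<rho> m q) \<noteq> 0"
  shows "\<eta> \<in> carrier_mat n k \<Longrightarrow> resolvent \<rho> (n + m) (pair_dsum p q) * (kron (rl_C \<rho>) (1\<^sub>m (n + m)) * (inl_mat n m * \<eta>)) =
      ampl (rl_dim \<rho>) (inl_mat n m) * (resolvent \<rho> n p * (kron (rl_C \<rho>) (1\<^sub>m n) * \<eta>))"
    "\<theta> \<in> carrier_mat m k \<Longrightarrow> resolvent \<rho> (n + m) (pair_dsum p q) * (kron (rl_C \<rho>) (1\<^sub>m (n + m)) * (inr_mat n m * \<theta>)) =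
      ampl (rl_dim \<rho>) (inr_mat n m) * (resolvent \<rho> m q * (kron (rl_C \<rho>) (1\<^sub>m m) * \<theta>))"
proof -
  note P = resolvent_inverse[OF \<rho> p d(1)] and Q = resolvent_inverse[OF \<rho> q d(2)]
  have jd: "join (pair_dsum p q) i \<in> carrier_mat (n + m) (n + m)" for i
    unfolding join_dsum[OF p q] using p[THEN carrier_matD(1)] q[THEN carrier_matD(1)] by (intro carrier_matI) simp_all
  note R = resolvent_inverse[OF \<rho> jd resolvent_dsum(1)[OF \<rho> p q d]]
  note [simp] = carrier_matD[OF P(1)] carrier_matD[OF Q(1)] carrier_matD[OF R(1)]
  note s = resolvent_dsum_ampl[OF \<rho> p q d] and k = kron_ampl_one[OF rl_carriers(7)[OF \<rho>] inlr_carrier(1)[of n m]]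
    kron_ampl_one[OF rl_carriers(7)[OF \<rho>] inlr_carrier(2)[of n m]]
  show "resolvent \<rho> (n + m) (pair_dsum p q) * (kron (rl_C \<rho>) (1\<^sub>m (n + m)) * (inl_mat n m * \<eta>)) =
      ampl (rl_dim \<rho>) (inl_mat n m) * (resolvent \<rho> n p * (kron (rl_C \<rho>) (1\<^sub>m n) * \<eta>))" if \<eta>: "\<eta> \<in> carrier_mat n k"
  proof -
    note [simp] = carrier_matD[OF \<eta>]
    have "kron (rl_C \<rho>) (1\<^sub>m (n + m)) * (inl_mat n m * \<eta>) = ampl (rl_dim \<rho>) (inl_mat n m) * (kron (rl_C \<rho>) (1\<^sub>m n) * \<eta>)"
      by (subst mult_eq_assoc[OF k(1)]) (simp_all add: mmult_assoc)
    then show ?thesis by (simp only:) (subst mult_eq_assoc[OF s(2)], simp_all add: mmult_assoc)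
  qed
  show "resolvent \<rho> (n + m) (pair_dsum p q) * (kron (rl_C \<rho>) (1\<^sub>m (n + m)) * (inr_mat n m * \<theta>)) =
      ampl (rl_dim \<rho>) (inr_mat n m) * (resolvent \<rho> m q * (kron (rl_C \<rho>) (1\<^sub>m m) * \<theta>))" if \<theta>: "\<theta> \<in> carrier_mat m k"
  proof -
    note [simp] = carrier_matD[OF \<theta>]
    have "kron (rl_C \<rho>) (1\<^sub>m (n + m)) * (inr_mat n m * \<theta>) = ampl (rl_dim \<rho>) (inr_mat n m) * (kron (rl_C \<rho>) (1\<^sub>m m) * \<theta>)"
      by (subst mult_eq_assoc[OF k(2)]) (simp_all add: mmult_assoc)
    then show ?thesis by (simp only:) (subst mult_eq_assoc[OF s(1)], simp_all add: mmult_assoc)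
  qed
qed

text \<open>A unit vector \<open>z\<close> selects the entries of \<open>Y\<close> with a given
  position in the second Kronecker factor, so the slices together exhaust \<open>Y\<close>.\<close>

lemma ampl_adj_zero:
  assumes Y: "Y \<in> carrier_mat (d * n) 1" and z: "\<And>z. z \<in> carrier_mat n 1 \<Longrightarrow> ampl d (adj z) * Y = 0\<^sub>m d 1"
  shows "Y = 0\<^sub>m (d * n) 1"
proof (rule eq_matI)
  note [simp] = carrier_matD[OF Y]
  fix i j assume "i < dim_row (0\<^sub>m (d * n) 1 :: complex mat)" "j < dim_col (0\<^sub>m (d * n) 1 :: complex mat)"
  then have i: "i < d * n" and j: "j = 0" by auto
  note im = div_mod_less[OF i]
  define z where "z = mat n 1 (\<lambda>(k, l). if k = i mod n then 1 else 0 :: complex)"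
  have zc: "z \<in> carrier_mat n 1" by (simp add: z_def)
  note [simp] = carrier_matD[OF zc]
  have "0 = (ampl d (adj z) * Y) $$ (i div n, 0)" using assms(2)[OF zc] im by simp
  also have "\<dots> = (\<Sum>k = 0..<d * n. ampl d (adj z) $$ (i div n, k) * Y $$ (k, 0))"
    using im by (simp add: scalar_prod_def)
  also have "\<dots> = (\<Sum>k = 0..<d * n. if k = i then Y $$ (k, 0) else 0)"
  proof (rule sum.cong[OF refl])
    fix k assume "k \<in> {0..<d * n}"
    then have k: "k < d * n" by simp
    note km = div_mod_less[OF k]
    have "k = i \<longleftrightarrow> k div n = i div n \<and> k mod n = i mod n" by (metis div_mult_mod_eq)
    then show "ampl d (adj z) $$ (i div n, k) * Y $$ (k, 0) = (if k = i then Y $$ (k, 0) else 0)"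
      using im k km by (auto simp: ampl_def index_kron z_def)
  qed
  also have "\<dots> = Y $$ (i, 0)" using i by simp
  finally show "Y $$ (i, j) = 0\<^sub>m (d * n) 1 $$ (i, j)" using i j by simp
qed (use Y in auto)

context free_open_subdomain
begin

lemma reach_subspace: "col_subspace (rl_dim \<rho> * n) (reach \<rho> U n)"
proof -
  let ?e = "rl_dim \<rho>"
  note r = rl_carriers[OF \<rho>]
  have rd: "dim_row (resolvent \<rho> N P) = ?e * N" "dim_col (resolvent \<rho> N P) = ?e * N"
    if "P \<in> U" "P \<in> herm_pairs N" "1 \<le> N" for P N
    using carrier_matD[OF resolvent_inverse(1)[OF \<rho> join_herm(1)[OF that(2)] U_det[OF that]]] by simp_all
  show ?thesis
    unfolding col_subspace_def
  proof (intro conjI ballI allI)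
    show "reach \<rho> U n \<subseteq> carrier_mat (?e * n) 1"
    proof
      fix y assume "y \<in> reach \<rho> U n"
      then obtain N P \<eta> h where *: "1 \<le> N" "P \<in> U" "P \<in> herm_pairs N" "\<eta> \<in> carrier_mat N 1"
        "y = rl_lin \<rho> n N (xdir n N h) * (resolvent \<rho> N P * (kron (rl_C \<rho>) (1\<^sub>m N) * \<eta>))"
        unfolding reach_def by blast
      show "y \<in> carrier_mat (?e * n) 1" unfolding *(5) using *(4) by (intro carrier_matI) simp_all
    qed
    \<comment> \<open>Even zero needs some point of \<open>U\<close> as a witness; the scalar point
      is at hand.\<close>
    have "0\<^sub>m (?e * n) 1 = rl_lin \<rho> n 1 (xdir n 1 (\<lambda>_. 0\<^sub>m n 1)) *
        (resolvent \<rho> 1 p0 * (kron (rl_C \<rho>) (1\<^sub>m 1) * 0\<^sub>m 1 1))"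
      using rd[OF p0 order_refl] by (simp add: mmult_zero)
    then show "0\<^sub>m (?e * n) 1 \<in> reach \<rho> U n"
      unfolding reach_def mem_Collect_eq using p0
      by (intro exI[of _ 1] exI[of _ p0] exI[of _ "0\<^sub>m 1 1"] exI[of _ "\<lambda>_. 0\<^sub>m n 1"] conjI allI) simp_all
    fix y assume "y \<in> reach \<rho> U n"
    then obtain N P \<eta> h where N: "1 \<le> N" "P \<in> U" "P \<in> herm_pairs N" and \<eta>: "\<eta> \<in> carrier_mat N 1" and h: "\<And>i. h i \<in> carrier_mat n N"
      and y: "y = rl_lin \<rho> n N (xdir n N h) * (resolvent \<rho> N P * (kron (rl_C \<rho>) (1\<^sub>m N) * \<eta>))"
      unfolding reach_def by blast
    note [simp] = rd[OF N(2,3,1)] carrier_matD[OF \<eta>]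
    show "k \<cdot>\<^sub>m y \<in> reach \<rho> U n" for k
    proof -
      have "k \<cdot>\<^sub>m y = rl_lin \<rho> n N (xdir n N h) * (resolvent \<rho> N P * (kron (rl_C \<rho>) (1\<^sub>m N) * (k \<cdot>\<^sub>m \<eta>)))"
        unfolding y by (simp add: mmult_smult_right)
      moreover have "k \<cdot>\<^sub>m \<eta> \<in> carrier_mat N 1" using \<eta> by simp
      ultimately show ?thesis unfolding reach_def mem_Collect_eq using N h by blast
    qed
    show "y + z \<in> reach \<rho> U n" if "z \<in> reach \<rho> U n" for z
    proof -
      from that obtain N' P' \<eta>' h' where N': "1 \<le> N'" "P' \<in> U" "P' \<in> herm_pairs N'" and \<eta>': "\<eta>' \<in> carrier_mat N' 1" and h': "\<And>i. h' i \<in> carrier_mat n N'"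
        and z: "z = rl_lin \<rho> n N' (xdir n N' h') * (resolvent \<rho> N' P' * (kron (rl_C \<rho>) (1\<^sub>m N') * \<eta>'))"
        unfolding reach_def by blast
      note [simp] = rd[OF N'(2,3,1)] carrier_matD[OF \<eta>']
      note j = join_herm(1)[OF N(3)] join_herm(1)[OF N'(3)] and d = U_det[OF N(2,3,1)] U_det[OF N'(2,3,1)]
      let ?E = "inl_mat N N'" and ?F = "inr_mat N N'" and ?Q = "pair_dsum P P'"
      have Q: "?Q \<in> U" "?Q \<in> herm_pairs (N + N')" "1 \<le> N + N'"
        using free_set_dsum[OF free N(2) N'(2)] herm_pairs_dsum[OF N(3) N'(3)] N(1) by simp_all
      note [simp] = rd[OF Q]
      \<comment> \<open>The sum is reached at \<open>P \<oplus> P'\<close> with the block row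
        \<open>[h, h']\<close> and the stacked column of \<open>\<eta>\<close> and
        \<open>\<eta>'\<close>; the mixed terms vanish by orthogonality of the isometries.\<close>
      define h'' where "h'' i = h i * adj ?E + h' i * adj ?F" for i
      define \<eta>'' where "\<eta>'' = ?E * \<eta> + ?F * \<eta>'"
      have h'': "h'' i \<in> carrier_mat n (N + N')" for i
        unfolding h''_def using carrier_matD[OF h[of i]] carrier_matD[OF h'[of i]] by (intro carrier_matI) simp_all
      have \<eta>'': "\<eta>'' \<in> carrier_mat (N + N') 1" unfolding \<eta>''_def by (intro carrier_matI) simp_all
      have x: "(xdir n (N + N') h'' :: 'g + 'h \<Rightarrow> complex mat) = (\<lambda>i. xdir n N h i * adj ?E + xdir n N' h' i * adj ?F)"
      proof (rule ext)
        fix i :: "'g + 'h"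
        show "xdir n (N + N') h'' i = xdir n N h i * adj ?E + xdir n N' h' i * adj ?F"
          by (cases i) (simp_all add: xdir_def h''_def mmult_zero add_zero_mat)
      qed
      have "rl_lin \<rho> n (N + N') (xdir n (N + N') h'') =
          rl_lin \<rho> n (N + N') (\<lambda>i. xdir n N h i * adj ?E) +
          rl_lin \<rho> n (N + N') (\<lambda>i. xdir n N' h' i * adj ?F)"
        unfolding x
        by (rule lin_add_right[OF r(4) mult_carrier_mat[OF xdir_carrier[OF h] adj_carrier[OF inlr_carrier(1)]]
              mult_carrier_mat[OF xdir_carrier[OF h'] adj_carrier[OF inlr_carrier(2)]]])
      also have "rl_lin \<rho> n (N + N') (\<lambda>i. xdir n N h i * adj ?E) =
          rl_lin \<rho> n N (xdir n N h) * ampl ?e (adj ?E)"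
        by (rule lin_kron_ampl[OF r(4) xdir_carrier[OF h] adj_carrier[OF inlr_carrier(1)], symmetric])
      also have "rl_lin \<rho> n (N + N') (\<lambda>i. xdir n N' h' i * adj ?F) =
          rl_lin \<rho> n N' (xdir n N' h') * ampl ?e (adj ?F)"
        by (rule lin_kron_ampl[OF r(4) xdir_carrier[OF h'] adj_carrier[OF inlr_carrier(2)], symmetric])
      finally have l: "rl_lin \<rho> n (N + N') (xdir n (N + N') h'') =
          rl_lin \<rho> n N (xdir n N h) * ampl ?e (adj ?E) +
          rl_lin \<rho> n N' (xdir n N' h') * ampl ?e (adj ?F)" .
      define Y where "Y = resolvent \<rho> N P * (kron (rl_C \<rho>) (1\<^sub>m N) * \<eta>)"
      define Y' where "Y' = resolvent \<rho> N' P' * (kron (rl_C \<rho>) (1\<^sub>m N') * \<eta>')"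
      have [simp]: "dim_row Y = ?e * N" "dim_col Y = 1" "dim_row Y' = ?e * N'" "dim_col Y' = 1" by (simp_all add: Y_def Y'_def)
      have "resolvent \<rho> (N + N') ?Q * (kron (rl_C \<rho>) (1\<^sub>m (N + N')) * \<eta>'') =
         resolvent \<rho> (N + N') ?Q * (kron (rl_C \<rho>) (1\<^sub>m (N + N')) * (?E * \<eta>)) +
         resolvent \<rho> (N + N') ?Q * (kron (rl_C \<rho>) (1\<^sub>m (N + N')) * (?F * \<eta>'))"
        unfolding \<eta>''_def by (simp add: mmult_add_right)
      also have "\<dots> = ampl ?e ?E * Y + ampl ?e ?F * Y'"
        unfolding resolvent_dsum_apply(1)[OF \<rho> j d \<eta>] resolvent_dsum_apply(2)[OF \<rho> j d \<eta>'] Y_def Y'_def ..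
      finally have "rl_lin \<rho> n (N + N') (xdir n (N + N') h'') *
          (resolvent \<rho> (N + N') ?Q * (kron (rl_C \<rho>) (1\<^sub>m (N + N')) * \<eta>'')) =
         rl_lin \<rho> n N (xdir n N h) * Y + rl_lin \<rho> n N' (xdir n N' h') * Y'"
        unfolding l by (simp add: mat_algebra ampl_mult_left inlr add_zero_mat)
      then have "y + z = rl_lin \<rho> n (N + N') (xdir n (N + N') h'') *
          (resolvent \<rho> (N + N') ?Q * (kron (rl_C \<rho>) (1\<^sub>m (N + N')) * \<eta>''))"
        unfolding y z Y_def[symmetric] Y'_def[symmetric] by (rule sym)
      then show ?thesis unfolding reach_def mem_Collect_eq
        by (intro exI[of _ "N + N'"] exI[of _ ?Q] exI[of _ \<eta>''] exI[of _ h''] conjI allI Q h'' \<eta>'')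
    qed
  qed
qed

text \<open>Each slice \<open>ampl e (adj z) * y\<close> is tested with rank-one directions
  \<open>h = z g\<close> in a single variable x. Orthogonality to \<open>reach\<close> places
  \<open>T\<^sub>l\<close> times the slice in \<open>annih\<close>, which is trivial. Hence the
  slice lies in the common kernel of the \<open>T\<^sub>l\<close> and is orthogonal to the range of
  \<open>V_T\<close>.\<close>

lemma reach_perp:
  assumes smr: "is_SMR r \<rho>" and y: "y \<in> carrier_mat (rl_dim \<rho> * n) 1"
    and perp: "\<And>s. s \<in> reach \<rho> U n \<Longrightarrow> adj y * s = 0\<^sub>m 1 1"
  shows "adj (kron (V_T \<rho>) (1\<^sub>m n)) * y = 0\<^sub>m (dim_col (V_T \<rho>) * n) 1"
proof -
  let ?e = "rl_dim \<rho>"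
  define v where "v = dim_col (V_T \<rho>)"
  have [simp]: "dim_col (V_T \<rho>) = v" by (simp add: v_def)
  note r = rl_carriers[OF \<rho>]
  note [simp] = carrier_matD(1)[OF V_T_props(1)[OF \<rho>]] r(4)[unfolded carrier_mat_iff] carrier_matD[OF y]
  have T: "rl_T \<rho> l * (ampl ?e (adj z) * y) = 0\<^sub>m ?e 1" if z: "z \<in> carrier_mat n 1" for z l
  proof -
    note [simp] = carrier_matD[OF z]
    define u where "u = coeffs \<rho> (Inl l) * (ampl ?e (adj z) * y)"
    have uc: "u \<in> carrier_mat ?e 1" unfolding u_def by (rule carrier_matI) simp_all
    note [simp] = carrier_matD[OF uc]
    have au: "adj u = adj y * (ampl ?e z * coeffs \<rho> (Inl l))" by (simp add: u_def mat_algebra adj_ampl r(5))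
    have "u \<in> annih \<rho> U"
    proof (rule annihI[OF uc])
      fix N P assume N: "1 \<le> N" "P \<in> U" "P \<in> herm_pairs N"
      note i = resolvent_inverse[OF \<rho> join_herm(1)[OF N(3)] U_det[OF N(2,3,1)]]
      define X where "X = resolvent \<rho> N P * kron (rl_C \<rho>) (1\<^sub>m N)"
      have Xc: "X \<in> carrier_mat (?e * N) N"
        unfolding X_def using mult_carrier_mat[OF i(1) kron_carrier[OF r(7) one_carrier_mat]] by simp
      note [simp] = carrier_matD[OF Xc] carrier_matD[OF i(1)]
      have hz: "g * (adj (kron u (1\<^sub>m N)) * X) = 0\<^sub>m 1 N" if g: "g \<in> carrier_mat 1 N" for g
      proof (rule mat_eq_zeroI)
        note [simp] = carrier_matD[OF g]
        show "g * (adj (kron u (1\<^sub>m N)) * X) \<in> carrier_mat 1 N" by (rule carrier_matI) simp_all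
        fix \<eta> :: "complex mat" assume \<eta>: "\<eta> \<in> carrier_mat N 1"
        note [simp] = carrier_matD[OF \<eta>]
        define h where "h = (\<lambda>i. if i = l then z * g else 0\<^sub>m n N)"
        have h: "h i \<in> carrier_mat n N" for i unfolding h_def by (rule carrier_matI) simp_all
        have "rl_lin \<rho> n N (xdir n N h) * (resolvent \<rho> N P * (kron (rl_C \<rho>) (1\<^sub>m N) * \<eta>)) \<in> reach \<rho> U n"
          unfolding reach_def using N \<eta> h by blast
        from perp[OF this] have p: "adj y * (rl_lin \<rho> n N (xdir n N h) * (X * \<eta>)) = 0\<^sub>m 1 1"
          by (simp add: X_def mmult_assoc)
        have "kron (coeffs \<rho> j) (xdir n N h j) = (if j = Inl l then kron (coeffs \<rho> (Inl l)) (z * g) else 0\<^sub>m (?e * n) (?e * N))" for j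
          by (cases j) (simp_all add: xdir_def h_def kron_zero)
        then have "rl_lin \<rho> n N (xdir n N h) = kron (coeffs \<rho> (Inl l)) (z * g)"
          unfolding lin_def by (intro eq_matI) (auto simp: index_mat_sum if_distrib[of "\<lambda>A. A $$ _"] cong: if_cong)
        also have "\<dots> = ampl ?e z * (kron (coeffs \<rho> (Inl l)) (1\<^sub>m 1) * ampl ?e g)"
          unfolding ampl_def by (subst kron_mult, simp, simp, subst kron_mult) (simp_all add: mmult_one)
        finally have k: "rl_lin \<rho> n N (xdir n N h) = ampl ?e z * (coeffs \<rho> (Inl l) * ampl ?e g)" by simp
        have "adj u * ampl ?e g = g * adj (kron u (1\<^sub>m N))"
        proof -
          have "kron u (1\<^sub>m N) * adj g = ampl ?e (adj g) * kron u (1\<^sub>m 1)" by (rule kron_ampl_one[OF uc adj_carrier[OF g]])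
          then have "adj (kron u (1\<^sub>m N) * adj g) = adj (ampl ?e (adj g) * u)" by simp
          then show ?thesis by (simp add: adj_mult adj_ampl)
        qed
        from this[symmetric] have "g * (adj (kron u (1\<^sub>m N)) * (X * \<eta>)) = adj u * ampl ?e g * (X * \<eta>)"
          by (rule mult_eq_assoc) simp_all
        also have "\<dots> = adj u * (ampl ?e g * (X * \<eta>))" by (simp add: mmult_assoc)
        finally have "g * (adj (kron u (1\<^sub>m N)) * (X * \<eta>)) = adj u * (ampl ?e g * (X * \<eta>))" .
        also have "\<dots> = 0\<^sub>m 1 1" using p unfolding k au by (simp add: mmult_assoc)
        finally show "g * (adj (kron u (1\<^sub>m N)) * X) * \<eta> = 0\<^sub>m 1 1" by (simp add: mmult_assoc)
      qed
      have "adj (kron u (1\<^sub>m N)) * X = 0\<^sub>m N N"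
      proof (rule mat_zero_by_rows)
        show "adj (kron u (1\<^sub>m N)) * X \<in> carrier_mat N N" by (rule carrier_matI) simp_all
      qed (rule hz)
      then show "adj (kron u (1\<^sub>m N)) * (resolvent \<rho> N P * kron (rl_C \<rho>) (1\<^sub>m N)) = 0\<^sub>m N N" by (simp add: X_def)
    qed
    then have "u = 0\<^sub>m ?e 1" by (rule annih_trivial[OF smr])
    then show ?thesis by (simp add: u_def coeffs_def)
  qed
  have "adj (kron (V_T \<rho>) (1\<^sub>m n)) * y = 0\<^sub>m (v * n) 1"
  proof (rule ampl_adj_zero)
    show "adj (kron (V_T \<rho>) (1\<^sub>m n)) * y \<in> carrier_mat (v * n) 1" by (rule carrier_matI) simp_all
    fix z :: "complex mat" assume z: "z \<in> carrier_mat n 1"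
    note [simp] = carrier_matD[OF z]
    have c: "ampl ?e (adj z) * y \<in> carrier_mat ?e 1" by (rule carrier_matI) simp_all
    have "ampl v (adj z) * kron (adj (V_T \<rho>)) (1\<^sub>m n) = adj (V_T \<rho>) * ampl ?e (adj z)"
    proof -
      have "ampl v (adj z) * kron (adj (V_T \<rho>)) (1\<^sub>m n) = kron (adj (V_T \<rho>)) (adj z)"
        unfolding ampl_def by (subst kron_mult) (simp_all add: mmult_one)
      also have "\<dots> = kron (adj (V_T \<rho>)) (1\<^sub>m 1) * ampl ?e (adj z)"
        unfolding ampl_def by (subst kron_mult) (simp_all add: mmult_one)
      finally show ?thesis by simp
    qed
    then have "ampl v (adj z) * (kron (adj (V_T \<rho>)) (1\<^sub>m n) * y) = adj (V_T \<rho>) * ampl ?e (adj z) * y"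
      by (rule mult_eq_assoc) simp_all
    also have "\<dots> = adj (V_T \<rho>) * (ampl ?e (adj z) * y)" by (rule mmult_assoc) simp_all
    also have "\<dots> = 0\<^sub>m v 1" using V_T_props(4)[OF \<rho> c T[OF z]] by simp
    finally show "ampl v (adj z) * (adj (kron (V_T \<rho>) (1\<^sub>m n)) * y) = 0\<^sub>m v 1" by (simp add: adj_kron)
  qed
  then show ?thesis by simp
qed

text \<open>By \<open>subspace_double_perp\<close> and \<open>reach_perp\<close> every vector
  \<open>V w\<close> is reachable from some \<open>P\<close>. The second-order inequality at
  \<open>(A, X) \<oplus> P\<close>, with the off-diagonal direction and a column supported on the
  second summand, yields the vector \<open>V w\<close> in the first summand, where the resolvent is
  that of \<open>(A, X)\<close>.\<close>

lemma R_T_psd: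
  assumes smr: "is_SMR r \<rho>" and D: "domain_of_partial_convexity \<rho> D" and UD: "U \<subseteq> D"
    and n: "1 \<le> n" and pD: "(A, X) \<in> D" and p: "(A, X) \<in> herm_pairs n"
  shows "psd_mat (dim_col (V_T \<rho>) * n) (R_T \<rho> n (A, X))"
proof -
  let ?e = "rl_dim \<rho>"
  define v where "v = dim_col (V_T \<rho>)"
  note r = rl_carriers[OF \<rho>]
  have Dr: "D \<subseteq> rl_dom \<rho>" and fD: "free_set D"
    using D by (simp_all add: domain_of_partial_convexity_def r_convex_in_x_def)
  note j = join_herm(1)[OF p]
  have d: "det (pencil \<rho> n (A, X)) \<noteq> 0" using rl_dom_iff[OF p n, of \<rho>] Dr pD by blast
  note i = resolvent_inverse[OF \<rho> j d]
  define V1 where "V1 = kron (V_T \<rho>) (1\<^sub>m n)"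
  have V1: "V1 \<in> carrier_mat (?e * n) (v * n)"
    unfolding V1_def v_def by (rule kron_carrier[OF V_T_props(1)[OF \<rho>] one_carrier_mat])
  note [simp] = carrier_matD[OF i(1)] carrier_matD[OF V1]
  have a: "adj (resolvent \<rho> n (A, X)) = resolvent \<rho> n (A, X)"
    by (rule hermitian_inverse[OF pencil_carrier[OF \<rho> j] i(1,2) pencil_hermitian[OF \<rho> p]])
  note R = R_T_eq[OF \<rho> j d, folded V1_def]
  have "psd_mat (v * n) (adj V1 * (resolvent \<rho> n (A, X) * V1))"
    unfolding psd_mat_iff
  proof (intro conjI ballI)
    show "adj V1 * (resolvent \<rho> n (A, X) * V1) \<in> carrier_mat (v * n) (v * n)" by (rule carrier_matI) simp_all
    show "adj (adj V1 * (resolvent \<rho> n (A, X) * V1)) = adj V1 * (resolvent \<rho> n (A, X) * V1)" by (simp add: mat_algebra a)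
    fix w :: "complex mat" assume w: "w \<in> carrier_mat (v * n) 1"
    note [simp] = carrier_matD[OF w]
    have Vw: "V1 * w \<in> carrier_mat (?e * n) 1" by (rule mult_carrier_mat[OF V1 w])
    have "V1 * w \<in> reach \<rho> U n"
    proof (rule subspace_double_perp[OF reach_subspace Vw])
      fix y :: "complex mat" assume y: "y \<in> carrier_mat (?e * n) 1" and perp: "\<And>s. s \<in> reach \<rho> U n \<Longrightarrow> adj y * s = 0\<^sub>m 1 1"
      note [simp] = carrier_matD[OF y]
      have "adj V1 * y = 0\<^sub>m (v * n) 1" unfolding V1_def v_def by (rule reach_perp[OF smr y perp])
      then have "adj (adj V1 * y) = 0\<^sub>m 1 (v * n)" by simp
      then have "adj y * V1 = 0\<^sub>m 1 (v * n)" by (simp add: adj_mult)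
      then have "adj y * (V1 * w) = 0\<^sub>m 1 (v * n) * w" by (rule mult_eq_assoc) simp_all
      then show "adj y * (V1 * w) = 0\<^sub>m 1 1" by (simp add: mmult_zero)
    qed
    then obtain N P \<eta> h where N: "1 \<le> N" "P \<in> U" "P \<in> herm_pairs N" and \<eta>: "\<eta> \<in> carrier_mat N 1" and h: "\<And>i. h i \<in> carrier_mat n N"
      and y: "V1 * w = rl_lin \<rho> n N (xdir n N h) * (resolvent \<rho> N P * (kron (rl_C \<rho>) (1\<^sub>m N) * \<eta>))"
      unfolding reach_def by blast
    note jP = join_herm(1)[OF N(3)] and dP = U_det[OF N(2,3,1)]
    note iP = resolvent_inverse[OF \<rho> jP dP]
    note [simp] = carrier_matD[OF iP(1)] carrier_matD[OF \<eta>]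
    let ?E = "inl_mat n N" and ?F = "inr_mat n N" and ?Q = "pair_dsum (A, X) P"
    \<comment> \<open>The direct sum is formed in \<open>D\<close>, whose freeness is used here:
      \<open>P\<close> lies in \<open>U\<close>, but \<open>(A, X)\<close> is an arbitrary point of
      \<open>D\<close>.\<close>
    have Q: "?Q \<in> D" "?Q \<in> herm_pairs (n + N)" "1 \<le> n + N"
      using free_set_dsum[OF fD pD subsetD[OF UD N(2)]] herm_pairs_dsum[OF p N(3)] n by simp_all
    obtain B Y where BY: "?Q = (B, Y)" by (cases ?Q)
    define h' where "h' = offdiag n N h"
    have h': "h' i \<in> carrier_mat (n + N) (n + N)" "adj (h' i) = h' i" for i
      unfolding h'_def by (rule offdiag_hermitian[where q = h, OF h])+
    have x: "xdir (n + N) (n + N) h' = (offdiag n N (xdir n N h) :: 'g + 'h \<Rightarrow> complex mat)"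
    proof (rule ext)
      fix i :: "'g + 'h"
      show "xdir (n + N) (n + N) h' i = offdiag n N (xdir n N h) i"
        by (cases i) (simp_all add: xdir_def h'_def offdiag_def mmult_zero add_zero_mat)
    qed
    let ?R = "resolvent \<rho> (n + N) ?Q"
    define Z where "Z = resolvent \<rho> N P * (kron (rl_C \<rho>) (1\<^sub>m N) * \<eta>)"
    have [simp]: "dim_row Z = ?e * N" "dim_col Z = 1" by (simp_all add: Z_def)
    have "rl_lin \<rho> (n + N) (n + N) (xdir (n + N) (n + N) h') * (?R * (kron (rl_C \<rho>) (1\<^sub>m (n + N)) * (?F * \<eta>))) =
      rl_lin \<rho> (n + N) (n + N) (offdiag n N (xdir n N h)) * (ampl ?e ?F * Z)"
      unfolding x resolvent_dsum_apply(2)[OF \<rho> j jP d dP \<eta>] Z_def ..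
    also have "\<dots> = ampl ?e ?E * rl_lin \<rho> n N (xdir n N h) * Z"
      by (rule mult_eq_assoc[OF lin_offdiag_inr[OF r(4) xdir_carrier[OF h]]]) simp_all
    also have "\<dots> = ampl ?e ?E * (V1 * w)" unfolding y Z_def by (simp add: mmult_assoc)
    finally have e: "rl_lin \<rho> (n + N) (n + N) (xdir (n + N) (n + N) h') * (?R * (kron (rl_C \<rho>) (1\<^sub>m (n + N)) * (?F * \<eta>))) =
      ampl ?e ?E * (V1 * w)" .
    have F\<eta>: "?F * \<eta> \<in> carrier_mat (n + N) 1" by (rule carrier_matI) simp_all
    have "0 \<le> qform ?R (ampl ?e ?E * (V1 * w))"
      using second_order_nonneg[where h = h', OF \<rho> D Q(3) Q(1,2)[unfolded BY] h' F\<eta>] unfolding BY[symmetric] e .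
    also have "qform ?R (ampl ?e ?E * (V1 * w)) = qform (adj (ampl ?e ?E) * (?R * ampl ?e ?E)) (V1 * w)"
    proof (rule qform_congruence[symmetric, OF _ _ Vw])
      have "det (pencil \<rho> (n + N) ?Q) \<noteq> 0" by (rule resolvent_dsum(1)[OF \<rho> j jP d dP])
      then show "?R \<in> carrier_mat (?e * (n + N)) (?e * (n + N))" by (rule resolvent_inverse(1)[OF \<rho> join_herm(1)[OF Q(2)]])
      show "ampl ?e ?E \<in> carrier_mat (?e * (n + N)) (?e * n)" by (rule carrier_matI) simp_all
    qed
    also have "adj (ampl ?e ?E) * (?R * ampl ?e ?E) = resolvent \<rho> n (A, X)"
      unfolding resolvent_dsum_ampl(2)[OF \<rho> j jP d dP] by (simp add: adj_ampl ampl_mult_left inlr mmult_one)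
    also have "qform (resolvent \<rho> n (A, X)) (V1 * w) = qform (adj V1 * (resolvent \<rho> n (A, X) * V1)) w"
      by (rule qform_congruence[OF i(1) V1 w, symmetric])
    finally show "0 \<le> qform (adj V1 * (resolvent \<rho> n (A, X) * V1)) w" .
  qed
  then show ?thesis unfolding R v_def .
qed

end

theorem theorem1p1:
  fixes r :: "('h::finite, 'g::finite) nc_expr"
    and \<rho> :: "('h, 'g) realization"
  assumes "nc_symmetric r"
    and "regular_at_origin r"
    and "is_SMR r \<rho>"
  shows "domain_of_partial_convexity \<rho> (rl_dom_plus \<rho>) \<and>
    (\<forall>D. D \<subseteq> rl_dom \<rho> \<longrightarrow> full_domain_of_partial_convexity \<rho> D \<longrightarrow>
       D \<subseteq> rl_dom_plus \<rho> \<and> full_domain_of_partial_convexity \<rho> (rl_dom_plus \<rho>))"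
proof (intro conjI allI impI)
  have \<rho>: "sym_realization \<rho>" using assms(3) by (simp add: is_SMR_def)
  show dom_plus: "domain_of_partial_convexity \<rho> (rl_dom_plus \<rho>)" by (rule domain_rl_dom_plus[OF \<rho>])
  fix D assume D: "D \<subseteq> rl_dom \<rho>" and full: "full_domain_of_partial_convexity \<rho> D"
  then obtain U where pc: "domain_of_partial_convexity \<rho> D" and U: "U \<subseteq> D" "free_set U" "open_graded U" "U \<inter> herm_pairs 1 \<noteq> {}"
    unfolding full_domain_of_partial_convexity_def by blast
  then obtain p0 where p0: "p0 \<in> U" "p0 \<in> herm_pairs 1" by blast
  have UD: "U \<subseteq> rl_dom \<rho>" using U(1) D by (rule subset_trans)
  interpret free_open_subdomain \<rho> U p0
    by unfold_locales (fact \<rho> U(2,3) UD p0)+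
  show sub: "D \<subseteq> rl_dom_plus \<rho>"
  proof
    fix p assume p: "p \<in> D"
    obtain A X where AX: "p = (A, X)" by (cases p)
    obtain n where n: "1 \<le> n" "p \<in> herm_pairs n" "det (pencil \<rho> n p) \<noteq> 0"
      using p D unfolding rl_dom_def by auto
    have "psd_mat (dim_col (V_T \<rho>) * n) (R_T \<rho> n (A, X))"
      by (rule R_T_psd[OF assms(3) pc U(1) n(1) p[unfolded AX] n(2)[unfolded AX]])
    then show "p \<in> rl_dom_plus \<rho>" unfolding rl_dom_plus_iff[OF n(2,1)] using n(3) AX by simp
  qed
  \<comment> \<open>The same \<open>U\<close> is the witness, as it lies in \<open>D\<close> and
    \<open>D\<close> in the positive part.\<close>
  show "full_domain_of_partial_convexity \<rho> (rl_dom_plus \<rho>)"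
    unfolding full_domain_of_partial_convexity_def using dom_plus U subset_trans[OF U(1) sub] by blast
qed

end
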